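(* Let $R$ be a commutative Noetherian ring, $\mathfrak a$ a proper ideal of $R$, and $M$ a finitely generated $R$-module. Let $(0)=\bigcap_{i=1}^nN_i$ be a reduced primary decomposition of $(0)$ in $M$, where $N_i$ is $\mathfrak p_i$-primary, and let $M_i=\bigcap_{\operatorname{cd}(\mathfrak a,R/\mathfrak p_j)>i}N_j$ for all $0\le i\le c=\operatorname{cd}(\mathfrak a,M)$ (an empty intersection being $M$). Assume that $\operatorname{cd}\bigl(\mathfrak a,\bigcap_{\operatorname{cd}(\mathfrak a,R/\mathfrak p_j)>0}N_j\bigr)=0$. Then $\{M_i\}_{i=0}^c$ is the cohomological dimension filtration of $M$ with respect to $\mathfrak a$.
   Context: $H^i_{\mathfrak a}(-)$ denotes local cohomology with respect to $\mathfrak a$ and $\operatorname{cd}(\mathfrak a,N)=\sup\{i\in\mathbb Z\mid H^i_{\mathfrak a}(N)\neq0\}$. A primary decomposition is reduced if the primes $\mathfrak p_i$ are pairwise distinct and no $N_i$ can be omitted from the intersection. The cohomological dimension filtration (cd-filtration) of a finitely generated $R$-module $M$ with $c=\operatorname{cd}(\mathfrak a,M)$ is the increasing filtration $\{M_i\}_{i=0}^c$ of submodules of $M$ in which $M_i$ is the largest submodule of $M$ with $\operatorname{cd}(\mathfrak a,M_i)\le i$. *)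

theory Defs
  imports
    "HOL-Algebra.Module"
    "HOL-Algebra.Ideal_Product"
    "HOL-Algebra.Ring_Divisibility"
    "HOL-Library.Extended_Real"
begin

text \<open>
  A submodule \<open>N\<close> of \<open>M\<close> is a subset of the carrier (library predicate \<open>submodule\<close>); regarded as
  a module in its own right it is \<open>M\<lparr>carrier := N\<rparr>\<close>.  The fields \<open>mult\<close> and \<open>one\<close> of a module
  record play no role in \<open>module R M\<close>, hence they are left unspecified below.
\<close>

definition regular_module :: "('a, 'r) ring_scheme \<Rightarrow> ('a, 'a) module" where
  "regular_module R =
     \<lparr>carrier = carrier R, monoid.mult = undefined, one = undefined,
      zero = \<zero>\<^bsub>R\<^esub>, add = add R, smult = monoid.mult R\<rparr>"

definition quot_module :: "('a, 'b, 'm) module_scheme \<Rightarrow> 'b set \<Rightarrow> ('a, 'b set) module" where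
  "quot_module M N =
     \<lparr>carrier = a_rcosets\<^bsub>M\<^esub> N, monoid.mult = undefined, one = undefined,
      zero = N, add = set_add M, smult = (\<lambda>r X. \<Union>x\<in>X. N +>\<^bsub>M\<^esub> (r \<odot>\<^bsub>M\<^esub> x))\<rparr>"

definition mod_hom ::
  "('a, 'r) ring_scheme \<Rightarrow> ('a, 'b, 'm) module_scheme \<Rightarrow> ('a, 'c, 'n) module_scheme \<Rightarrow> ('b \<Rightarrow> 'c) set"
  where
  "mod_hom R M N =
     {f \<in> carrier M \<rightarrow> carrier N.
        (\<forall>x\<in>carrier M. \<forall>y\<in>carrier M. f (x \<oplus>\<^bsub>M\<^esub> y) = f x \<oplus>\<^bsub>N\<^esub> f y) \<and>
        (\<forall>r\<in>carrier R. \<forall>x\<in>carrier M. f (r \<odot>\<^bsub>M\<^esub> x) = r \<odot>\<^bsub>N\<^esub> f x)}"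

definition fg_module :: "('a, 'r) ring_scheme \<Rightarrow> ('a, 'b, 'm) module_scheme \<Rightarrow> bool" where
  "fg_module R M \<longleftrightarrow> module R M \<and>
     (\<exists>S. finite S \<and> S \<subseteq> carrier M \<and> (\<forall>N. submodule N R M \<and> S \<subseteq> N \<longrightarrow> N = carrier M))"

text \<open>
  The test modules \<open>B\<close> range over the modules whose elements have the same type as those of \<open>E\<close>.
  By Baer's criterion this is injectivity with respect to all modules as soon as that type contains
  a copy of \<open>R\<close>, as the type of the resolutions used below does.
\<close>

definition injective_module :: "('a, 'r) ring_scheme \<Rightarrow> ('a, 'e) module \<Rightarrow> bool" where
  "injective_module R E \<longleftrightarrow> module R E \<and>
     (\<forall>(B :: ('a, 'e) module) A f.
        module R B \<and> submodule A R B \<and> f \<in> mod_hom R (B\<lparr>carrier := A\<rparr>) E \<longrightarrow>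
        (\<exists>g\<in>mod_hom R B E. \<forall>x\<in>A. g x = f x))"

definition injective_resolution ::
  "('a, 'r) ring_scheme \<Rightarrow> ('a, 'b, 'm) module_scheme \<Rightarrow>
   (nat \<Rightarrow> ('a, 'e) module) \<Rightarrow> ('b \<Rightarrow> 'e) \<Rightarrow> (nat \<Rightarrow> 'e \<Rightarrow> 'e) \<Rightarrow> bool" where
  "injective_resolution R N E \<epsilon> d \<longleftrightarrow>
     (\<forall>k. injective_module R (E k)) \<and>
     \<epsilon> \<in> mod_hom R N (E 0) \<and> inj_on \<epsilon> (carrier N) \<and>
     (\<forall>k. d k \<in> mod_hom R (E k) (E (Suc k))) \<and>
     \<epsilon> ` carrier N = {x \<in> carrier (E 0). d 0 x = \<zero>\<^bsub>E 1\<^esub>} \<and>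
     (\<forall>k. d k ` carrier (E k) = {x \<in> carrier (E (Suc k)). d (Suc k) x = \<zero>\<^bsub>E (Suc (Suc k))\<^esub>})"

text \<open>
  HOL cannot quantify over all types, so the resolutions are taken with elements in one type that is
  large enough to resolve every module over a ring on \<open>'a\<close> with elements in \<open>'b\<close>: it contains \<open>'b\<close>
  and is closed under sequences and under families indexed by \<open>'a\<close>.  Indeed, if the elements of a
  module \<open>A\<close> lie in this type, so do (up to isomorphism) those of a divisible abelian group
  \<open>D \<supseteq> A\<close>, namely a quotient of the finitely supported functions from \<open>A\<close> to the rationals, those of
  the injective module of additive maps from \<open>R\<close> to \<open>D\<close>, in which \<open>A\<close> embeds, and those of the
  cokernel of this embedding (choose a representative of each coset).
\<close>

datatype ('a, 'b) resol_elem =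
    Elem 'b
  | Seq "nat \<Rightarrow> ('a, 'b) resol_elem"
  | Fam "'a \<Rightarrow> ('a, 'b) resol_elem"

definition torsion_part ::
  "('a, 'r) ring_scheme \<Rightarrow> 'a set \<Rightarrow> ('a, 'b, 'm) module_scheme \<Rightarrow> 'b set" where
  "torsion_part R \<aa> N =
     {x \<in> carrier N. \<exists>n::nat. \<forall>r \<in> \<aa> [^]\<^bsub>ideals_set R\<^esub> n. r \<odot>\<^bsub>N\<^esub> x = \<zero>\<^bsub>N\<^esub>}"

text \<open>
  The \<open>i\<close>-th right derived functor of the \<open>\<aa>\<close>-torsion functor: the cohomology in degree \<open>i\<close> of the
  \<open>\<aa>\<close>-torsion part of a chosen injective resolution, which does not depend on \<open>i\<close>.
\<close>

definition chosen_resolution ::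
  "('a, 'r) ring_scheme \<Rightarrow> ('a, 'b, 'm) module_scheme \<Rightarrow>
   (nat \<Rightarrow> ('a, ('a, 'b) resol_elem) module) \<times> ('b \<Rightarrow> ('a, 'b) resol_elem) \<times>
   (nat \<Rightarrow> ('a, 'b) resol_elem \<Rightarrow> ('a, 'b) resol_elem)" where
  "chosen_resolution R N = (SOME (E, \<epsilon>, d). injective_resolution R N E \<epsilon> d)"

definition local_cohomology ::
  "('a, 'r) ring_scheme \<Rightarrow> 'a set \<Rightarrow> nat \<Rightarrow> ('a, 'b, 'm) module_scheme \<Rightarrow>
   ('a, ('a, 'b) resol_elem set) module" where
  "local_cohomology R \<aa> i N =
     (let (E, \<epsilon>, d) = chosen_resolution R N;
          Z = {x \<in> torsion_part R \<aa> (E i). d i x = \<zero>\<^bsub>E (Suc i)\<^esub>};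
          B = (case i of 0 \<Rightarrow> {\<zero>\<^bsub>E 0\<^esub>} | Suc k \<Rightarrow> d k ` torsion_part R \<aa> (E k))
      in quot_module ((E i)\<lparr>carrier := Z\<rparr>) B)"

text \<open>
  Local cohomology vanishes in negative degrees.  The supremum of the empty set is \<open>-\<infinity>\<close>; in
  particular this is the cohomological dimension of the zero module.
\<close>

definition cd :: "('a, 'r) ring_scheme \<Rightarrow> 'a set \<Rightarrow> ('a, 'b, 'm) module_scheme \<Rightarrow> ereal" where
  "cd R \<aa> N =
     Sup {ereal (real i) | i. carrier (local_cohomology R \<aa> i N) \<noteq> {\<zero>\<^bsub>local_cohomology R \<aa> i N\<^esub>}}"

definition primary_submodule ::
  "('a, 'r) ring_scheme \<Rightarrow> ('a, 'b, 'm) module_scheme \<Rightarrow> 'a set \<Rightarrow> 'b set \<Rightarrow> bool" where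
  "primary_submodule R M \<pp> N \<longleftrightarrow>
     submodule N R M \<and> N \<noteq> carrier M \<and>
     (\<forall>r\<in>carrier R. \<forall>x\<in>carrier M. r \<odot>\<^bsub>M\<^esub> x \<in> N \<longrightarrow>
        x \<in> N \<or> (\<exists>k::nat. \<forall>y\<in>carrier M. (r [^]\<^bsub>R\<^esub> k) \<odot>\<^bsub>M\<^esub> y \<in> N)) \<and>
     \<pp> = {r \<in> carrier R. \<exists>k::nat. \<forall>y\<in>carrier M. (r [^]\<^bsub>R\<^esub> k) \<odot>\<^bsub>M\<^esub> y \<in> N}"

text \<open>
  Intersections of submodules of \<open>M\<close> are intersected with \<open>carrier M\<close>, so that the empty one is \<open>M\<close>.
\<close>

definition reduced_primary_decomposition_of_zero ::
  "('a, 'r) ring_scheme \<Rightarrow> ('a, 'b, 'm) module_scheme \<Rightarrow> nat \<Rightarrow> (nat \<Rightarrow> 'a set) \<Rightarrow> (nat \<Rightarrow> 'b set) \<Rightarrow> bool"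
  where
  "reduced_primary_decomposition_of_zero R M n \<pp> N \<longleftrightarrow>
     (\<forall>i\<in>{1..n}. primary_submodule R M (\<pp> i) (N i)) \<and>
     carrier M \<inter> (\<Inter>i\<in>{1..n}. N i) = {\<zero>\<^bsub>M\<^esub>} \<and>
     inj_on \<pp> {1..n} \<and>
     (\<forall>i\<in>{1..n}. carrier M \<inter> (\<Inter>j\<in>{1..n} - {i}. N j) \<noteq> {\<zero>\<^bsub>M\<^esub>})"

text \<open>Only the members \<open>F i\<close> with \<open>0 \<le> i \<le> cd R \<aa> M\<close> belong to the filtration.\<close>

definition is_cd_filtration ::
  "('a, 'r) ring_scheme \<Rightarrow> 'a set \<Rightarrow> ('a, 'b, 'm) module_scheme \<Rightarrow> (nat \<Rightarrow> 'b set) \<Rightarrow> bool" where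
  "is_cd_filtration R \<aa> M F \<longleftrightarrow>
     (\<forall>i j. i \<le> j \<and> ereal (real j) \<le> cd R \<aa> M \<longrightarrow> F i \<subseteq> F j) \<and>
     (\<forall>i. ereal (real i) \<le> cd R \<aa> M \<longrightarrow>
        submodule (F i) R M \<and> cd R \<aa> (M\<lparr>carrier := F i\<rparr>) \<le> ereal (real i) \<and>
        (\<forall>L. submodule L R M \<and> cd R \<aa> (M\<lparr>carrier := L\<rparr>) \<le> ereal (real i) \<longrightarrow> L \<subseteq> F i))"

end

theory Submission
  imports Defs "HOL-Algebra.IntRing" "HOL-Library.Countable"
begin

text \<open>
  The key point is that the cohomological dimension of a finitely generated module \<open>L\<close> dominates
  that of \<open>R/q\<close> for every prime \<open>q\<close> containing the annihilator of \<open>L\<close>, and that conversely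
  \<open>H\<^sup>k(L)\<close> vanishes as soon as all these \<open>H\<^sup>k(R/q)\<close> do (filter \<open>L\<close> by copies of modules \<open>R/q\<close>).
  Granting this, a product of elements taken from the powers of the primes \<open>\<pp>\<^sub>j\<close> with
  \<open>cd(R/\<pp>\<^sub>j) \<le> i\<close> annihilates \<open>M\<^sub>i\<close>, so every prime containing its annihilator contains one of these
  \<open>\<pp>\<^sub>j\<close>, and \<open>cd M\<^sub>i \<le> i\<close>. If \<open>L\<close> is not contained in \<open>N\<^sub>j\<close>, then \<open>\<pp>\<^sub>j\<close> contains the annihilator of
  \<open>L\<close>, so \<open>cd(R/\<pp>\<^sub>j) \<le> cd L\<close>; hence every \<open>L\<close> with \<open>cd L \<le> i\<close> lies in \<open>M\<^sub>i\<close>.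

  Local cohomology enters only through the vanishing consequences of the long exact sequence and
  the vanishing in degrees larger than the number of generators of \<open>\<aa>\<close>. Since modules over
  different types have resolutions over different types, injectivity is handled through Baer's
  criterion, which does not depend on a type of test modules.
\<close>

subsection \<open>Modules, submodules and homomorphisms\<close>

text \<open>The hard direction is the passage of vanishing from \<open>L\<close> to
  \<open>R/q\<close>, since in general \<open>R/q\<close> is neither a submodule nor a quotient of
  \<open>L\<close>. Instead of localising at \<open>q\<close>, an element \<open>t\<close> outside
  \<open>q\<close> with \<open>t L \<subseteq> L' + R x\<close> is fixed, and
  \<open>t y \<equiv> r x\<close> modulo \<open>L'\<close> sends \<open>y\<close> to the class of
  \<open>r\<close>. The image of this map inherits vanishing in degree \<open>k\<close> once its
  kernel \<open>L'\<close> has vanishing in degree \<open>k + 1\<close>. This forces a descending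
  induction, and with it a bound, uniform over all modules, beyond which cohomology vanishes. That
  bound is obtained without Cech complexes: torsion is imposed for one generator of \<aa> at a time,
  and each generator costs one degree. Vanishing is read off elementwise from the torsion part of
  any resolution satisfying Baer's condition, whatever its element type. For a short exact sequence,
  the horseshoe lemma supplies a resolution of the middle term that splits degreewise, so that
  torsion can be taken componentwise.\<close>

lemma moduleI':
  fixes R (structure) and M (structure)
  assumes "cring R"
    and "\<And>x y. x \<in> carrier M \<Longrightarrow> y \<in> carrier M \<Longrightarrow> x \<oplus>\<^bsub>M\<^esub> y \<in> carrier M"
    and "\<zero>\<^bsub>M\<^esub> \<in> carrier M"
    and "\<And>x y z. x \<in> carrier M \<Longrightarrow> y \<in> carrier M \<Longrightarrow> z \<in> carrier M \<Longrightarrow>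
           x \<oplus>\<^bsub>M\<^esub> y \<oplus>\<^bsub>M\<^esub> z = x \<oplus>\<^bsub>M\<^esub> (y \<oplus>\<^bsub>M\<^esub> z)"
    and "\<And>x y. x \<in> carrier M \<Longrightarrow> y \<in> carrier M \<Longrightarrow> x \<oplus>\<^bsub>M\<^esub> y = y \<oplus>\<^bsub>M\<^esub> x"
    and "\<And>x. x \<in> carrier M \<Longrightarrow> \<zero>\<^bsub>M\<^esub> \<oplus>\<^bsub>M\<^esub> x = x"
    and "\<And>x. x \<in> carrier M \<Longrightarrow> \<exists>y\<in>carrier M. y \<oplus>\<^bsub>M\<^esub> x = \<zero>\<^bsub>M\<^esub>"
    and "\<And>a x. a \<in> carrier R \<Longrightarrow> x \<in> carrier M \<Longrightarrow> a \<odot>\<^bsub>M\<^esub> x \<in> carrier M"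
    and "\<And>a b x. a \<in> carrier R \<Longrightarrow> b \<in> carrier R \<Longrightarrow> x \<in> carrier M \<Longrightarrow>
           (a \<oplus> b) \<odot>\<^bsub>M\<^esub> x = a \<odot>\<^bsub>M\<^esub> x \<oplus>\<^bsub>M\<^esub> b \<odot>\<^bsub>M\<^esub> x"
    and "\<And>a x y. a \<in> carrier R \<Longrightarrow> x \<in> carrier M \<Longrightarrow> y \<in> carrier M \<Longrightarrow>
           a \<odot>\<^bsub>M\<^esub> (x \<oplus>\<^bsub>M\<^esub> y) = a \<odot>\<^bsub>M\<^esub> x \<oplus>\<^bsub>M\<^esub> a \<odot>\<^bsub>M\<^esub> y"
    and "\<And>a b x. a \<in> carrier R \<Longrightarrow> b \<in> carrier R \<Longrightarrow> x \<in> carrier M \<Longrightarrow>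
           (a \<otimes> b) \<odot>\<^bsub>M\<^esub> x = a \<odot>\<^bsub>M\<^esub> (b \<odot>\<^bsub>M\<^esub> x)"
    and "\<And>x. x \<in> carrier M \<Longrightarrow> \<one> \<odot>\<^bsub>M\<^esub> x = x"
  shows "module R M"
proof (rule moduleI[OF assms(1) _ assms(8-12)])
  show "abelian_group M"
    by (rule abelian_groupI) (fact assms)+
qed

context module
begin

text \<open>Negation is scaling by \<open>\<ominus> \<one>\<close>, so closure under scalars already
  gives inverses; each later submodule proof becomes a check of four clauses.\<close>

lemma submodule_iff:
  "submodule H R M \<longleftrightarrow> H \<subseteq> carrier M \<and> \<zero>\<^bsub>M\<^esub> \<in> H \<and> (\<forall>x\<in>H. \<forall>y\<in>H. x \<oplus>\<^bsub>M\<^esub> y \<in> H) \<and>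
     (\<forall>r\<in>carrier R. \<forall>x\<in>H. r \<odot>\<^bsub>M\<^esub> x \<in> H)"
proof
  assume H: "submodule H R M"
  then have "\<zero>\<^bsub>M\<^esub> \<in> H"
    using submoduleE[OF H] by (metis M.l_neg equals0I subsetD)
  then show "H \<subseteq> carrier M \<and> \<zero>\<^bsub>M\<^esub> \<in> H \<and> (\<forall>x\<in>H. \<forall>y\<in>H. x \<oplus>\<^bsub>M\<^esub> y \<in> H) \<and>
     (\<forall>r\<in>carrier R. \<forall>x\<in>H. r \<odot>\<^bsub>M\<^esub> x \<in> H)"
    using submoduleE[OF H] by blast
next
  assume H: "H \<subseteq> carrier M \<and> \<zero>\<^bsub>M\<^esub> \<in> H \<and> (\<forall>x\<in>H. \<forall>y\<in>H. x \<oplus>\<^bsub>M\<^esub> y \<in> H) \<and>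
     (\<forall>r\<in>carrier R. \<forall>x\<in>H. r \<odot>\<^bsub>M\<^esub> x \<in> H)"
  have "\<ominus>\<^bsub>M\<^esub> x \<in> H" if "x \<in> H" for x
  proof -
    have "\<ominus>\<^bsub>M\<^esub> x = (\<ominus> \<one>) \<odot>\<^bsub>M\<^esub> x"
      using that H by (subst smult_l_minus) auto
    then show ?thesis
      using that H by auto
  qed
  then show "submodule H R M"
    using H by (intro submoduleI) auto
qed

lemma submodule_minus:
  assumes "submodule H R M" "x \<in> H" "y \<in> H"
  shows "x \<ominus>\<^bsub>M\<^esub> y \<in> H"
  using submoduleE[OF assms(1)] assms(2,3) by (simp add: a_minus_def)

lemma zero_submodule: "submodule {\<zero>\<^bsub>M\<^esub>} R M"
  by (auto simp: submodule_iff)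

lemma submodule_Inter:
  assumes "\<And>H. H \<in> \<C> \<Longrightarrow> submodule H R M"
  shows "submodule (carrier M \<inter> \<Inter>\<C>) R M"
  using assms unfolding submodule_iff by auto

lemma submodule_add:
  assumes H: "submodule H R M" and K: "submodule K R M"
  shows "submodule {x \<oplus>\<^bsub>M\<^esub> y |x y. x \<in> H \<and> y \<in> K} R M"
  unfolding submodule_iff
proof (intro conjI ballI)
  have HM: "H \<subseteq> carrier M" "K \<subseteq> carrier M" "\<zero>\<^bsub>M\<^esub> \<in> H" "\<zero>\<^bsub>M\<^esub> \<in> K"
    using H K by (auto simp: submodule_iff)
  show "{x \<oplus>\<^bsub>M\<^esub> y |x y. x \<in> H \<and> y \<in> K} \<subseteq> carrier M"
    using HM by auto
  show "\<zero>\<^bsub>M\<^esub> \<in> {x \<oplus>\<^bsub>M\<^esub> y |x y. x \<in> H \<and> y \<in> K}"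
    using HM by (auto intro!: exI[of _ "\<zero>\<^bsub>M\<^esub>"])
  show "u \<oplus>\<^bsub>M\<^esub> v \<in> {x \<oplus>\<^bsub>M\<^esub> y |x y. x \<in> H \<and> y \<in> K}"
    if uv: "u \<in> {x \<oplus>\<^bsub>M\<^esub> y |x y. x \<in> H \<and> y \<in> K}" "v \<in> {x \<oplus>\<^bsub>M\<^esub> y |x y. x \<in> H \<and> y \<in> K}" for u v
  proof -
    obtain x y x' y' where *: "u = x \<oplus>\<^bsub>M\<^esub> y" "v = x' \<oplus>\<^bsub>M\<^esub> y'" "x \<in> H" "x' \<in> H" "y \<in> K" "y' \<in> K"
      using uv by blast
    then have "u \<oplus>\<^bsub>M\<^esub> v = (x \<oplus>\<^bsub>M\<^esub> x') \<oplus>\<^bsub>M\<^esub> (y \<oplus>\<^bsub>M\<^esub> y')"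
      using HM by (simp add: M.a_ac subset_iff)
    moreover have "x \<oplus>\<^bsub>M\<^esub> x' \<in> H" "y \<oplus>\<^bsub>M\<^esub> y' \<in> K"
      using * H K by (auto simp: submodule_iff)
    ultimately show ?thesis
      by blast
  qed
  show "r \<odot>\<^bsub>M\<^esub> u \<in> {x \<oplus>\<^bsub>M\<^esub> y |x y. x \<in> H \<and> y \<in> K}"
    if r: "r \<in> carrier R" and u: "u \<in> {x \<oplus>\<^bsub>M\<^esub> y |x y. x \<in> H \<and> y \<in> K}" for r u
  proof -
    obtain x y where *: "u = x \<oplus>\<^bsub>M\<^esub> y" "x \<in> H" "y \<in> K"
      using u by blast
    then have "r \<odot>\<^bsub>M\<^esub> u = (r \<odot>\<^bsub>M\<^esub> x) \<oplus>\<^bsub>M\<^esub> (r \<odot>\<^bsub>M\<^esub> y)"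
      using HM r by (simp add: smult_r_distr subset_iff)
    moreover have "r \<odot>\<^bsub>M\<^esub> x \<in> H" "r \<odot>\<^bsub>M\<^esub> y \<in> K"
      using * r H K by (auto simp: submodule_iff)
    ultimately show ?thesis
      by blast
  qed
qed

lemma cyclic_submodule:
  assumes "x \<in> carrier M"
  shows "submodule {r \<odot>\<^bsub>M\<^esub> x |r. r \<in> carrier R} R M"
  unfolding submodule_iff
proof (intro conjI ballI)
  show "\<zero>\<^bsub>M\<^esub> \<in> {r \<odot>\<^bsub>M\<^esub> x |r. r \<in> carrier R}"
    using assms by (auto intro!: exI[of _ "\<zero>"])
qed (use assms in \<open>auto simp flip: smult_l_distr smult_assoc1\<close>)

lemma smult_minus_distr:
  assumes "r \<in> carrier R" "x \<in> carrier M" "y \<in> carrier M"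
  shows "r \<odot>\<^bsub>M\<^esub> (x \<ominus>\<^bsub>M\<^esub> y) = r \<odot>\<^bsub>M\<^esub> x \<ominus>\<^bsub>M\<^esub> r \<odot>\<^bsub>M\<^esub> y"
  using assms by (simp add: a_minus_def smult_r_distr smult_r_minus)

lemma smult_l_minus_distr:
  assumes "r \<in> carrier R" "s \<in> carrier R" "x \<in> carrier M"
  shows "(r \<ominus> s) \<odot>\<^bsub>M\<^esub> x = r \<odot>\<^bsub>M\<^esub> x \<ominus>\<^bsub>M\<^esub> s \<odot>\<^bsub>M\<^esub> x"
  using assms by (simp add: a_minus_def smult_l_distr smult_l_minus)

lemma smult_commute:
  assumes "r \<in> carrier R" "s \<in> carrier R" "x \<in> carrier M"
  shows "r \<odot>\<^bsub>M\<^esub> (s \<odot>\<^bsub>M\<^esub> x) = s \<odot>\<^bsub>M\<^esub> (r \<odot>\<^bsub>M\<^esub> x)"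
  using assms by (metis R.m_comm smult_assoc1)

end

lemma (in abelian_group) minus_eq_zero_iff:
  assumes "x \<in> carrier G" "y \<in> carrier G"
  shows "x \<ominus> y = \<zero> \<longleftrightarrow> x = y"
  using assms by (metis a_minus_def minus_equality minus_minus r_neg a_inv_closed)

lemma (in abelian_group) minus_zero_right: "x \<in> carrier G \<Longrightarrow> x \<ominus> \<zero> = x"
  by (simp add: a_minus_def add.inv_one)

lemma (in abelian_group) minus_add_cancel:
  assumes "x \<in> carrier G" "y \<in> carrier G"
  shows "x \<ominus> y \<oplus> y = x" "y \<oplus> (x \<ominus> y) = x" "x \<oplus> y \<ominus> y = x" "y \<oplus> x \<ominus> y = x"
  using assms by (simp_all add: a_minus_def a_ac r_neg l_neg)

lemma mod_homI:
  assumes "\<And>x. x \<in> carrier M \<Longrightarrow> f x \<in> carrier N"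
    and "\<And>x y. x \<in> carrier M \<Longrightarrow> y \<in> carrier M \<Longrightarrow> f (x \<oplus>\<^bsub>M\<^esub> y) = f x \<oplus>\<^bsub>N\<^esub> f y"
    and "\<And>r x. r \<in> carrier R \<Longrightarrow> x \<in> carrier M \<Longrightarrow> f (r \<odot>\<^bsub>M\<^esub> x) = r \<odot>\<^bsub>N\<^esub> f x"
  shows "f \<in> mod_hom R M N"
  using assms unfolding mod_hom_def by auto

lemma mod_homD:
  assumes "f \<in> mod_hom R M N"
  shows "x \<in> carrier M \<Longrightarrow> f x \<in> carrier N"
    and "x \<in> carrier M \<Longrightarrow> y \<in> carrier M \<Longrightarrow> f (x \<oplus>\<^bsub>M\<^esub> y) = f x \<oplus>\<^bsub>N\<^esub> f y"
    and "r \<in> carrier R \<Longrightarrow> x \<in> carrier M \<Longrightarrow> f (r \<odot>\<^bsub>M\<^esub> x) = r \<odot>\<^bsub>N\<^esub> f x"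
  using assms unfolding mod_hom_def by auto

lemma mod_hom_zero:
  assumes "module R M" "module R N" "f \<in> mod_hom R M N"
  shows "f \<zero>\<^bsub>M\<^esub> = \<zero>\<^bsub>N\<^esub>"
proof -
  interpret M: module R M by fact
  interpret N: module R N by fact
  have "f (\<zero>\<^bsub>R\<^esub> \<odot>\<^bsub>M\<^esub> \<zero>\<^bsub>M\<^esub>) = \<zero>\<^bsub>R\<^esub> \<odot>\<^bsub>N\<^esub> f \<zero>\<^bsub>M\<^esub>"
    by (intro mod_homD[OF assms(3)]) auto
  then show ?thesis
    using mod_homD(1)[OF assms(3)] by simp
qed

lemma mod_hom_minus:
  assumes "module R M" "module R N" "f \<in> mod_hom R M N" "x \<in> carrier M" "y \<in> carrier M"
  shows "f (x \<ominus>\<^bsub>M\<^esub> y) = f x \<ominus>\<^bsub>N\<^esub> f y"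
proof -
  interpret M: module R M by fact
  interpret N: module R N by fact
  have "f (x \<ominus>\<^bsub>M\<^esub> y) \<oplus>\<^bsub>N\<^esub> f y = f x"
    using assms(4,5) by (simp add: M.minus_add_cancel flip: mod_homD(2)[OF assms(3)])
  then show ?thesis
    using assms(4,5) mod_homD(1)[OF assms(3)] by (metis N.minus_add_cancel(3) M.minus_closed)
qed

lemma mod_hom_comp:
  assumes "f \<in> mod_hom R L M" "g \<in> mod_hom R M N"
  shows "(\<lambda>x. g (f x)) \<in> mod_hom R L N"
  by (rule mod_homI) (simp_all add: mod_homD[OF assms(1)] mod_homD[OF assms(2)])

lemma mod_hom_diff:
  assumes "module R M" "module R N" "f \<in> mod_hom R M N" "g \<in> mod_hom R M N"
  shows "(\<lambda>x. f x \<ominus>\<^bsub>N\<^esub> g x) \<in> mod_hom R M N"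
proof -
  interpret M: module R M by fact
  interpret N: module R N by fact
  note f = mod_homD[OF assms(3)] and g = mod_homD[OF assms(4)]
  show ?thesis
  proof (rule mod_homI)
    fix x y assume "x \<in> carrier M" "y \<in> carrier M"
    then show "f (x \<oplus>\<^bsub>M\<^esub> y) \<ominus>\<^bsub>N\<^esub> g (x \<oplus>\<^bsub>M\<^esub> y) = f x \<ominus>\<^bsub>N\<^esub> g x \<oplus>\<^bsub>N\<^esub> (f y \<ominus>\<^bsub>N\<^esub> g y)"
      using f(1) g(1) by (simp add: f(2) g(2) a_minus_def N.minus_add N.a_ac)
  qed (use f g in \<open>auto simp: N.smult_minus_distr\<close>)
qed

lemma mod_hom_add:
  assumes "module R M" "module R N" "f \<in> mod_hom R M N" "g \<in> mod_hom R M N"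
  shows "(\<lambda>x. f x \<oplus>\<^bsub>N\<^esub> g x) \<in> mod_hom R M N"
proof -
  interpret M: module R M by fact
  interpret N: module R N by fact
  note f = mod_homD[OF assms(3)] and g = mod_homD[OF assms(4)]
  show ?thesis
  proof (rule mod_homI)
    fix x y assume "x \<in> carrier M" "y \<in> carrier M"
    then show "f (x \<oplus>\<^bsub>M\<^esub> y) \<oplus>\<^bsub>N\<^esub> g (x \<oplus>\<^bsub>M\<^esub> y) = f x \<oplus>\<^bsub>N\<^esub> g x \<oplus>\<^bsub>N\<^esub> (f y \<oplus>\<^bsub>N\<^esub> g y)"
      using f(1) g(1) by (simp add: f(2) g(2) N.a_ac)
  qed (use f g in \<open>auto simp: N.smult_r_distr\<close>)
qed

lemma mod_hom_uminus:
  assumes "module R M" "module R N" "f \<in> mod_hom R M N"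
  shows "(\<lambda>x. \<ominus>\<^bsub>N\<^esub> f x) \<in> mod_hom R M N"
proof -
  interpret M: module R M by fact
  interpret N: module R N by fact
  note f = mod_homD[OF assms(3)]
  show ?thesis
    by (rule mod_homI) (use f in \<open>auto simp: N.minus_add N.smult_r_minus\<close>)
qed

lemma mod_hom_inclusion:
  assumes "submodule A R M" "module R M"
  shows "(\<lambda>x. x) \<in> mod_hom R (M\<lparr>carrier := A\<rparr>) M"
  using module.submoduleE(1)[OF assms(2,1)] by (intro mod_homI) auto

lemma mod_hom_image_submodule:
  assumes "module R M" "module R N" "f \<in> mod_hom R M N"
  shows "submodule (f ` carrier M) R N"
proof -
  interpret M: module R M by fact
  interpret N: module R N by fact
  note f = mod_homD[OF assms(3)]
  show ?thesis
    unfolding N.submodule_iff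
  proof (intro conjI ballI)
    show "\<zero>\<^bsub>N\<^esub> \<in> f ` carrier M"
      using mod_hom_zero[OF assms] M.M.zero_closed by (metis imageI)
    show "x \<oplus>\<^bsub>N\<^esub> y \<in> f ` carrier M" if "x \<in> f ` carrier M" "y \<in> f ` carrier M" for x y
      using that f(2) by (metis (no_types, lifting) M.M.a_closed imageE imageI)
    show "r \<odot>\<^bsub>N\<^esub> x \<in> f ` carrier M" if "r \<in> carrier R" "x \<in> f ` carrier M" for r x
      using that f(3) by (metis (no_types, lifting) M.smult_closed imageE imageI)
  qed (use f(1) in auto)
qed

lemma module_regular:
  assumes "cring R"
  shows "module R (regular_module R)"
proof -
  interpret cring R by fact
  show ?thesis
  proof (rule moduleI')
    show "\<exists>y\<in>carrier (regular_module R). y \<oplus>\<^bsub>regular_module R\<^esub> x = \<zero>\<^bsub>regular_module R\<^esub>"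
      if "x \<in> carrier (regular_module R)" for x
      using that by (intro bexI[of _ "\<ominus>\<^bsub>R\<^esub> x"]) (auto simp: regular_module_def l_neg)
  qed (auto simp: regular_module_def a_ac m_assoc l_distr r_distr assms)
qed

lemma regular_module_simps [simp]:
  "carrier (regular_module R) = carrier R"
  "zero (regular_module R) = \<zero>\<^bsub>R\<^esub>"
  "add (regular_module R) = add R"
  "smult (regular_module R) = monoid.mult R"
  by (simp_all add: regular_module_def)

lemma regular_module_a_inv [simp]: "a_inv (regular_module R) = a_inv R"
  by (simp add: a_inv_def m_inv_def fun_eq_iff)

text \<open>Allows ideals to be built by the clauses of \<open>submodule_iff\<close>, and turns the
  noetherian condition on the ring into one on \<open>regular_module R\<close>.\<close>

lemma submodule_regular_iff:
  assumes "cring R"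
  shows "submodule J R (regular_module R) \<longleftrightarrow> ideal J R"
proof
  interpret cring R by fact
  interpret M: module R "regular_module R"
    by (rule module_regular) fact
  show "ideal J R" if J: "submodule J R (regular_module R)"
  proof (rule idealI)
    show "ring R"
      by (rule ring_axioms)
    show "subgroup J (add_monoid R)"
      using that unfolding M.submodule_iff
      by (auto intro!: add.subgroupI dest: M.submoduleE(3)[OF J])
    show "x \<otimes>\<^bsub>R\<^esub> a \<in> J" "a \<otimes>\<^bsub>R\<^esub> x \<in> J" if "a \<in> J" "x \<in> carrier R" for a x
      using that J unfolding M.submodule_iff by (auto simp: m_comm[of a x] subset_iff)
  qed
  show "submodule J R (regular_module R)" if "ideal J R"
  proof -
    interpret J: ideal J R by fact
    show ?thesis
      unfolding M.submodule_iff using J.a_subset by (auto intro: J.I_l_closed)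
  qed
qed

text \<open>Used in two ways: it houses the graphs of partial homomorphisms in Baer's criterion, and
  it provides the middle resolution in the horseshoe lemma.\<close>

definition prod_module ::
  "('a, 'b, 'm) module_scheme \<Rightarrow> ('a, 'c, 'n) module_scheme \<Rightarrow> ('a, 'b \<times> 'c) module" where
  "prod_module M N =
     \<lparr>carrier = carrier M \<times> carrier N, monoid.mult = undefined, one = undefined,
      zero = (\<zero>\<^bsub>M\<^esub>, \<zero>\<^bsub>N\<^esub>), add = (\<lambda>p q. (fst p \<oplus>\<^bsub>M\<^esub> fst q, snd p \<oplus>\<^bsub>N\<^esub> snd q)),
      smult = (\<lambda>r p. (r \<odot>\<^bsub>M\<^esub> fst p, r \<odot>\<^bsub>N\<^esub> snd p))\<rparr>"

lemma prod_module_simps [simp]: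
  "carrier (prod_module M N) = carrier M \<times> carrier N"
  "zero (prod_module M N) = (\<zero>\<^bsub>M\<^esub>, \<zero>\<^bsub>N\<^esub>)"
  "p \<oplus>\<^bsub>prod_module M N\<^esub> q = (fst p \<oplus>\<^bsub>M\<^esub> fst q, snd p \<oplus>\<^bsub>N\<^esub> snd q)"
  "r \<odot>\<^bsub>prod_module M N\<^esub> p = (r \<odot>\<^bsub>M\<^esub> fst p, r \<odot>\<^bsub>N\<^esub> snd p)"
  by (simp_all add: prod_module_def)

lemma module_prod:
  assumes "module R M" "module R N"
  shows "module R (prod_module M N)"
proof -
  interpret M: module R M by fact
  interpret N: module R N by fact
  show ?thesis
  proof (rule moduleI')
    show "cring R" by (rule M.is_cring)
    show "\<exists>y\<in>carrier (prod_module M N). y \<oplus>\<^bsub>prod_module M N\<^esub> x = \<zero>\<^bsub>prod_module M N\<^esub>"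
      if "x \<in> carrier (prod_module M N)" for x
      using that by (auto intro!: bexI[of _ "(\<ominus>\<^bsub>M\<^esub> fst x, \<ominus>\<^bsub>N\<^esub> snd x)"] simp: M.l_neg N.l_neg)
  qed (auto simp: M.a_ac N.a_ac M.smult_l_distr N.smult_l_distr M.smult_r_distr N.smult_r_distr
          M.smult_assoc1 N.smult_assoc1)
qed

subsection \<open>Quotient modules\<close>

context
  fixes R :: "('a, 'r) ring_scheme" and M :: "('a, 'b, 'm) module_scheme" and N
  assumes module: "module R M" and sub: "submodule N R M"
begin

interpretation M: module R M by (rule module)

interpretation N: abelian_subgroup N M
  by (rule abelian_subgroupI3)
    (use sub in \<open>auto simp: submodule_def additive_subgroup_def M.abelian_group_axioms\<close>)

lemma quot_module_carrier: "carrier (quot_module M N) = (\<lambda>x. N +>\<^bsub>M\<^esub> x) ` carrier M"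
  by (auto simp: quot_module_def A_RCOSETS_def')

lemma quot_module_coset_eq_iff:
  assumes "x \<in> carrier M" "y \<in> carrier M"
  shows "N +>\<^bsub>M\<^esub> x = N +>\<^bsub>M\<^esub> y \<longleftrightarrow> x \<ominus>\<^bsub>M\<^esub> y \<in> N"
  by (metis assms a_minus_def N.a_rcos_module N.a_repr_independence' N.a_repr_independenceD)

lemma quot_module_zero: "\<zero>\<^bsub>quot_module M N\<^esub> = N +>\<^bsub>M\<^esub> \<zero>\<^bsub>M\<^esub>"
  using N.a_subset by (simp add: quot_module_def)

lemma quot_module_coset_eq_zero_iff:
  assumes "x \<in> carrier M"
  shows "N +>\<^bsub>M\<^esub> x = \<zero>\<^bsub>quot_module M N\<^esub> \<longleftrightarrow> x \<in> N"
  using assms by (simp add: quot_module_zero quot_module_coset_eq_iff M.minus_zero_right)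

lemma quot_module_add:
  assumes "x \<in> carrier M" "y \<in> carrier M"
  shows "(N +>\<^bsub>M\<^esub> x) \<oplus>\<^bsub>quot_module M N\<^esub> (N +>\<^bsub>M\<^esub> y) = N +>\<^bsub>M\<^esub> (x \<oplus>\<^bsub>M\<^esub> y)"
  using assms by (simp add: quot_module_def N.a_rcos_sum)

text \<open>The scalar action on a coset is a union over its representatives; all of them yield the
  same coset, so this is the union of a constant family.\<close>

lemma quot_module_smult:
  assumes "r \<in> carrier R" "x \<in> carrier M"
  shows "r \<odot>\<^bsub>quot_module M N\<^esub> (N +>\<^bsub>M\<^esub> x) = N +>\<^bsub>M\<^esub> (r \<odot>\<^bsub>M\<^esub> x)"
proof -
  have "N +>\<^bsub>M\<^esub> (r \<odot>\<^bsub>M\<^esub> y) = N +>\<^bsub>M\<^esub> (r \<odot>\<^bsub>M\<^esub> x)" if y: "y \<in> N +>\<^bsub>M\<^esub> x" for y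
  proof -
    have "y \<in> carrier M" "y \<ominus>\<^bsub>M\<^esub> x \<in> N"
      using y assms N.a_elemrcos_carrier N.a_rcos_module_imp by (auto simp: a_minus_def)
    then have "r \<odot>\<^bsub>M\<^esub> (y \<ominus>\<^bsub>M\<^esub> x) \<in> N"
      using sub assms by (simp add: submodule.smult_closed)
    with \<open>y \<in> carrier M\<close> assms show ?thesis
      by (subst quot_module_coset_eq_iff) (auto simp: M.smult_minus_distr)
  qed
  moreover have "x \<in> N +>\<^bsub>M\<^esub> x"
    using assms by (simp add: N.a_rcos_self)
  ultimately have "(\<Union>y\<in>N +>\<^bsub>M\<^esub> x. N +>\<^bsub>M\<^esub> (r \<odot>\<^bsub>M\<^esub> y)) = N +>\<^bsub>M\<^esub> (r \<odot>\<^bsub>M\<^esub> x)"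
    by (intro SUP_eq_const) blast
  then show ?thesis
    by (simp add: quot_module_def)
qed

lemma module_quot: "module R (quot_module M N)"
proof (rule moduleI')
  show "cring R" by (rule M.is_cring)
  show "\<exists>y\<in>carrier (quot_module M N). y \<oplus>\<^bsub>quot_module M N\<^esub> X = \<zero>\<^bsub>quot_module M N\<^esub>"
    if "X \<in> carrier (quot_module M N)" for X
  proof -
    obtain x where x: "x \<in> carrier M" "X = N +>\<^bsub>M\<^esub> x"
      using \<open>X \<in> _\<close> by (auto simp: quot_module_carrier)
    have "(N +>\<^bsub>M\<^esub> (\<ominus>\<^bsub>M\<^esub> x)) \<oplus>\<^bsub>quot_module M N\<^esub> (N +>\<^bsub>M\<^esub> x) = \<zero>\<^bsub>quot_module M N\<^esub>"
      unfolding quot_module_zero using x by (subst quot_module_add) (auto simp: M.l_neg)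
    moreover have "N +>\<^bsub>M\<^esub> (\<ominus>\<^bsub>M\<^esub> x) \<in> carrier (quot_module M N)"
      unfolding quot_module_carrier using x by blast
    ultimately show ?thesis
      using x by blast
  qed
  show "\<zero>\<^bsub>quot_module M N\<^esub> \<in> carrier (quot_module M N)"
    unfolding quot_module_carrier quot_module_zero by blast
qed (auto simp: quot_module_carrier quot_module_add quot_module_smult quot_module_zero
      M.a_ac M.smult_l_distr M.smult_r_distr M.smult_assoc1 simp del: M.a_coset_add_zero)

lemma mod_hom_quot: "(\<lambda>x. N +>\<^bsub>M\<^esub> x) \<in> mod_hom R M (quot_module M N)"
  by (rule mod_homI) (auto simp: quot_module_carrier quot_module_add quot_module_smult)

end

subsection \<open>Baer's criterion\<close>

text \<open>An extension of \<open>f\<close> to the whole ring is recorded by its value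
  \<open>e\<close> at one. Only ideals are quantified over, so no type other than those of
  \<open>R\<close> and \<open>E\<close> occurs.\<close>

definition baer :: "('a, 'r) ring_scheme \<Rightarrow> ('a, 'e, 'm) module_scheme \<Rightarrow> bool" where
  "baer R E \<longleftrightarrow> module R E \<and>
     (\<forall>J f. ideal J R \<and> f \<in> mod_hom R ((regular_module R)\<lparr>carrier := J\<rparr>) E \<longrightarrow>
        (\<exists>e\<in>carrier E. \<forall>r\<in>J. f r = r \<odot>\<^bsub>E\<^esub> e))"

lemma baer_module: "baer R E \<Longrightarrow> module R E"
  by (simp add: baer_def)

text \<open>
  Partial homomorphisms are treated as their graphs, which are the submodules of the product that
  are single-valued at zero; a maximal one is total.
\<close>

lemma baer_extend_graph:
  assumes B: "module R B" and E: "baer R E"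
    and G0: "submodule G0 R (prod_module B E)" "\<And>e. (\<zero>\<^bsub>B\<^esub>, e) \<in> G0 \<Longrightarrow> e = \<zero>\<^bsub>E\<^esub>"
  shows "\<exists>g\<in>mod_hom R B E. \<forall>(x, e)\<in>G0. g x = e"
proof -
  let ?P = "prod_module B E"
  interpret B: module R B by fact
  interpret E: module R E using E by (rule baer_module)
  interpret P: module R ?P by (rule module_prod) (rule B.module_axioms E.module_axioms)+
  define \<A> where "\<A> = {G. submodule G R ?P \<and> G0 \<subseteq> G \<and> (\<forall>e. (\<zero>\<^bsub>B\<^esub>, e) \<in> G \<longrightarrow> e = \<zero>\<^bsub>E\<^esub>)}"
  have "\<exists>G\<in>\<A>. \<forall>X\<in>\<A>. G \<subseteq> X \<longrightarrow> X = G"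
  proof (rule subset_Zorn_nonempty)
    show "\<A> \<noteq> {}"
      using G0 by (auto simp: \<A>_def)
    fix C assume C: "C \<noteq> {}" "subset.chain \<A> C"
    then have CA: "\<And>G. G \<in> C \<Longrightarrow> G \<in> \<A>" and tot: "\<And>X Y. X \<in> C \<Longrightarrow> Y \<in> C \<Longrightarrow> X \<subseteq> Y \<or> Y \<subseteq> X"
      by (auto simp: subset.chain_def subset_chain_def)
    have "submodule (\<Union>C) R ?P"
      unfolding P.submodule_iff
    proof (intro conjI ballI)
      show "\<Union>C \<subseteq> carrier ?P" "\<zero>\<^bsub>?P\<^esub> \<in> \<Union>C"
        using CA C(1) unfolding \<A>_def P.submodule_iff by blast+
      show "r \<odot>\<^bsub>?P\<^esub> x \<in> \<Union>C" if "r \<in> carrier R" "x \<in> \<Union>C" for r x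
        using CA that unfolding \<A>_def P.submodule_iff by blast
      show "x \<oplus>\<^bsub>?P\<^esub> y \<in> \<Union>C" if xy: "x \<in> \<Union>C" "y \<in> \<Union>C" for x y
      proof -
        obtain X where "X \<in> C" "x \<in> X" "y \<in> X"
          using xy tot by blast
        then show ?thesis
          using CA unfolding \<A>_def P.submodule_iff by blast
      qed
    qed
    then show "\<Union>C \<in> \<A>"
      using CA C(1) unfolding \<A>_def by blast
  qed
  then obtain G where GA: "G \<in> \<A>" and max: "\<And>X. X \<in> \<A> \<Longrightarrow> G \<subseteq> X \<Longrightarrow> X = G"
    by blast
  have G: "submodule G R ?P" "G0 \<subseteq> G" and zero: "\<And>e. (\<zero>\<^bsub>B\<^esub>, e) \<in> G \<Longrightarrow> e = \<zero>\<^bsub>E\<^esub>"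
    using GA by (auto simp: \<A>_def)
  have Gc: "x \<in> carrier B" "e \<in> carrier E" if "(x, e) \<in> G" for x e
    using G(1) that by (auto simp: P.submodule_iff)
  have Ga: "(x \<oplus>\<^bsub>B\<^esub> y, e \<oplus>\<^bsub>E\<^esub> e') \<in> G" if "(x, e) \<in> G" "(y, e') \<in> G" for x e y e'
    using G(1) that unfolding P.submodule_iff by force
  have Gs: "(r \<odot>\<^bsub>B\<^esub> x, r \<odot>\<^bsub>E\<^esub> e) \<in> G" if "r \<in> carrier R" "(x, e) \<in> G" for x e r
    using G(1) that unfolding P.submodule_iff by force
  have Gm: "(\<ominus>\<^bsub>B\<^esub> x, \<ominus>\<^bsub>E\<^esub> e) \<in> G" if "(x, e) \<in> G" for x e
    using Gs[OF _ that, of "\<ominus>\<^bsub>R\<^esub> \<one>\<^bsub>R\<^esub>"] Gc[OF that] by (simp add: B.smult_l_minus E.smult_l_minus)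
  have fn: "e = e'" if "(x, e) \<in> G" "(x, e') \<in> G" for x e e'
  proof -
    have "(x \<oplus>\<^bsub>B\<^esub> \<ominus>\<^bsub>B\<^esub> x, e \<oplus>\<^bsub>E\<^esub> \<ominus>\<^bsub>E\<^esub> e') \<in> G"
      using that by (intro Ga Gm)
    then have "e \<oplus>\<^bsub>E\<^esub> \<ominus>\<^bsub>E\<^esub> e' = \<zero>\<^bsub>E\<^esub>"
      using zero Gc(1)[OF that(1)] by (simp add: B.r_neg)
    then show ?thesis
      using Gc(2)[OF that(1)] Gc(2)[OF that(2)] E.minus_eq_zero_iff by (simp add: a_minus_def)
  qed
  have total: "\<exists>e. (b, e) \<in> G" if b: "b \<in> carrier B" for b
  proof -
    \<comment> \<open>The ring elements whose product with \<open>b\<close> lies in the domain of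
      the partial map; \<open>f\<close> is the value there, to be extended from this ideal to
      \<open>R\<close> by Baer's condition.\<close>
    define J where "J = {r \<in> carrier R. \<exists>e. (r \<odot>\<^bsub>B\<^esub> b, e) \<in> G}"
    define f where "f r = (THE e. (r \<odot>\<^bsub>B\<^esub> b, e) \<in> G)" for r
    have f: "f r = e" if "(r \<odot>\<^bsub>B\<^esub> b, e) \<in> G" for r e
      unfolding f_def using that fn by blast
    have J: "(r \<odot>\<^bsub>B\<^esub> b, f r) \<in> G" "r \<in> carrier R" if "r \<in> J" for r
      using that f unfolding J_def by auto
    interpret reg: module R "regular_module R"
      by (rule module_regular) (rule B.is_cring)
    have add: "((r \<oplus>\<^bsub>R\<^esub> s) \<odot>\<^bsub>B\<^esub> b, f r \<oplus>\<^bsub>E\<^esub> f s) \<in> G" if "r \<in> J" "s \<in> J" for r s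
      using Ga[OF J(1)[OF that(1)] J(1)[OF that(2)]] J(2) that b by (simp add: B.smult_l_distr)
    have smult: "((r \<otimes>\<^bsub>R\<^esub> s) \<odot>\<^bsub>B\<^esub> b, r \<odot>\<^bsub>E\<^esub> f s) \<in> G" if "r \<in> carrier R" "s \<in> J" for r s
      using Gs[OF that(1) J(1)[OF that(2)]] J(2) that b by (simp add: B.smult_assoc1)
    have "submodule J R (regular_module R)"
      unfolding reg.submodule_iff
    proof (intro conjI ballI)
      have "(\<zero>\<^bsub>R\<^esub> \<odot>\<^bsub>B\<^esub> b, \<zero>\<^bsub>E\<^esub>) \<in> G"
        using G(1) b by (simp add: P.submodule_iff)
      then show "\<zero>\<^bsub>regular_module R\<^esub> \<in> J"
        by (auto simp: J_def)
      show "J \<subseteq> carrier (regular_module R)"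
        by (auto simp: J_def)
      show "r \<oplus>\<^bsub>regular_module R\<^esub> s \<in> J" if "r \<in> J" "s \<in> J" for r s
        using add[OF that] J(2) that unfolding J_def by auto
      show "r \<odot>\<^bsub>regular_module R\<^esub> s \<in> J" if "r \<in> carrier R" "s \<in> J" for r s
        using smult[OF that] J(2) that unfolding J_def by auto
    qed
    then have "ideal J R"
      by (simp add: submodule_regular_iff B.is_cring)
    moreover have "f \<in> mod_hom R ((regular_module R)\<lparr>carrier := J\<rparr>) E"
      using f[OF add] f[OF smult] Gc(2)[OF J(1)] by (intro mod_homI) simp_all
    ultimately obtain e0 where e0: "e0 \<in> carrier E" "\<And>r. r \<in> J \<Longrightarrow> f r = r \<odot>\<^bsub>E\<^esub> e0"
      using E unfolding baer_def by blast
    \<comment> \<open>The graph enlarged by sending \<open>b\<close> to \<open>e0\<close>. It stays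
      single-valued because for \<open>r \<in> J\<close> both prescriptions agree by the choice of
      \<open>e0\<close>; maximality then puts \<open>(b, e0)\<close> into \<open>G\<close>.\<close>
    define G' where "G' = {u \<oplus>\<^bsub>?P\<^esub> v |u v. u \<in> G \<and> v \<in> {r \<odot>\<^bsub>?P\<^esub> (b, e0) |r. r \<in> carrier R}}"
    have be: "(b, e0) \<in> carrier ?P"
      using b e0 by simp
    have "submodule G' R ?P"
      unfolding G'_def by (intro P.submodule_add P.cyclic_submodule G(1) be)
    moreover have GG': "G \<subseteq> G'"
    proof
      fix u assume u: "u \<in> G"
      then have "u = u \<oplus>\<^bsub>?P\<^esub> \<zero>\<^bsub>R\<^esub> \<odot>\<^bsub>?P\<^esub> (b, e0)"
        using G(1) b e0(1) by (auto simp: P.submodule_iff)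
      then show "u \<in> G'"
        unfolding G'_def using u by blast
    qed
    moreover have "e = \<zero>\<^bsub>E\<^esub>" if "(\<zero>\<^bsub>B\<^esub>, e) \<in> G'" for e
    proof -
      obtain x e' r where *: "(x, e') \<in> G" "r \<in> carrier R" "\<zero>\<^bsub>B\<^esub> = x \<oplus>\<^bsub>B\<^esub> r \<odot>\<^bsub>B\<^esub> b"
        "e = e' \<oplus>\<^bsub>E\<^esub> r \<odot>\<^bsub>E\<^esub> e0"
        using \<open>(\<zero>\<^bsub>B\<^esub>, e) \<in> G'\<close> unfolding G'_def by auto
      have "r \<odot>\<^bsub>B\<^esub> b = \<ominus>\<^bsub>B\<^esub> x"
        using * Gc[OF *(1)] b by (metis B.minus_equality B.M.a_comm B.smult_closed)
      then have "(r \<odot>\<^bsub>B\<^esub> b, \<ominus>\<^bsub>E\<^esub> e') \<in> G"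
        using Gm[OF *(1)] by simp
      then have "r \<odot>\<^bsub>E\<^esub> e0 = \<ominus>\<^bsub>E\<^esub> e'"
        using f e0(2)[of r] *(2) unfolding J_def by force
      then show ?thesis
        using * Gc[OF *(1)] by (simp add: E.r_neg)
    qed
    ultimately have "G' = G"
      using G(2) by (intro max) (auto simp: \<A>_def)
    moreover have "(b, e0) \<in> G'"
    proof -
      have "(b, e0) = \<zero>\<^bsub>?P\<^esub> \<oplus>\<^bsub>?P\<^esub> \<one>\<^bsub>R\<^esub> \<odot>\<^bsub>?P\<^esub> (b, e0)"
        using b e0(1) by simp
      moreover have "\<zero>\<^bsub>?P\<^esub> \<in> G"
        using G(1) by (auto simp: P.submodule_iff)
      ultimately show ?thesis
        unfolding G'_def using B.one_closed by blast
    qed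
    ultimately show ?thesis
      by blast
  qed
  define g where "g x = (THE e. (x, e) \<in> G)" for x
  have g: "g x = e" if "(x, e) \<in> G" for x e
    unfolding g_def using that fn by blast
  then have g': "(x, g x) \<in> G" if "x \<in> carrier B" for x
    using total[OF that] by auto
  have "g \<in> mod_hom R B E"
    by (rule mod_homI) (auto intro!: g Ga Gs g' Gc(2)[OF g'])
  then show ?thesis
    using g G(2) by blast
qed

text \<open>The image of \<open>x \<mapsto> (p x, f x)\<close> is a graph, single-valued at zero by
  \<open>ker\<close>. With \<open>p\<close> an inclusion this is the usual extension property;
  allowing \<open>p\<close> to have a kernel gives the factorisations on which the comparison
  theorem and the horseshoe lemma rest.\<close>

lemma baer_factor:
  assumes X: "module R X" and Y: "module R Y" and I: "baer R I"
    and p: "p \<in> mod_hom R X Y" and f: "f \<in> mod_hom R X I"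
    and ker: "\<And>x. x \<in> carrier X \<Longrightarrow> p x = \<zero>\<^bsub>Y\<^esub> \<Longrightarrow> f x = \<zero>\<^bsub>I\<^esub>"
  shows "\<exists>g\<in>mod_hom R Y I. \<forall>x\<in>carrier X. g (p x) = f x"
proof -
  have "(\<lambda>x. (p x, f x)) \<in> mod_hom R X (prod_module Y I)"
    using mod_homD[OF p] mod_homD[OF f] by (intro mod_homI) auto
  then have "submodule ((\<lambda>x. (p x, f x)) ` carrier X) R (prod_module Y I)"
    by (intro mod_hom_image_submodule module_prod X Y baer_module I)
  from baer_extend_graph[OF Y I this] ker show ?thesis
    by force
qed

lemma injective_module_baer:
  assumes "baer R E"
  shows "injective_module R E"
  unfolding injective_module_def
proof (intro conjI allI impI)
  show E: "module R E"
    using assms by (rule baer_module)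
  fix B :: "('a, 'c) module" and A f
  assume *: "module R B \<and> submodule A R B \<and> f \<in> mod_hom R (B\<lparr>carrier := A\<rparr>) E"
  have A: "module R (B\<lparr>carrier := A\<rparr>)"
    using * submodule.submodule_is_module by blast
  from mod_hom_zero[OF A E] * have "f \<zero>\<^bsub>B\<^esub> = \<zero>\<^bsub>E\<^esub>"
    by auto
  then show "\<exists>g\<in>mod_hom R B E. \<forall>x\<in>A. g x = f x"
    using baer_factor[where Y = B and f = f, OF A _ assms mod_hom_inclusion] * by auto
qed

subsection \<open>Transport of structure\<close>

text \<open>Structure carried along a map \<open>u\<close> that is injective on the carrier. It
  brings modules of functions or cosets back into the fixed element type of the resolutions.\<close>

definition transport_module :: "('b \<Rightarrow> 'c) \<Rightarrow> ('a, 'b, 'm) module_scheme \<Rightarrow> ('a, 'c) module" where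
  "transport_module u M =
     (let v = inv_into (carrier M) u in
      \<lparr>carrier = u ` carrier M, monoid.mult = undefined, one = undefined, zero = u \<zero>\<^bsub>M\<^esub>,
       add = (\<lambda>x y. u (v x \<oplus>\<^bsub>M\<^esub> v y)), smult = (\<lambda>r x. u (r \<odot>\<^bsub>M\<^esub> v x))\<rparr>)"

lemma transport_module_simps [simp]:
  "carrier (transport_module u M) = u ` carrier M"
  "\<zero>\<^bsub>transport_module u M\<^esub> = u \<zero>\<^bsub>M\<^esub>"
  by (simp_all add: transport_module_def Let_def)

lemma transport_module_add:
  assumes "inj_on u (carrier M)" "x \<in> carrier M" "y \<in> carrier M"
  shows "u x \<oplus>\<^bsub>transport_module u M\<^esub> u y = u (x \<oplus>\<^bsub>M\<^esub> y)"
  using assms by (simp add: transport_module_def Let_def)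

lemma transport_module_smult:
  assumes "inj_on u (carrier M)" "x \<in> carrier M"
  shows "r \<odot>\<^bsub>transport_module u M\<^esub> u x = u (r \<odot>\<^bsub>M\<^esub> x)"
  using assms by (simp add: transport_module_def Let_def)

lemma module_transport:
  assumes "module R M" and inj: "inj_on u (carrier M)"
  shows "module R (transport_module u M)"
proof -
  interpret M: module R M by fact
  note simps = transport_module_add[OF inj] transport_module_smult[OF inj]
  show ?thesis
  proof (rule moduleI')
    show "cring R" by (rule M.is_cring)
    show "\<exists>y\<in>carrier (transport_module u M). y \<oplus>\<^bsub>transport_module u M\<^esub> x = \<zero>\<^bsub>transport_module u M\<^esub>"
      if x: "x \<in> carrier (transport_module u M)" for x
    proof -
      obtain z where z: "z \<in> carrier M" "x = u z"
        using x by auto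
      then show ?thesis
        by (intro bexI[of _ "u (\<ominus>\<^bsub>M\<^esub> z)"]) (auto simp: simps M.l_neg)
    qed
  qed (auto simp: simps M.a_assoc M.smult_l_distr M.smult_r_distr M.smult_assoc1,
       auto simp: M.a_comm)
qed

lemma transport_module_hom:
  assumes "inj_on u (carrier M)"
  shows "u \<in> mod_hom R M (transport_module u M)"
  by (rule mod_homI) (auto simp: transport_module_add[OF assms] transport_module_smult[OF assms])

lemma mod_hom_inv_into:
  assumes "module R M" and f: "f \<in> mod_hom R M N" and bij: "bij_betw f (carrier M) (carrier N)"
  shows "inv_into (carrier M) f \<in> mod_hom R N M"
proof (rule mod_homI)
  interpret M: module R M by fact
  let ?g = "inv_into (carrier M) f"
  have inj: "inj_on f (carrier M)" and img: "f ` carrier M = carrier N"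
    using bij by (auto simp: bij_betw_def)
  have g: "?g y \<in> carrier M" "f (?g y) = y" if "y \<in> carrier N" for y
    using that img by (metis inv_into_into, metis f_inv_into_f)
  show "?g x \<in> carrier M" if "x \<in> carrier N" for x
    using g that by blast
  show "?g (x \<oplus>\<^bsub>N\<^esub> y) = ?g x \<oplus>\<^bsub>M\<^esub> ?g y" if "x \<in> carrier N" "y \<in> carrier N" for x y
    using g that inj by (intro inv_into_f_eq) (auto simp: mod_homD(2)[OF f])
  show "?g (r \<odot>\<^bsub>N\<^esub> x) = r \<odot>\<^bsub>M\<^esub> ?g x" if "r \<in> carrier R" "x \<in> carrier N" for r x
    using g that inj by (intro inv_into_f_eq) (auto simp: mod_homD(3)[OF f])
qed

lemma baer_iso:
  assumes E: "baer R E" and E': "module R E'" and \<phi>: "\<phi> \<in> mod_hom R E E'"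
    and bij: "bij_betw \<phi> (carrier E) (carrier E')"
  shows "baer R E'"
  unfolding baer_def
proof (intro conjI allI impI E')
  fix J f assume *: "ideal J R \<and> f \<in> mod_hom R ((regular_module R)\<lparr>carrier := J\<rparr>) E'"
  let ?g = "inv_into (carrier E) \<phi>"
  have "(\<lambda>x. ?g (f x)) \<in> mod_hom R ((regular_module R)\<lparr>carrier := J\<rparr>) E"
    using mod_hom_comp[of f] mod_hom_inv_into[OF baer_module[OF E] \<phi> bij] * by blast
  then obtain e where e: "e \<in> carrier E" "\<And>r. r \<in> J \<Longrightarrow> ?g (f r) = r \<odot>\<^bsub>E\<^esub> e"
    using E * unfolding baer_def by blast
  have "f r = r \<odot>\<^bsub>E'\<^esub> \<phi> e" if "r \<in> J" for r
  proof -
    have "r \<in> carrier R"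
      using * that by (meson ideal.Icarr)
    moreover have "f r \<in> carrier E'"
      using * that mod_homD(1) by force
    then have "f r = \<phi> (?g (f r))"
      using bij by (simp add: bij_betw_def f_inv_into_f)
    ultimately show ?thesis
      using e that mod_homD(3)[OF \<phi>] by simp
  qed
  then show "\<exists>e\<in>carrier E'. \<forall>r\<in>J. f r = r \<odot>\<^bsub>E'\<^esub> e"
    using mod_homD(1)[OF \<phi> e(1)] by blast
qed

lemma baer_transport:
  assumes "baer R E" "inj_on u (carrier E)"
  shows "baer R (transport_module u E)"
  using assms
  by (intro baer_iso[OF assms(1) _ transport_module_hom] module_transport)
    (auto simp: bij_betw_def baer_module)

text \<open>An ideal of \<open>R\<close> can be tested against \<open>E\<close> only after
  \<open>R\<close> has been copied into the element type of \<open>E\<close>, which is the purpose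
  of the injection \<open>u\<close>; the value of the extension at \<open>u \<one>\<close> is the
  element that Baer's condition asks for.\<close>

lemma baer_injective_module:
  fixes E :: "('a, 'e) module" and u :: "'a \<Rightarrow> 'e"
  assumes "cring R" and E: "injective_module R E" and u: "inj u"
  shows "baer R E"
  unfolding baer_def
proof (intro conjI allI impI)
  show "module R E"
    using E by (simp add: injective_module_def)
  interpret cring R by fact
  fix J f assume *: "ideal J R \<and> f \<in> mod_hom R ((regular_module R)\<lparr>carrier := J\<rparr>) E"
  have inj: "inj_on u (carrier (regular_module R))"
    using u by (simp add: inj_on_def)
  let ?B = "transport_module u (regular_module R)"
  interpret reg: module R "regular_module R"
    by (rule module_regular) fact
  interpret B: module R ?B
    by (rule module_transport[OF reg.module_axioms inj])
  note simps = transport_module_add[OF inj] transport_module_smult[OF inj]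
  have J: "submodule J R (regular_module R)"
    using * by (simp add: submodule_regular_iff is_cring)
  have JR: "r \<in> carrier R" if "r \<in> J" for r
    using * that by (meson ideal.Icarr)
  have "submodule (u ` J) R ?B"
    using J unfolding B.submodule_iff reg.submodule_iff by (auto simp: simps subset_iff)
  moreover have "(\<lambda>x. f (inv_into UNIV u x)) \<in> mod_hom R (?B\<lparr>carrier := u ` J\<rparr>) E"
  proof (rule mod_homI)
    have f: "f \<in> mod_hom R ((regular_module R)\<lparr>carrier := J\<rparr>) E"
      using * by blast
    show "f (inv_into UNIV u x) \<in> carrier E" if "x \<in> carrier (?B\<lparr>carrier := u ` J\<rparr>)" for x
      using that mod_homD(1)[OF f] u by auto
    show "f (inv_into UNIV u (x \<oplus>\<^bsub>?B\<lparr>carrier := u ` J\<rparr>\<^esub> y)) = f (inv_into UNIV u x) \<oplus>\<^bsub>E\<^esub> f (inv_into UNIV u y)"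
      if xy: "x \<in> carrier (?B\<lparr>carrier := u ` J\<rparr>)" "y \<in> carrier (?B\<lparr>carrier := u ` J\<rparr>)" for x y
    proof -
      obtain r s where "r \<in> J" "s \<in> J" "x = u r" "y = u s"
        using xy by auto
      then show ?thesis
        using mod_homD(2)[OF f, of r s] u JR by (simp add: simps)
    qed
    show "f (inv_into UNIV u (r \<odot>\<^bsub>?B\<lparr>carrier := u ` J\<rparr>\<^esub> x)) = r \<odot>\<^bsub>E\<^esub> f (inv_into UNIV u x)"
      if r: "r \<in> carrier R" and x: "x \<in> carrier (?B\<lparr>carrier := u ` J\<rparr>)" for r x
    proof -
      obtain s where "s \<in> J" "x = u s"
        using x by auto
      then show ?thesis
        using mod_homD(3)[OF f r, of s] u JR r by (simp add: simps)
    qed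
  qed
  ultimately obtain g where g: "g \<in> mod_hom R ?B E" "\<forall>x\<in>u ` J. g x = f (inv_into UNIV u x)"
    using E B.module_axioms unfolding injective_module_def by blast
  have "f r = r \<odot>\<^bsub>E\<^esub> g (u \<one>\<^bsub>R\<^esub>)" if "r \<in> J" for r
  proof -
    have "f r = g (u r)"
      using g(2) that u by auto
    also have "u r = r \<odot>\<^bsub>?B\<^esub> u \<one>\<^bsub>R\<^esub>"
      using JR[OF that] by (simp add: simps)
    also have "g \<dots> = r \<odot>\<^bsub>E\<^esub> g (u \<one>\<^bsub>R\<^esub>)"
      using JR[OF that] by (intro mod_homD(3)[OF g(1)]) auto
    finally show ?thesis .
  qed
  moreover have "g (u \<one>\<^bsub>R\<^esub>) \<in> carrier E"
    by (rule mod_homD(1)[OF g(1)]) auto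
  ultimately show "\<exists>e\<in>carrier E. \<forall>r\<in>J. f r = r \<odot>\<^bsub>E\<^esub> e"
    by blast
qed

subsection \<open>Enough injectives\<close>

definition zmodule :: "('b, 'm) ring_scheme \<Rightarrow> (int, 'b) module" where
  "zmodule G =
     \<lparr>carrier = carrier G, monoid.mult = undefined, one = undefined, zero = \<zero>\<^bsub>G\<^esub>,
      add = add G, smult = (\<lambda>k x. [k] \<cdot>\<^bsub>G\<^esub> x)\<rparr>"

lemma zmodule_simps [simp]:
  "carrier (zmodule G) = carrier G"
  "\<zero>\<^bsub>zmodule G\<^esub> = \<zero>\<^bsub>G\<^esub>"
  "add (zmodule G) = add G"
  by (simp_all add: zmodule_def)

lemma module_zmodule:
  assumes "abelian_group G"
  shows "module \<Z> (zmodule G)"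
proof -
  interpret abelian_group G by fact
  show ?thesis
  proof (rule moduleI')
    show "\<exists>y\<in>carrier (zmodule G). y \<oplus>\<^bsub>zmodule G\<^esub> x = \<zero>\<^bsub>zmodule G\<^esub>" if "x \<in> carrier (zmodule G)" for x
      using that by (intro bexI[of _ "\<ominus>\<^bsub>G\<^esub> x"]) (auto simp: l_neg)
    show "(a \<otimes>\<^bsub>\<Z>\<^esub> b) \<odot>\<^bsub>zmodule G\<^esub> x = a \<odot>\<^bsub>zmodule G\<^esub> (b \<odot>\<^bsub>zmodule G\<^esub> x)"
      if "x \<in> carrier (zmodule G)" for a b x
      using that add.int_pow_pow[of x a b] by (simp add: zmodule_def mult.commute)
  qed (auto simp: zmodule_def int_is_cring a_assoc add.int_pow_mult add.int_pow_distrib, auto simp: a_comm)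
qed

text \<open>Integer multiples are repeated sums, so additivity propagates by induction from 0 in
  both directions, the downward step cancelling \<open>f x\<close>.\<close>

lemma additive_imp_int_linear:
  assumes "module \<Z> X" "module \<Z> D"
    and f: "\<And>x. x \<in> carrier X \<Longrightarrow> f x \<in> carrier D"
      "\<And>x y. x \<in> carrier X \<Longrightarrow> y \<in> carrier X \<Longrightarrow> f (x \<oplus>\<^bsub>X\<^esub> y) = f x \<oplus>\<^bsub>D\<^esub> f y"
  shows "f \<in> mod_hom \<Z> X D"
proof (rule mod_homI)
  interpret X: module \<Z> X by fact
  interpret D: module \<Z> D by fact
  have one: "1 \<odot>\<^bsub>X\<^esub> x = x" if "x \<in> carrier X" for x
    using X.smult_one[OF that] by simp
  have one': "1 \<odot>\<^bsub>D\<^esub> x = x" if "x \<in> carrier D" for x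
    using D.smult_one[OF that] by simp
  have suc: "(i + 1) \<odot>\<^bsub>X\<^esub> x = i \<odot>\<^bsub>X\<^esub> x \<oplus>\<^bsub>X\<^esub> x" if "x \<in> carrier X" for i x
    using X.smult_l_distr[of i 1 x] that by (simp add: one)
  have suc': "(i + 1) \<odot>\<^bsub>D\<^esub> x = i \<odot>\<^bsub>D\<^esub> x \<oplus>\<^bsub>D\<^esub> x" if "x \<in> carrier D" for i x
    using D.smult_l_distr[of i 1 x] that by (simp add: one')
  have Xc: "i \<odot>\<^bsub>X\<^esub> x \<in> carrier X" if "x \<in> carrier X" for i x
    using X.smult_closed[of i x] that by simp
  have Dc: "i \<odot>\<^bsub>D\<^esub> x \<in> carrier D" if "x \<in> carrier D" for i x
    using D.smult_closed[of i x] that by simp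
  fix k x assume x: "x \<in> carrier X"
  show "f (k \<odot>\<^bsub>X\<^esub> x) = k \<odot>\<^bsub>D\<^esub> f x"
  proof (induction k rule: int_induct[where k = 0])
    case base
    have "f \<zero>\<^bsub>X\<^esub> \<oplus>\<^bsub>D\<^esub> f \<zero>\<^bsub>X\<^esub> = f \<zero>\<^bsub>X\<^esub>"
      using f(2)[of "\<zero>\<^bsub>X\<^esub>" "\<zero>\<^bsub>X\<^esub>"] by simp
    then have "f \<zero>\<^bsub>X\<^esub> = \<zero>\<^bsub>D\<^esub>"
      using f(1)[of "\<zero>\<^bsub>X\<^esub>"] by (metis D.add.r_cancel_one X.M.zero_closed)
    then show ?case
      using X.smult_l_null[OF x] D.smult_l_null[OF f(1)[OF x]] by simp
  next
    case (step1 i)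
    then show ?case
      using x f Xc by (simp add: suc suc')
  next
    case (step2 i)
    have "f ((i - 1) \<odot>\<^bsub>X\<^esub> x) \<oplus>\<^bsub>D\<^esub> f x = f (i \<odot>\<^bsub>X\<^esub> x)"
      using suc[OF x, of "i - 1"] x by (simp add: Xc flip: f(2))
    also have "\<dots> = (i - 1) \<odot>\<^bsub>D\<^esub> f x \<oplus>\<^bsub>D\<^esub> f x"
      using suc'[OF f(1)[OF x], of "i - 1"] step2 by simp
    finally show ?case
      using x f Xc Dc by simp
  qed
qed (use f in auto)

text \<open>A nonzero ideal of the integers is generated by its least positive element
  \<open>n\<close>, so \<open>f\<close> is determined by \<open>f n\<close>, and divisibility
  provides \<open>e\<close> with \<open>n e = f n\<close>.\<close>

lemma divisible_imp_baer:
  assumes D: "module \<Z> D"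
    and div: "\<And>d k. d \<in> carrier D \<Longrightarrow> k \<noteq> 0 \<Longrightarrow> \<exists>e\<in>carrier D. k \<odot>\<^bsub>D\<^esub> e = d"
  shows "baer \<Z> D"
  unfolding baer_def
proof (intro conjI allI impI D)
  interpret D: module \<Z> D by fact
  fix J f assume *: "ideal J \<Z> \<and> f \<in> mod_hom \<Z> ((regular_module \<Z>)\<lparr>carrier := J\<rparr>) D"
  then have J: "submodule J \<Z> (regular_module \<Z>)"
    by (simp add: submodule_regular_iff int_is_cring)
  interpret reg: module \<Z> "regular_module \<Z>"
    by (rule module_regular) (rule int_is_cring)
  have J0: "0 \<in> J" and Ja: "\<And>x y. x \<in> J \<Longrightarrow> y \<in> J \<Longrightarrow> x + y \<in> J" and Js: "\<And>r x. x \<in> J \<Longrightarrow> r * x \<in> J"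
    using J unfolding reg.submodule_iff by simp_all
  have f: "f \<in> mod_hom \<Z> ((regular_module \<Z>)\<lparr>carrier := J\<rparr>) D"
    using * by blast
  have f0: "f 0 = \<zero>\<^bsub>D\<^esub>"
    using mod_homD(3)[OF f, of 0 0] mod_homD(1)[OF f, of 0] D.smult_l_null[of "f 0"] J0 by simp
  show "\<exists>e\<in>carrier D. \<forall>r\<in>J. f r = r \<odot>\<^bsub>D\<^esub> e"
  proof (cases "J = {0}")
    case True
    then show ?thesis
      using f0 D.smult_l_null[of "\<zero>\<^bsub>D\<^esub>"] by (intro bexI[of _ "\<zero>\<^bsub>D\<^esub>"]) auto
  next
    case False
    then obtain j where j: "j \<in> J" "j \<noteq> 0"
      using J0 by blast
    define n where "n = (LEAST n. n > 0 \<and> int n \<in> J)"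
    have "int (nat \<bar>j\<bar>) \<in> J"
      using j Js[OF j(1), of "-1"] by (auto simp: abs_if)
    then have n: "n > 0" "int n \<in> J"
      using LeastI[of "\<lambda>n. n > 0 \<and> int n \<in> J" "nat \<bar>j\<bar>"] j by (auto simp: n_def)
    have dvd: "int n dvd r" if "r \<in> J" for r
    proof (rule ccontr)
      assume "\<not> int n dvd r"
      then have "r mod int n \<noteq> 0"
        by (simp add: dvd_eq_mod_eq_0)
      then have pos: "0 < r mod int n" "r mod int n < int n"
        using n(1) by (simp_all add: order.not_eq_order_implies_strict)
      have "r mod int n = r + (- (r div int n)) * int n"
        by (simp add: minus_mult_div_eq_mod[symmetric] mult.commute)
      then have "r mod int n \<in> J"
        using Ja[OF that Js[OF n(2), of "- (r div int n)"]] by simp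
      then have "n \<le> nat (r mod int n)"
        using pos Least_le[of "\<lambda>n. n > 0 \<and> int n \<in> J" "nat (r mod int n)", folded n_def] by auto
      then show False
        using pos by simp
    qed
    obtain e where e: "e \<in> carrier D" "int n \<odot>\<^bsub>D\<^esub> e = f (int n)"
      using div[of "f (int n)" "int n"] n mod_homD(1)[OF f, of "int n"] by auto
    have "f r = r \<odot>\<^bsub>D\<^esub> e" if r: "r \<in> J" for r
    proof -
      obtain k where k: "r = k * int n"
        using dvd[OF r] by (metis dvdE mult.commute)
      have "f (k * int n) = k \<odot>\<^bsub>D\<^esub> f (int n)"
        using mod_homD(3)[OF f, of k "int n"] n by simp
      then show ?thesis
        using e D.smult_assoc1[of k "int n" e] k by simp
    qed
    then show ?thesis
      using e by blast
  qed
qed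

text \<open>The rational vector space with basis \<open>A\<close>, regarded as an abelian group;
  division of coefficients makes it and each of its quotients divisible.\<close>

definition finsupp_module :: "'b set \<Rightarrow> (int, 'b \<Rightarrow> rat) module" where
  "finsupp_module A =
     \<lparr>carrier = {f. finite {x. f x \<noteq> 0} \<and> {x. f x \<noteq> 0} \<subseteq> A}, monoid.mult = undefined,
      one = undefined, zero = (\<lambda>_. 0), add = (\<lambda>f g x. f x + g x),
      smult = (\<lambda>k f x. of_int k * f x)\<rparr>"

lemma finsupp_module_simps:
  "f \<in> carrier (finsupp_module A) \<longleftrightarrow> finite {x. f x \<noteq> 0} \<and> {x. f x \<noteq> 0} \<subseteq> A"
  "\<zero>\<^bsub>finsupp_module A\<^esub> = (\<lambda>_. 0)"
  "f \<oplus>\<^bsub>finsupp_module A\<^esub> g = (\<lambda>x. f x + g x)"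
  "k \<odot>\<^bsub>finsupp_module A\<^esub> f = (\<lambda>x. of_int k * f x)"
  by (simp_all add: finsupp_module_def)

lemma module_finsupp: "module \<Z> (finsupp_module A)"
proof (rule moduleI')
  have sub: "{x. f x + g x \<noteq> 0} \<subseteq> {x. f x \<noteq> 0} \<union> {x. g x \<noteq> 0}" for f g :: "'a \<Rightarrow> rat"
    by auto
  show "f \<oplus>\<^bsub>finsupp_module A\<^esub> g \<in> carrier (finsupp_module A)"
    if "f \<in> carrier (finsupp_module A)" "g \<in> carrier (finsupp_module A)" for f g
    using that finite_subset[OF sub[of f g]] sub[of f g] by (auto simp: finsupp_module_simps)
  show "\<exists>g\<in>carrier (finsupp_module A). g \<oplus>\<^bsub>finsupp_module A\<^esub> f = \<zero>\<^bsub>finsupp_module A\<^esub>"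
    if "f \<in> carrier (finsupp_module A)" for f
    using that by (intro bexI[of _ "\<lambda>x. - f x"]) (auto simp: finsupp_module_simps)
  show "k \<odot>\<^bsub>finsupp_module A\<^esub> f \<in> carrier (finsupp_module A)" if "f \<in> carrier (finsupp_module A)" for k f
    using that by (auto simp: finsupp_module_simps elim: finite_subset[rotated])
qed (auto simp: finsupp_module_simps int_is_cring algebra_simps fun_eq_iff)

text \<open>
  Writing \<open>A = \<int>\<^bsup>(A)\<^esup> / K\<close>, the group \<open>A\<close> embeds in the divisible group \<open>\<rat>\<^bsup>(A)\<^esup> / K\<close>.
\<close>

lemma divisible_embedding:
  fixes A :: "(int, 'b) module"
  assumes A: "module \<Z> A"
  shows "\<exists>K \<delta>. submodule K \<Z> (finsupp_module (carrier A)) \<and>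
           baer \<Z> (quot_module (finsupp_module (carrier A)) K) \<and>
           \<delta> \<in> mod_hom \<Z> A (quot_module (finsupp_module (carrier A)) K) \<and> inj_on \<delta> (carrier A)"
proof -
  interpret A: module \<Z> A by fact
  let ?F = "finsupp_module (carrier A)"
  interpret F: module \<Z> ?F by (rule module_finsupp)
  \<comment> \<open>Evaluation of formal integral combinations of elements of \<open>A\<close>. The
    floor only converts integral rationals to integers; additivity is therefore claimed on
    \<open>Z\<close> alone.\<close>
  define ev where "ev f = (\<Oplus>\<^bsub>A\<^esub>a\<in>{x. f x \<noteq> 0}. \<lfloor>f a\<rfloor> \<odot>\<^bsub>A\<^esub> a)" for f :: "'b \<Rightarrow> rat"
  define Z where "Z = {f \<in> carrier ?F. \<forall>x. f x \<in> \<int>}"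
  have closed: "k \<odot>\<^bsub>A\<^esub> a \<in> carrier A" if "a \<in> carrier A" for k a
    using A.smult_closed[of k a] that by simp
  have null: "0 \<odot>\<^bsub>A\<^esub> a = \<zero>\<^bsub>A\<^esub>" if "a \<in> carrier A" for a
    using A.smult_l_null[OF that] by simp
  have dist: "(k + l) \<odot>\<^bsub>A\<^esub> a = k \<odot>\<^bsub>A\<^esub> a \<oplus>\<^bsub>A\<^esub> l \<odot>\<^bsub>A\<^esub> a" if "a \<in> carrier A" for a k l
    using A.smult_l_distr[of k l a] that by simp
  have assoc: "(k * l) \<odot>\<^bsub>A\<^esub> a = k \<odot>\<^bsub>A\<^esub> (l \<odot>\<^bsub>A\<^esub> a)" if "a \<in> carrier A" for a k l
    using A.smult_assoc1[of k l a] that by simp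
  \<comment> \<open>Allows the supports of two functions to be replaced by one common finite set
    before adding.\<close>
  have ev_eq: "ev f = (\<Oplus>\<^bsub>A\<^esub>a\<in>S. \<lfloor>f a\<rfloor> \<odot>\<^bsub>A\<^esub> a)"
    if "finite S" "{x. f x \<noteq> 0} \<subseteq> S" "S \<subseteq> carrier A" for f S
    unfolding ev_def using that
    by (intro A.add.finprod_mono_neutral_cong_left) (auto simp: null closed subset_iff)
  have ev_add: "ev (\<lambda>x. f x + g x) = ev f \<oplus>\<^bsub>A\<^esub> ev g" if "f \<in> Z" "g \<in> Z" for f g
  proof -
    let ?S = "{x. f x \<noteq> 0} \<union> {x. g x \<noteq> 0}"
    have S: "finite ?S" "?S \<subseteq> carrier A"
      using that by (auto simp: Z_def finsupp_module_simps)
    have "ev (\<lambda>x. f x + g x) = (\<Oplus>\<^bsub>A\<^esub>a\<in>?S. \<lfloor>f a + g a\<rfloor> \<odot>\<^bsub>A\<^esub> a)"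
      using S by (intro ev_eq) auto
    also have "\<dots> = (\<Oplus>\<^bsub>A\<^esub>a\<in>?S. \<lfloor>f a\<rfloor> \<odot>\<^bsub>A\<^esub> a \<oplus>\<^bsub>A\<^esub> \<lfloor>g a\<rfloor> \<odot>\<^bsub>A\<^esub> a)"
    proof (rule A.M.finsum_cong')
      show "\<lfloor>f a + g a\<rfloor> \<odot>\<^bsub>A\<^esub> a = \<lfloor>f a\<rfloor> \<odot>\<^bsub>A\<^esub> a \<oplus>\<^bsub>A\<^esub> \<lfloor>g a\<rfloor> \<odot>\<^bsub>A\<^esub> a" if a: "a \<in> ?S" for a
      proof -
        have "f a \<in> \<int>" "g a \<in> \<int>"
          using \<open>f \<in> Z\<close> \<open>g \<in> Z\<close> by (auto simp: Z_def)
        then have "\<lfloor>f a + g a\<rfloor> = \<lfloor>f a\<rfloor> + \<lfloor>g a\<rfloor>"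
          by (auto elim!: Ints_cases)
        then show ?thesis
          using a S by (simp add: dist subset_iff)
      qed
    qed (use S in \<open>auto simp: closed\<close>)
    also have "\<dots> = (\<Oplus>\<^bsub>A\<^esub>a\<in>?S. \<lfloor>f a\<rfloor> \<odot>\<^bsub>A\<^esub> a) \<oplus>\<^bsub>A\<^esub> (\<Oplus>\<^bsub>A\<^esub>a\<in>?S. \<lfloor>g a\<rfloor> \<odot>\<^bsub>A\<^esub> a)"
      using S by (intro A.M.finsum_addf) (auto simp: closed)
    also have "\<dots> = ev f \<oplus>\<^bsub>A\<^esub> ev g"
      using S by (subst (1 2) ev_eq[symmetric]) auto
    finally show ?thesis .
  qed
  have ev_closed: "ev f \<in> carrier A" if "f \<in> Z" for f
    unfolding ev_def using that by (intro A.M.finsum_closed) (auto simp: Z_def finsupp_module_simps closed)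
  have ev_smult: "ev (\<lambda>x. of_int k * f x) = k \<odot>\<^bsub>A\<^esub> ev f" if "f \<in> Z" for k f
  proof -
    let ?S = "{x. f x \<noteq> 0}"
    have S: "finite ?S" "?S \<subseteq> carrier A"
      using that by (auto simp: Z_def finsupp_module_simps)
    have "ev (\<lambda>x. of_int k * f x) = (\<Oplus>\<^bsub>A\<^esub>a\<in>?S. \<lfloor>of_int k * f a\<rfloor> \<odot>\<^bsub>A\<^esub> a)"
      using S by (intro ev_eq) auto
    also have "\<dots> = (\<Oplus>\<^bsub>A\<^esub>a\<in>?S. k \<odot>\<^bsub>A\<^esub> (\<lfloor>f a\<rfloor> \<odot>\<^bsub>A\<^esub> a))"
    proof (rule A.M.finsum_cong')
      show "\<lfloor>of_int k * f a\<rfloor> \<odot>\<^bsub>A\<^esub> a = k \<odot>\<^bsub>A\<^esub> (\<lfloor>f a\<rfloor> \<odot>\<^bsub>A\<^esub> a)" if a: "a \<in> ?S" for a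
      proof -
        have "f a \<in> \<int>"
          using \<open>f \<in> Z\<close> by (auto simp: Z_def)
        then have "\<lfloor>of_int k * f a\<rfloor> = k * \<lfloor>f a\<rfloor>"
          by (auto elim!: Ints_cases simp flip: of_int_mult)
        then show ?thesis
          using a S by (simp add: assoc subset_iff)
      qed
    qed (use S in \<open>auto simp: closed\<close>)
    also have "\<dots> = k \<odot>\<^bsub>A\<^esub> ev f"
      unfolding ev_def using S by (intro A.finsum_smult_ldistr[symmetric]) (auto simp: closed)
    finally show ?thesis .
  qed
  have Z: "submodule Z \<Z> ?F"
    unfolding F.submodule_iff
  proof (intro conjI ballI)
    show "f \<oplus>\<^bsub>?F\<^esub> g \<in> Z" if "f \<in> Z" "g \<in> Z" for f g
      using that F.M.a_closed[of f g] by (auto simp: Z_def finsupp_module_simps(3))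
    show "k \<odot>\<^bsub>?F\<^esub> f \<in> Z" if "f \<in> Z" for k f
      using that F.smult_closed[of k f] by (auto simp: Z_def finsupp_module_simps(4))
  qed (auto simp: Z_def finsupp_module_simps)
  define K where "K = {f \<in> Z. ev f = \<zero>\<^bsub>A\<^esub>}"
  have K: "submodule K \<Z> ?F"
    unfolding F.submodule_iff
  proof (intro conjI ballI)
    show "\<zero>\<^bsub>?F\<^esub> \<in> K"
      using Z unfolding F.submodule_iff K_def by (simp add: ev_def finsupp_module_simps)
    show "f \<oplus>\<^bsub>?F\<^esub> g \<in> K" if "f \<in> K" "g \<in> K" for f g
      using that Z ev_add[of f g] unfolding F.submodule_iff K_def by (auto simp: finsupp_module_simps(3))
    show "k \<odot>\<^bsub>?F\<^esub> f \<in> K" if "f \<in> K" for k f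
      using that Z ev_smult[of f k] A.smult_r_null[of k] unfolding F.submodule_iff K_def
      by (auto simp: finsupp_module_simps(4))
  qed (use Z in \<open>auto simp: K_def F.submodule_iff\<close>)
  let ?D = "quot_module ?F K"
  note quot = quot_module_carrier[OF F.module_axioms K] quot_module_add[OF F.module_axioms K]
    quot_module_smult[OF F.module_axioms K] quot_module_coset_eq_iff[OF F.module_axioms K]
  have D: "module \<Z> ?D"
    by (rule module_quot[OF F.module_axioms K])
  have "baer \<Z> ?D"
  proof (rule divisible_imp_baer[OF D])
    fix d and k :: int assume d: "d \<in> carrier ?D" and k: "k \<noteq> 0"
    then obtain f where f: "f \<in> carrier ?F" "d = K +>\<^bsub>?F\<^esub> f"
      by (auto simp: quot)
    let ?g = "\<lambda>x. f x / of_int k"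
    have g: "?g \<in> carrier ?F"
      using f k by (auto simp: finsupp_module_simps)
    moreover have "k \<odot>\<^bsub>?F\<^esub> ?g = f"
      using k by (simp add: finsupp_module_simps)
    ultimately have "k \<odot>\<^bsub>?D\<^esub> (K +>\<^bsub>?F\<^esub> ?g) = d"
      using f by (subst quot(3)) auto
    then show "\<exists>e\<in>carrier ?D. k \<odot>\<^bsub>?D\<^esub> e = d"
      using g unfolding quot(1) by blast
  qed
  moreover define \<delta> where "\<delta> a = K +>\<^bsub>?F\<^esub> (\<lambda>x. if x = a then 1 else 0)" for a
  have single: "(\<lambda>x. if x = a then 1 else 0) \<in> Z" if "a \<in> carrier A" for a
    using that by (auto simp: Z_def finsupp_module_simps)
  have ev_single: "ev (\<lambda>x. if x = a then 1 else 0) = a" if "a \<in> carrier A" for a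
  proof -
    have "ev (\<lambda>x. if x = a then 1 else 0) = (\<Oplus>\<^bsub>A\<^esub>b\<in>{a}. \<lfloor>(if b = a then 1 else 0) :: rat\<rfloor> \<odot>\<^bsub>A\<^esub> b)"
      using that by (intro ev_eq) auto
    also have "\<dots> = a"
      using that A.smult_one[OF that] closed[OF that] by simp
    finally show ?thesis .
  qed
  have F_minus: "f \<ominus>\<^bsub>?F\<^esub> g = (\<lambda>x. f x + of_int (- 1) * g x)" if "g \<in> carrier ?F" for f g
  proof -
    have "\<ominus>\<^bsub>?F\<^esub> g = (\<lambda>x. - g x)"
      using F.smult_l_minus[of 1 g] F.smult_one[of g] that by (simp add: finsupp_module_simps(4))
    then show ?thesis
      by (simp add: a_minus_def finsupp_module_simps(3))
  qed
  \<comment> \<open>Two integral combinations agree modulo \<open>K\<close> exactly when they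
    evaluate to the same element. This yields both additivity and injectivity of
    \<open>\<delta>\<close>, because a basis vector evaluates to its index.\<close>
  have minusK: "f \<ominus>\<^bsub>?F\<^esub> g \<in> K \<longleftrightarrow> ev f = ev g" if fg: "f \<in> Z" "g \<in> Z" for f g
  proof -
    have g': "(\<lambda>x. of_int (- 1) * g x) \<in> Z"
      using submodule.smult_closed[OF Z, of "- 1" g] fg by (simp add: finsupp_module_simps(4))
    have "f \<ominus>\<^bsub>?F\<^esub> g = (\<lambda>x. f x + of_int (- 1) * g x)"
      using fg by (intro F_minus) (auto simp: Z_def)
    moreover have "ev (\<lambda>x. f x + of_int (- 1) * g x) = ev f \<oplus>\<^bsub>A\<^esub> (- 1) \<odot>\<^bsub>A\<^esub> ev g"
      using ev_add[OF fg(1) g'] ev_smult[OF fg(2), of "- 1"] by simp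
    moreover have "(- 1) \<odot>\<^bsub>A\<^esub> ev g = \<ominus>\<^bsub>A\<^esub> ev g"
      using A.smult_l_minus[of 1 "ev g"] A.smult_one[of "ev g"] ev_closed[OF fg(2)] by simp
    moreover have "f \<ominus>\<^bsub>?F\<^esub> g \<in> Z"
      by (rule F.submodule_minus[OF Z fg])
    ultimately show ?thesis
      using ev_closed fg A.minus_eq_zero_iff[of "ev f" "ev g"] by (simp add: K_def a_minus_def)
  qed
  have ZF: "f \<in> carrier ?F" if "f \<in> Z" for f
    using that by (simp add: Z_def)
  have "\<delta> \<in> mod_hom \<Z> A ?D"
  proof (rule additive_imp_int_linear[OF A D])
    show "\<delta> x \<in> carrier ?D" if "x \<in> carrier A" for x
      unfolding \<delta>_def quot(1) using single[OF that] ZF by blast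
    show "\<delta> (x \<oplus>\<^bsub>A\<^esub> y) = \<delta> x \<oplus>\<^bsub>?D\<^esub> \<delta> y" if xy: "x \<in> carrier A" "y \<in> carrier A" for x y
    proof -
      let ?s = "\<lambda>a x. (if x = a then 1 else 0) :: rat"
      have s: "?s x \<in> Z" "?s y \<in> Z" "?s (x \<oplus>\<^bsub>A\<^esub> y) \<in> Z"
        using xy by (auto intro!: single)
      have "?s x \<oplus>\<^bsub>?F\<^esub> ?s y \<in> Z"
        using s Z unfolding F.submodule_iff by blast
      moreover have "ev (?s x \<oplus>\<^bsub>?F\<^esub> ?s y) = ev (?s (x \<oplus>\<^bsub>A\<^esub> y))"
        using ev_add[OF s(1,2)] xy by (simp add: ev_single finsupp_module_simps(3))
      ultimately have "K +>\<^bsub>?F\<^esub> ?s (x \<oplus>\<^bsub>A\<^esub> y) = K +>\<^bsub>?F\<^esub> (?s x \<oplus>\<^bsub>?F\<^esub> ?s y)"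
        using s ZF minusK by (subst quot(4)) auto
      then show ?thesis
        unfolding \<delta>_def using s ZF by (simp add: quot(2))
    qed
  qed
  moreover have "inj_on \<delta> (carrier A)"
  proof (rule inj_onI)
    fix x y assume xy: "x \<in> carrier A" "y \<in> carrier A" "\<delta> x = \<delta> y"
    then show "x = y"
      using minusK[OF single single, of x y] quot(4) ZF single ev_single unfolding \<delta>_def by metis
  qed
  ultimately show ?thesis
    using K by blast
qed


text \<open>The coinduced module: additive maps from \<open>R\<close> to \<open>D\<close>, with
  \<open>r\<close> acting by precomposition with multiplication by \<open>r\<close>. Values outside
  the carrier are fixed to zero so that equality of functions is equality of module
  elements.\<close>

definition coind_module :: "('a, 'r) ring_scheme \<Rightarrow> (int, 'e) module \<Rightarrow> ('a, 'a \<Rightarrow> 'e) module" where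
  "coind_module R D =
     \<lparr>carrier = {\<phi>. \<phi> \<in> mod_hom \<Z> (zmodule R) D \<and> (\<forall>x. x \<notin> carrier R \<longrightarrow> \<phi> x = \<zero>\<^bsub>D\<^esub>)},
      monoid.mult = undefined, one = undefined, zero = (\<lambda>_. \<zero>\<^bsub>D\<^esub>),
      add = (\<lambda>\<phi> \<psi> x. \<phi> x \<oplus>\<^bsub>D\<^esub> \<psi> x),
      smult = (\<lambda>r \<phi> x. if x \<in> carrier R then \<phi> (x \<otimes>\<^bsub>R\<^esub> r) else \<zero>\<^bsub>D\<^esub>)\<rparr>"

lemma coind_module_simps:
  "\<zero>\<^bsub>coind_module R D\<^esub> = (\<lambda>_. \<zero>\<^bsub>D\<^esub>)"
  "\<phi> \<oplus>\<^bsub>coind_module R D\<^esub> \<psi> = (\<lambda>x. \<phi> x \<oplus>\<^bsub>D\<^esub> \<psi> x)"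
  "r \<odot>\<^bsub>coind_module R D\<^esub> \<phi> = (\<lambda>x. if x \<in> carrier R then \<phi> (x \<otimes>\<^bsub>R\<^esub> r) else \<zero>\<^bsub>D\<^esub>)"
  by (simp_all add: coind_module_def)

context
  fixes R :: "('a, 'r) ring_scheme" and D :: "(int, 'e) module"
  assumes R: "cring R" and D: "module \<Z> D"
begin

interpretation R: cring R by (rule R)
interpretation D: module \<Z> D by (rule D)

lemma coind_module_carrier:
  "\<phi> \<in> carrier (coind_module R D) \<longleftrightarrow>
     (\<forall>x\<in>carrier R. \<phi> x \<in> carrier D) \<and> (\<forall>x. x \<notin> carrier R \<longrightarrow> \<phi> x = \<zero>\<^bsub>D\<^esub>) \<and>
     (\<forall>x\<in>carrier R. \<forall>y\<in>carrier R. \<phi> (x \<oplus>\<^bsub>R\<^esub> y) = \<phi> x \<oplus>\<^bsub>D\<^esub> \<phi> y)"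
  (is "?l \<longleftrightarrow> ?r")
proof
  assume ?l
  then have \<phi>: "\<phi> \<in> mod_hom \<Z> (zmodule R) D" "\<forall>x. x \<notin> carrier R \<longrightarrow> \<phi> x = \<zero>\<^bsub>D\<^esub>"
    by (auto simp: coind_module_def)
  with mod_homD[OF \<phi>(1)] show ?r
    by simp
next
  assume ?r
  then have "\<phi> \<in> mod_hom \<Z> (zmodule R) D"
    by (intro additive_imp_int_linear module_zmodule D R.abelian_group_axioms) auto
  with \<open>?r\<close> show ?l
    by (simp add: coind_module_def)
qed

lemma coind_moduleD:
  assumes "\<phi> \<in> carrier (coind_module R D)"
  shows "\<phi> x \<in> carrier D" and "x \<notin> carrier R \<Longrightarrow> \<phi> x = \<zero>\<^bsub>D\<^esub>"
    and "x \<in> carrier R \<Longrightarrow> y \<in> carrier R \<Longrightarrow> \<phi> (x \<oplus>\<^bsub>R\<^esub> y) = \<phi> x \<oplus>\<^bsub>D\<^esub> \<phi> y"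
  using assms unfolding coind_module_carrier by (cases "x \<in> carrier R"; simp)+

lemma module_coind: "module R (coind_module R D)"
proof (rule moduleI'[OF R])
  note \<phi> = coind_moduleD
  show "\<exists>\<psi>\<in>carrier (coind_module R D). \<psi> \<oplus>\<^bsub>coind_module R D\<^esub> \<phi> = \<zero>\<^bsub>coind_module R D\<^esub>"
    if "\<phi> \<in> carrier (coind_module R D)" for \<phi>
  proof (intro bexI[of _ "\<lambda>x. \<ominus>\<^bsub>D\<^esub> \<phi> x"])
    show "(\<lambda>x. \<ominus>\<^bsub>D\<^esub> \<phi> x) \<in> carrier (coind_module R D)"
      unfolding coind_module_carrier using \<phi>[OF that] by (simp add: D.minus_add D.add.inv_one)
    show "(\<lambda>x. \<ominus>\<^bsub>D\<^esub> \<phi> x) \<oplus>\<^bsub>coind_module R D\<^esub> \<phi> = \<zero>\<^bsub>coind_module R D\<^esub>"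
      using \<phi>(1)[OF that] by (simp add: coind_module_simps D.l_neg)
  qed
  show "\<phi> \<oplus>\<^bsub>coind_module R D\<^esub> \<psi> \<in> carrier (coind_module R D)"
    if "\<phi> \<in> carrier (coind_module R D)" "\<psi> \<in> carrier (coind_module R D)" for \<phi> \<psi>
    unfolding coind_module_carrier coind_module_simps using \<phi>[OF that(1)] \<phi>[OF that(2)]
    by (simp add: D.a_ac)
  show "\<zero>\<^bsub>coind_module R D\<^esub> \<in> carrier (coind_module R D)"
    unfolding coind_module_carrier coind_module_simps by simp
  show "r \<odot>\<^bsub>coind_module R D\<^esub> \<phi> \<in> carrier (coind_module R D)"
    if "r \<in> carrier R" "\<phi> \<in> carrier (coind_module R D)" for r \<phi>
    unfolding coind_module_carrier coind_module_simps using \<phi>[OF that(2)] that(1)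
    by (simp add: R.l_distr)
  show "(a \<oplus>\<^bsub>R\<^esub> b) \<odot>\<^bsub>coind_module R D\<^esub> \<phi> =
      a \<odot>\<^bsub>coind_module R D\<^esub> \<phi> \<oplus>\<^bsub>coind_module R D\<^esub> b \<odot>\<^bsub>coind_module R D\<^esub> \<phi>"
    if "a \<in> carrier R" "b \<in> carrier R" "\<phi> \<in> carrier (coind_module R D)" for a b \<phi>
    unfolding coind_module_simps using \<phi>[OF that(3)] that by (auto simp: R.r_distr)
  show "(a \<otimes>\<^bsub>R\<^esub> b) \<odot>\<^bsub>coind_module R D\<^esub> \<phi> = a \<odot>\<^bsub>coind_module R D\<^esub> (b \<odot>\<^bsub>coind_module R D\<^esub> \<phi>)"
    if "a \<in> carrier R" "b \<in> carrier R" "\<phi> \<in> carrier (coind_module R D)" for a b \<phi>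
    unfolding coind_module_simps using that by (auto simp: R.m_assoc)
  show "\<one>\<^bsub>R\<^esub> \<odot>\<^bsub>coind_module R D\<^esub> \<phi> = \<phi>" if "\<phi> \<in> carrier (coind_module R D)" for \<phi>
    unfolding coind_module_simps using \<phi>(2)[OF that] by auto
  show "\<phi> \<oplus>\<^bsub>coind_module R D\<^esub> \<psi> \<oplus>\<^bsub>coind_module R D\<^esub> \<chi> = \<phi> \<oplus>\<^bsub>coind_module R D\<^esub> (\<psi> \<oplus>\<^bsub>coind_module R D\<^esub> \<chi>)"
    if "\<phi> \<in> carrier (coind_module R D)" "\<psi> \<in> carrier (coind_module R D)"
      "\<chi> \<in> carrier (coind_module R D)" for \<phi> \<psi> \<chi>
    unfolding coind_module_simps using \<phi>(1)[OF that(1)] \<phi>(1)[OF that(2)] \<phi>(1)[OF that(3)]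
    by (simp add: D.a_assoc)
  show "\<phi> \<oplus>\<^bsub>coind_module R D\<^esub> \<psi> = \<psi> \<oplus>\<^bsub>coind_module R D\<^esub> \<phi>"
    if "\<phi> \<in> carrier (coind_module R D)" "\<psi> \<in> carrier (coind_module R D)" for \<phi> \<psi>
    unfolding coind_module_simps using \<phi>(1)[OF that(1)] \<phi>(1)[OF that(2)] by (simp add: D.a_comm)
  show "\<zero>\<^bsub>coind_module R D\<^esub> \<oplus>\<^bsub>coind_module R D\<^esub> \<phi> = \<phi>" if "\<phi> \<in> carrier (coind_module R D)" for \<phi>
    unfolding coind_module_simps using \<phi>(1)[OF that] by simp
  show "a \<odot>\<^bsub>coind_module R D\<^esub> (\<phi> \<oplus>\<^bsub>coind_module R D\<^esub> \<psi>) =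
      a \<odot>\<^bsub>coind_module R D\<^esub> \<phi> \<oplus>\<^bsub>coind_module R D\<^esub> a \<odot>\<^bsub>coind_module R D\<^esub> \<psi>"
    if "a \<in> carrier R" for a \<phi> \<psi>
    unfolding coind_module_simps by auto
qed

end

text \<open>Evaluation at one turns an \<open>R\<close>-linear map from \<open>J\<close> to the
  coinduced module into an additive map from \<open>J\<close> to \<open>D\<close>. Its additive
  extension \<open>g\<close> to \<open>R\<close>, set to zero outside the carrier, is itself the
  element that Baer's condition asks for.\<close>

lemma baer_coind:
  assumes R: "cring R" and D: "baer \<Z> D"
  shows "baer R (coind_module R D)"
  unfolding baer_def
proof (intro conjI allI impI)
  let ?H = "coind_module R D"
  interpret R: cring R by (rule R)
  interpret D: module \<Z> D using D by (rule baer_module)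
  interpret H: module R ?H by (rule module_coind[OF R D.module_axioms])
  show "module R ?H" ..
  note HD = coind_moduleD[OF R D.module_axioms]
  fix J F assume *: "ideal J R \<and> F \<in> mod_hom R ((regular_module R)\<lparr>carrier := J\<rparr>) ?H"
  then interpret J: ideal J R by blast
  have F: "j \<in> J \<Longrightarrow> F j \<in> carrier ?H"
    "i \<in> J \<Longrightarrow> j \<in> J \<Longrightarrow> F (i \<oplus>\<^bsub>R\<^esub> j) = F i \<oplus>\<^bsub>?H\<^esub> F j"
    "r \<in> carrier R \<Longrightarrow> j \<in> J \<Longrightarrow> F (r \<otimes>\<^bsub>R\<^esub> j) = r \<odot>\<^bsub>?H\<^esub> F j" for i j r
    using * mod_homD[of F R "(regular_module R)\<lparr>carrier := J\<rparr>" ?H] by auto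
  have ZR: "module \<Z> (zmodule R)"
    by (rule module_zmodule) (rule R.abelian_group_axioms)
  define J' where "J' = R\<lparr>carrier := J\<rparr>"
  have J': "abelian_group J'"
    unfolding J'_def
    by (rule abelian_groupI) (auto simp: R.a_ac R.r_neg intro!: bexI[of _ "\<ominus>\<^bsub>R\<^esub> _"])
  have ZJ: "module \<Z> (zmodule J')"
    by (rule module_zmodule) (rule J')
  have i: "(\<lambda>x. x) \<in> mod_hom \<Z> (zmodule J') (zmodule R)"
    by (rule additive_imp_int_linear[OF ZJ ZR]) (auto simp: J'_def)
  have e: "(\<lambda>j. F j \<one>\<^bsub>R\<^esub>) \<in> mod_hom \<Z> (zmodule J') D"
    by (rule additive_imp_int_linear[OF ZJ D.module_axioms])
      (auto simp: J'_def F HD(1)[OF F(1)] coind_module_simps)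
  have "F \<zero>\<^bsub>R\<^esub> \<one>\<^bsub>R\<^esub> = \<zero>\<^bsub>D\<^esub>"
    using mod_hom_zero[OF ZJ D.module_axioms e] by (simp add: J'_def)
  then obtain g where g: "g \<in> mod_hom \<Z> (zmodule R) D" "\<And>j. j \<in> J \<Longrightarrow> g j = F j \<one>\<^bsub>R\<^esub>"
    using baer_factor[OF ZJ ZR D i e] by (auto simp: J'_def)
  let ?e = "\<lambda>x. if x \<in> carrier R then g x else \<zero>\<^bsub>D\<^esub>"
  have "?e \<in> carrier ?H"
    unfolding coind_module_carrier[OF R D.module_axioms] using mod_homD[OF g(1)] by simp
  moreover have "F j = j \<odot>\<^bsub>?H\<^esub> ?e" if j: "j \<in> J" for j
  proof
    fix x
    show "F j x = (j \<odot>\<^bsub>?H\<^esub> ?e) x"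
    proof (cases "x \<in> carrier R")
      case True
      then have "x \<otimes>\<^bsub>R\<^esub> j \<in> J"
        using j J.I_l_closed by blast
      then have "g (x \<otimes>\<^bsub>R\<^esub> j) = F (x \<otimes>\<^bsub>R\<^esub> j) \<one>\<^bsub>R\<^esub>"
        using g(2) by simp
      also have "\<dots> = F j x"
        using True j by (simp add: F(3) coind_module_simps)
      finally show ?thesis
        using True j J.a_Hcarr by (simp add: coind_module_simps)
    next
      case False
      then show ?thesis
        using HD(2)[OF F(1)[OF j]] by (simp add: coind_module_simps)
    qed
  qed
  ultimately show "\<exists>e\<in>carrier ?H. \<forall>r\<in>J. F r = r \<odot>\<^bsub>?H\<^esub> e"
    by blast
qed

subsection \<open>Existence of injective resolutions\<close>

text \<open>
  A finitely supported function is encoded by the finite sequence of the points of its graph.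
\<close>

definition encode_pair :: "('a, 'b) resol_elem \<Rightarrow> rat \<Rightarrow> ('a, 'b) resol_elem" where
  "encode_pair x q =
     Seq (\<lambda>m. if m = 0 then x else if m = Suc (to_nat q) then Elem undefined else Seq undefined)"

text \<open>After position 0, the marker \<open>Elem undefined\<close> occurs only at position
  \<open>Suc (to_nat q)\<close>, so the sequence recovers \<open>q\<close> as well as
  \<open>x\<close>.\<close>

lemma encode_pair_eq_iff: "encode_pair x q = encode_pair y r \<longleftrightarrow> x = y \<and> q = r"
proof
  assume *: "encode_pair x q = encode_pair y r"
  then have eq: "(if m = 0 then x else if m = Suc (to_nat q) then Elem undefined else Seq undefined) =
      (if m = 0 then y else if m = Suc (to_nat r) then Elem undefined else Seq undefined)" for m
    by (simp add: encode_pair_def fun_eq_iff)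
  have "to_nat q = to_nat r"
    using eq[of "Suc (to_nat q)"] by (auto split: if_splits)
  then show "x = y \<and> q = r"
    using eq[of 0] by simp
qed auto

definition encode_fun :: "(('a, 'b) resol_elem \<Rightarrow> rat) \<Rightarrow> ('a, 'b) resol_elem" where
  "encode_fun f =
     (let l = (SOME l. set l = {x. f x \<noteq> 0}) in
      Seq (\<lambda>k. if k < length l then encode_pair (l ! k) (f (l ! k)) else Elem undefined))"

text \<open>The enumeration of the support is chosen arbitrarily, so sequences are compared through
  their ranges: removing the padding \<open>Elem undefined\<close>, which is never an encoded pair,
  leaves the encoded graph of the function on its support.\<close>

lemma inj_on_encode_fun: "inj_on encode_fun {f. finite {x. f x \<noteq> 0}}"
proof (rule inj_onI)
  have *: "\<exists>s. encode_fun f = Seq s \<and>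
      range s - {Elem undefined} = (\<lambda>x. encode_pair x (f x)) ` {x. f x \<noteq> 0}"
    if "finite {x. f x \<noteq> 0}" for f :: "('a, 'b) resol_elem \<Rightarrow> rat"
  proof -
    define l where "l = (SOME l. set l = {x. f x \<noteq> 0})"
    define s where
      "s = (\<lambda>k. if k < length l then encode_pair (l ! k) (f (l ! k)) else Elem undefined)"
    have "set l = {x. f x \<noteq> 0}"
      unfolding l_def using finite_list[OF that] by (rule someI_ex)
    moreover have "range s - {Elem undefined} = (\<lambda>x. encode_pair x (f x)) ` set l"
    proof -
      have "encode_pair x q \<noteq> Elem undefined" for x :: "('a, 'b) resol_elem" and q
        by (simp add: encode_pair_def)
      then show ?thesis
        unfolding s_def set_conv_nth by (auto split: if_splits)
    qed
    moreover have "encode_fun f = Seq s"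
      unfolding encode_fun_def s_def Let_def l_def[symmetric] by simp
    ultimately show ?thesis
      by auto
  qed
  fix f g :: "('a, 'b) resol_elem \<Rightarrow> rat"
  assume fg: "f \<in> {f. finite {x. f x \<noteq> 0}}" "g \<in> {f. finite {x. f x \<noteq> 0}}" "encode_fun f = encode_fun g"
  then have eq: "(\<lambda>x. encode_pair x (f x)) ` {x. f x \<noteq> 0} = (\<lambda>x. encode_pair x (g x)) ` {x. g x \<noteq> 0}"
    using *[of f] *[of g] by (metis (no_types, lifting) mem_Collect_eq resol_elem.inject(2))
  show "f = g"
  proof
    fix x
    have "f x = g x" if "f x \<noteq> 0"
    proof -
      have "encode_pair x (f x) \<in> (\<lambda>x. encode_pair x (g x)) ` {x. g x \<noteq> 0}"
        unfolding eq[symmetric] using that by auto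
      then show ?thesis
        by (auto simp: encode_pair_eq_iff)
    qed
    moreover have "f x = g x" if "g x \<noteq> 0"
    proof -
      have "encode_pair x (g x) \<in> (\<lambda>x. encode_pair x (f x)) ` {x. f x \<noteq> 0}"
        unfolding eq using that by auto
      then show ?thesis
        by (auto simp: encode_pair_eq_iff)
    qed
    ultimately show "f x = g x"
      by metis
  qed
qed

text \<open>Choosing a representative of each coset places a quotient back in the element type of
  \<open>M\<close>; this keeps iterated cokernels in a single type.\<close>

lemma inj_on_quot_module_rep:
  assumes "module R M" "submodule N R M"
  shows "inj_on (\<lambda>X. SOME x. x \<in> X) (carrier (quot_module M N))"
    and "X \<in> carrier (quot_module M N) \<Longrightarrow> (SOME x. x \<in> X) \<in> carrier M"
proof -
  interpret M: module R M by fact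
  interpret N: abelian_subgroup N M
    by (rule abelian_subgroupI3)
      (use assms(2) in \<open>auto simp: submodule_def additive_subgroup_def M.abelian_group_axioms\<close>)
  have rep: "(SOME x. x \<in> X) \<in> carrier M \<and> X = N +>\<^bsub>M\<^esub> (SOME x. x \<in> X)"
    if X: "X \<in> carrier (quot_module M N)" for X
  proof -
    obtain x where x: "x \<in> carrier M" "X = N +>\<^bsub>M\<^esub> x"
      using X unfolding quot_module_carrier[OF assms] by blast
    have "x \<in> X"
      unfolding x(2) using x(1) by (rule N.a_rcos_self)
    then have "(SOME x. x \<in> X) \<in> X"
      by (rule someI)
    then show ?thesis
      using x N.a_repr_independence'[of "SOME x. x \<in> X" x] N.a_elemrcos_carrier by blast
  qed
  then show "inj_on (\<lambda>X. SOME x. x \<in> X) (carrier (quot_module M N))"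
    by (intro inj_onI) metis
  show "(SOME x. x \<in> X) \<in> carrier M" if "X \<in> carrier (quot_module M N)"
    using rep[OF that] by blast
qed

lemma divisible_embedding_resol_elem:
  fixes A :: "(int, ('a, 'b) resol_elem) module"
  assumes A: "module \<Z> A"
  shows "\<exists>(D :: (int, ('a, 'b) resol_elem) module) \<delta>. baer \<Z> D \<and> \<delta> \<in> mod_hom \<Z> A D \<and> inj_on \<delta> (carrier A)"
proof -
  let ?F = "finsupp_module (carrier A)"
  obtain K \<delta> where *: "submodule K \<Z> ?F" "baer \<Z> (quot_module ?F K)"
    "\<delta> \<in> mod_hom \<Z> A (quot_module ?F K)" "inj_on \<delta> (carrier A)"
    using divisible_embedding[OF A] by blast
  note rep = inj_on_quot_module_rep[OF module_finsupp *(1)]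
  let ?u = "\<lambda>X. encode_fun (SOME x. x \<in> X)"
  have u: "inj_on ?u (carrier (quot_module ?F K))"
  proof (rule comp_inj_on[OF rep(1), of encode_fun, unfolded comp_def])
    show "inj_on encode_fun ((\<lambda>X. SOME x. x \<in> X) ` carrier (quot_module ?F K))"
      using rep(2) by (intro inj_on_subset[OF inj_on_encode_fun]) (auto simp: finsupp_module_simps)
  qed
  have "inj_on (\<lambda>x. ?u (\<delta> x)) (carrier A)"
    using mod_homD(1)[OF *(3)] by (intro comp_inj_on[OF *(4), of ?u, unfolded comp_def] inj_on_subset[OF u]) auto
  moreover have "(\<lambda>x. ?u (\<delta> x)) \<in> mod_hom \<Z> A (transport_module ?u (quot_module ?F K))"
    by (rule mod_hom_comp[OF *(3) transport_module_hom[OF u]])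
  ultimately show ?thesis
    using baer_transport[OF *(2) u] by blast
qed

text \<open>Given an embedding \<open>\<delta>\<close> of \<open>A\<close> into a divisible group,
  \<open>a \<mapsto> (r \<mapsto> \<delta> (r a))\<close> maps \<open>A\<close> linearly into the
  coinduced module, and the value at one recovers \<open>\<delta> a\<close>. The constructor
  \<open>Fam\<close> then codes these functions in the type of the resolutions.\<close>

lemma enough_injectives:
  fixes A :: "('a, ('a, 'b) resol_elem) module"
  assumes A: "module R A"
  shows "\<exists>(I :: ('a, ('a, 'b) resol_elem) module) \<iota>. baer R I \<and> \<iota> \<in> mod_hom R A I \<and> inj_on \<iota> (carrier A)"
proof -
  interpret A: module R A by fact
  have ZA: "module \<Z> (zmodule A)"
    by (rule module_zmodule) (rule A.abelian_group_axioms)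
  obtain D :: "(int, ('a, 'b) resol_elem) module" and \<delta>
    where D: "baer \<Z> D" "\<delta> \<in> mod_hom \<Z> (zmodule A) D" "inj_on \<delta> (carrier A)"
    using divisible_embedding_resol_elem[OF ZA] by auto
  let ?H = "coind_module R D"
  note R = A.is_cring and DZ = baer_module[OF D(1)]
  define \<iota> where "\<iota> a = (\<lambda>r. if r \<in> carrier R then \<delta> (r \<odot>\<^bsub>A\<^esub> a) else \<zero>\<^bsub>D\<^esub>)" for a
  have \<delta>: "x \<in> carrier A \<Longrightarrow> \<delta> x \<in> carrier D"
    "x \<in> carrier A \<Longrightarrow> y \<in> carrier A \<Longrightarrow> \<delta> (x \<oplus>\<^bsub>A\<^esub> y) = \<delta> x \<oplus>\<^bsub>D\<^esub> \<delta> y" for x y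
    using mod_homD[OF D(2)] by auto
  interpret D: module \<Z> D by (rule DZ)
  have \<iota>: "\<iota> \<in> mod_hom R A ?H"
  proof (rule mod_homI)
    show "\<iota> a \<in> carrier ?H" if "a \<in> carrier A" for a
      unfolding coind_module_carrier[OF R DZ] \<iota>_def using that \<delta> by (simp add: A.smult_l_distr)
    show "\<iota> (a \<oplus>\<^bsub>A\<^esub> b) = \<iota> a \<oplus>\<^bsub>?H\<^esub> \<iota> b" if "a \<in> carrier A" "b \<in> carrier A" for a b
      unfolding \<iota>_def coind_module_simps using that \<delta> by (auto simp: A.smult_r_distr fun_eq_iff)
    show "\<iota> (r \<odot>\<^bsub>A\<^esub> a) = r \<odot>\<^bsub>?H\<^esub> \<iota> a" if "r \<in> carrier R" "a \<in> carrier A" for r a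
      unfolding \<iota>_def coind_module_simps using that by (auto simp: A.smult_assoc1 fun_eq_iff)
  qed
  have "inj_on \<iota> (carrier A)"
  proof (rule inj_onI)
    fix a b assume ab: "a \<in> carrier A" "b \<in> carrier A" "\<iota> a = \<iota> b"
    then have "\<delta> a = \<delta> b"
      using fun_cong[OF ab(3), of "\<one>\<^bsub>R\<^esub>"] unfolding \<iota>_def by simp
    then show "a = b"
      using D(3) ab by (auto dest: inj_onD)
  qed
  then have "inj_on (\<lambda>a. Fam (\<iota> a)) (carrier A)"
    by (auto simp: inj_on_def)
  moreover have Fam: "inj_on Fam (carrier ?H)"
    by (auto simp: inj_on_def)
  moreover have "(\<lambda>a. Fam (\<iota> a)) \<in> mod_hom R A (transport_module Fam ?H)"
    by (rule mod_hom_comp[OF \<iota> transport_module_hom[OF Fam]])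
  ultimately show ?thesis
    using baer_transport[OF baer_coind[OF R D(1)] Fam] by blast
qed

text \<open>Iterates the embedding into an injective module followed by passage to the cokernel.
  Cokernels are represented inside the same type, so a plain recursion over modules is
  possible.\<close>

lemma injective_resolution_exists:
  fixes N :: "('a, 'b, 'm) module_scheme"
  assumes N: "module R N"
  shows "\<exists>(E :: nat \<Rightarrow> ('a, ('a, 'b) resol_elem) module) \<epsilon> d. injective_resolution R N E \<epsilon> d"
proof -
  have "\<exists>(I :: ('a, ('a, 'b) resol_elem) module) \<iota> (C :: ('a, ('a, 'b) resol_elem) module) p.
      baer R I \<and> \<iota> \<in> mod_hom R A I \<and> inj_on \<iota> (carrier A) \<and> module R C \<and> p \<in> mod_hom R I C \<and>
      p ` carrier I = carrier C \<and> (\<forall>x\<in>carrier I. p x = \<zero>\<^bsub>C\<^esub> \<longleftrightarrow> x \<in> \<iota> ` carrier A)"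
    if A: "module R A" for A :: "('a, ('a, 'b) resol_elem) module"
  proof -
    obtain I :: "('a, ('a, 'b) resol_elem) module" and \<iota>
      where I: "baer R I" "\<iota> \<in> mod_hom R A I" "inj_on \<iota> (carrier A)"
      using enough_injectives[OF A] by blast
    note IM = baer_module[OF I(1)]
    let ?S = "\<iota> ` carrier A" and ?u = "\<lambda>X. SOME x. x \<in> X"
    have S: "submodule ?S R I"
      by (rule mod_hom_image_submodule[OF A IM I(2)])
    let ?Q = "quot_module I ?S"
    have inj: "inj_on ?u (carrier ?Q)"
      by (rule inj_on_quot_module_rep(1)[OF IM S])
    interpret Q: module R ?Q by (rule module_quot[OF IM S])
    let ?C = "transport_module ?u ?Q" and ?p = "\<lambda>x. ?u (?S +>\<^bsub>I\<^esub> x)"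
    have "?p x = \<zero>\<^bsub>?C\<^esub> \<longleftrightarrow> x \<in> ?S" if x: "x \<in> carrier I" for x
    proof -
      have "?S +>\<^bsub>I\<^esub> x \<in> carrier ?Q"
        using x unfolding quot_module_carrier[OF IM S] by blast
      then have "?p x = ?u \<zero>\<^bsub>?Q\<^esub> \<longleftrightarrow> ?S +>\<^bsub>I\<^esub> x = \<zero>\<^bsub>?Q\<^esub>"
        by (intro inj_on_eq_iff[OF inj]) auto
      then show ?thesis
        using quot_module_coset_eq_zero_iff[OF IM S x] by simp
    qed
    moreover have "?p \<in> mod_hom R I ?C"
      by (rule mod_hom_comp[OF mod_hom_quot[OF IM S] transport_module_hom[OF inj]])
    moreover have "?p ` carrier I = carrier ?C"
      by (simp add: quot_module_carrier[OF IM S] image_image)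
    ultimately show ?thesis
      using I module_transport[OF Q.module_axioms inj] by blast
  qed
  then obtain I :: "('a, ('a, 'b) resol_elem) module \<Rightarrow> ('a, ('a, 'b) resol_elem) module" and \<iota>
    and C :: "('a, ('a, 'b) resol_elem) module \<Rightarrow> ('a, ('a, 'b) resol_elem) module" and p
    where step: "\<And>A. module R A \<Longrightarrow> baer R (I A) \<and> \<iota> A \<in> mod_hom R A (I A) \<and> inj_on (\<iota> A) (carrier A) \<and>
      module R (C A) \<and> p A \<in> mod_hom R (I A) (C A) \<and> p A ` carrier (I A) = carrier (C A) \<and>
      (\<forall>x\<in>carrier (I A). p A x = \<zero>\<^bsub>C A\<^esub> \<longleftrightarrow> x \<in> \<iota> A ` carrier A)"
    by metis
  have inj: "inj_on Elem (carrier N)"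
    by (auto simp: inj_on_def)
  \<comment> \<open>The cosyzygies: the copy of \<open>N\<close> in degree 0, afterwards the
    cokernel of the previous embedding.\<close>
  define X where "X = rec_nat (transport_module Elem N) (\<lambda>_. C)"
  have X0: "X 0 = transport_module Elem N" and XSuc: "\<And>k. X (Suc k) = C (X k)"
    by (simp_all add: X_def)
  have X: "module R (X k)" for k
    by (induction k) (use step in \<open>auto simp: X0 XSuc intro: module_transport[OF N inj]\<close>)
  note s = step[OF X]
  \<comment> \<open>Project onto the cokernel, then embed the cokernel into the next injective;
    since the second map is injective, the kernel of \<open>d k\<close> is that of the
    projection.\<close>
  define d where "d k x = \<iota> (X (Suc k)) (p (X k) x)" for k x
  have d: "d k \<in> mod_hom R (I (X k)) (I (X (Suc k)))" for k
    unfolding d_def using mod_hom_comp[of "p (X k)" R _ _ "\<iota> (X (Suc k))"] s[of k] s[of "Suc k"]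
    by (auto simp: XSuc)
  have d_zero: "d k x = \<zero>\<^bsub>I (X (Suc k))\<^esub> \<longleftrightarrow> x \<in> \<iota> (X k) ` carrier (X k)" if x: "x \<in> carrier (I (X k))" for k x
  proof -
    have px: "p (X k) x \<in> carrier (X (Suc k))"
      using s[of k] x unfolding XSuc by blast
    interpret X: module R "X (Suc k)" by (rule X)
    have "\<iota> (X (Suc k)) \<zero>\<^bsub>X (Suc k)\<^esub> = \<zero>\<^bsub>I (X (Suc k))\<^esub>"
      using mod_hom_zero[OF X baer_module] s[of "Suc k"] by blast
    then have "d k x = \<zero>\<^bsub>I (X (Suc k))\<^esub> \<longleftrightarrow> p (X k) x = \<zero>\<^bsub>X (Suc k)\<^esub>"
      unfolding d_def using s[of "Suc k"] px by (metis X.M.zero_closed inj_on_eq_iff)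
    then show ?thesis
      using s[of k] x by (simp add: XSuc)
  qed
  have \<iota>_closed: "\<iota> (X k) ` carrier (X k) \<subseteq> carrier (I (X k))" for k
  proof -
    have "\<iota> (X k) \<in> mod_hom R (X k) (I (X k))"
      using s by blast
    from mod_homD(1)[OF this] show ?thesis
      by blast
  qed
  have d_img: "d k ` carrier (I (X k)) = \<iota> (X (Suc k)) ` carrier (X (Suc k))" for k
    unfolding d_def using s[of k] by (metis XSuc image_image)
  have "injective_resolution R N (\<lambda>k. I (X k)) (\<lambda>x. \<iota> (X 0) (Elem x)) d"
    unfolding injective_resolution_def
  proof (intro conjI allI)
    show "injective_module R (I (X k))" for k
      using s by (intro injective_module_baer) blast
    show "(\<lambda>x. \<iota> (X 0) (Elem x)) \<in> mod_hom R N (I (X 0))"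
      using s[of 0] by (intro mod_hom_comp[OF transport_module_hom[OF inj]]) (simp add: X0)
    show "inj_on (\<lambda>x. \<iota> (X 0) (Elem x)) (carrier N)"
      using s[of 0] by (intro comp_inj_on[OF inj, unfolded comp_def]) (simp add: X0)
    have "carrier (X 0) = Elem ` carrier N"
      by (simp add: X0)
    then have "(\<lambda>x. \<iota> (X 0) (Elem x)) ` carrier N = \<iota> (X 0) ` carrier (X 0)"
      by (simp add: image_image)
    then show "(\<lambda>x. \<iota> (X 0) (Elem x)) ` carrier N = {x \<in> carrier (I (X 0)). d 0 x = \<zero>\<^bsub>I (X 1)\<^esub>}"
      using d_zero[of _ 0] \<iota>_closed[of 0] by auto
    show "d k ` carrier (I (X k)) =
        {x \<in> carrier (I (X (Suc k))). d (Suc k) x = \<zero>\<^bsub>I (X (Suc (Suc k)))\<^esub>}" for k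
      using d_zero[of _ "Suc k"] \<iota>_closed[of "Suc k"] by (auto simp: d_img)
  qed (rule d)
  then show ?thesis
    by blast
qed

subsection \<open>The torsion functor\<close>

context
  fixes R :: "('a, 'r) ring_scheme" and \<aa> :: "'a set"
  assumes R: "cring R" and \<aa>: "ideal \<aa> R"
begin

interpretation R: cring R by (rule R)

lemma ideal_pow_ideal: "ideal (\<aa> [^]\<^bsub>ideals_set R\<^esub> (n :: nat)) R"
proof (induction n)
  case 0
  then show ?case
    by (simp add: ideals_set_def nat_pow_def R.oneideal)
next
  case (Suc n)
  then show ?case
    using R.ideal_prod_is_ideal[OF Suc \<aa>] by (simp add: ideals_set_def nat_pow_def)
qed

lemma ideal_pow_Suc:
  "\<aa> [^]\<^bsub>ideals_set R\<^esub> Suc n = (\<aa> [^]\<^bsub>ideals_set R\<^esub> n) \<cdot>\<^bsub>R\<^esub> \<aa>"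
  by (simp add: ideals_set_def nat_pow_def)

lemma ideal_pow_antimono:
  assumes "m \<le> n"
  shows "\<aa> [^]\<^bsub>ideals_set R\<^esub> n \<subseteq> \<aa> [^]\<^bsub>ideals_set R\<^esub> (m :: nat)"
  using assms
proof (induction n rule: dec_induct)
  case (step n)
  then show ?case
    using R.ideal_prod_inter[OF ideal_pow_ideal[of n] \<aa>] unfolding ideal_pow_Suc by blast
qed auto

lemma torsion_part_carrier: "x \<in> torsion_part R \<aa> N \<Longrightarrow> x \<in> carrier N"
  by (simp add: torsion_part_def)

lemma torsion_part_submodule:
  assumes "module R N"
  shows "submodule (torsion_part R \<aa> N) R N"
proof -
  interpret N: module R N by fact
  note pow_carr = ideal.Icarr[OF ideal_pow_ideal]
  show ?thesis
    unfolding N.submodule_iff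
  proof (intro conjI ballI)
    show "torsion_part R \<aa> N \<subseteq> carrier N" "\<zero>\<^bsub>N\<^esub> \<in> torsion_part R \<aa> N"
      using pow_carr by (auto simp: torsion_part_def intro!: exI[of _ 0])
    show "x \<oplus>\<^bsub>N\<^esub> y \<in> torsion_part R \<aa> N" if xy: "x \<in> torsion_part R \<aa> N" "y \<in> torsion_part R \<aa> N" for x y
    proof -
      obtain m n where mn: "\<forall>r\<in>\<aa> [^]\<^bsub>ideals_set R\<^esub> (m::nat). r \<odot>\<^bsub>N\<^esub> x = \<zero>\<^bsub>N\<^esub>"
          "\<forall>r\<in>\<aa> [^]\<^bsub>ideals_set R\<^esub> (n::nat). r \<odot>\<^bsub>N\<^esub> y = \<zero>\<^bsub>N\<^esub>" "x \<in> carrier N" "y \<in> carrier N"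
        using xy by (auto simp: torsion_part_def)
      have "r \<odot>\<^bsub>N\<^esub> (x \<oplus>\<^bsub>N\<^esub> y) = \<zero>\<^bsub>N\<^esub>" if r: "r \<in> \<aa> [^]\<^bsub>ideals_set R\<^esub> (max m n)" for r
      proof -
        have "r \<odot>\<^bsub>N\<^esub> x = \<zero>\<^bsub>N\<^esub>" "r \<odot>\<^bsub>N\<^esub> y = \<zero>\<^bsub>N\<^esub>"
          using r mn ideal_pow_antimono[of m "max m n"] ideal_pow_antimono[of n "max m n"] by auto
        then show ?thesis
          using mn pow_carr[OF r] by (simp add: N.smult_r_distr)
      qed
      then show ?thesis
        using mn by (auto simp: torsion_part_def)
    qed
    show "r \<odot>\<^bsub>N\<^esub> x \<in> torsion_part R \<aa> N" if r: "r \<in> carrier R" and x: "x \<in> torsion_part R \<aa> N" for r x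
    proof -
      obtain n where n: "\<forall>r\<in>\<aa> [^]\<^bsub>ideals_set R\<^esub> (n::nat). r \<odot>\<^bsub>N\<^esub> x = \<zero>\<^bsub>N\<^esub>" "x \<in> carrier N"
        using x by (auto simp: torsion_part_def)
      have "s \<odot>\<^bsub>N\<^esub> (r \<odot>\<^bsub>N\<^esub> x) = \<zero>\<^bsub>N\<^esub>" if s: "s \<in> \<aa> [^]\<^bsub>ideals_set R\<^esub> n" for s
        using n s r pow_carr[OF s] N.smult_commute[of s r x] by simp
      then show ?thesis
        using n r by (auto simp: torsion_part_def)
    qed
  qed
qed

lemma torsion_part_hom:
  assumes "module R M" "module R N" "f \<in> mod_hom R M N" "x \<in> torsion_part R \<aa> M"
  shows "f x \<in> torsion_part R \<aa> N"
proof -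
  obtain n where n: "\<forall>r\<in>\<aa> [^]\<^bsub>ideals_set R\<^esub> (n::nat). r \<odot>\<^bsub>M\<^esub> x = \<zero>\<^bsub>M\<^esub>" "x \<in> carrier M"
    using assms(4) by (auto simp: torsion_part_def)
  have "r \<odot>\<^bsub>N\<^esub> f x = \<zero>\<^bsub>N\<^esub>" if r: "r \<in> \<aa> [^]\<^bsub>ideals_set R\<^esub> n" for r
  proof -
    have "r \<odot>\<^bsub>N\<^esub> f x = f (r \<odot>\<^bsub>M\<^esub> x)"
      using mod_homD(3)[OF assms(3) ideal.Icarr[OF ideal_pow_ideal r] n(2)] by simp
    then show ?thesis
      using n r mod_hom_zero[OF assms(1-3)] by simp
  qed
  then show ?thesis
    using mod_homD(1)[OF assms(3) n(2)] by (auto simp: torsion_part_def)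
qed

lemma torsion_part_prod:
  assumes "module R M" "module R N"
  shows "torsion_part R \<aa> (prod_module M N) = torsion_part R \<aa> M \<times> torsion_part R \<aa> N"
proof -
  have "(x, y) \<in> torsion_part R \<aa> (prod_module M N)"
    if xy: "x \<in> torsion_part R \<aa> M" "y \<in> torsion_part R \<aa> N" for x y
  proof -
    obtain m n where mn: "\<forall>r\<in>\<aa> [^]\<^bsub>ideals_set R\<^esub> (m::nat). r \<odot>\<^bsub>M\<^esub> x = \<zero>\<^bsub>M\<^esub>"
        "\<forall>r\<in>\<aa> [^]\<^bsub>ideals_set R\<^esub> (n::nat). r \<odot>\<^bsub>N\<^esub> y = \<zero>\<^bsub>N\<^esub>" "x \<in> carrier M" "y \<in> carrier N"
      using xy by (auto simp: torsion_part_def)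
    have "r \<odot>\<^bsub>M\<^esub> x = \<zero>\<^bsub>M\<^esub> \<and> r \<odot>\<^bsub>N\<^esub> y = \<zero>\<^bsub>N\<^esub>" if r: "r \<in> \<aa> [^]\<^bsub>ideals_set R\<^esub> (max m n)" for r
      using r mn ideal_pow_antimono[of m "max m n"] ideal_pow_antimono[of n "max m n"] by auto
    then show ?thesis
      using mn by (auto simp: torsion_part_def)
  qed
  moreover have "x \<in> torsion_part R \<aa> M \<and> y \<in> torsion_part R \<aa> N"
    if "(x, y) \<in> torsion_part R \<aa> (prod_module M N)" for x y
    using that unfolding torsion_part_def by simp blast
  ultimately show ?thesis
    by auto
qed

end

subsection \<open>Resolutions and the comparison theorem\<close>

text \<open>Injectivity is expressed by \<open>baer\<close>, so every element type is allowed, for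
  instance products of two resolutions or modules with elements in \<open>unit\<close>. Exactness is
  stated as an equivalence in each degree to suit elementwise use.\<close>

definition baer_resolution ::
  "('a, 'r) ring_scheme \<Rightarrow> ('a, 'b, 'm) module_scheme \<Rightarrow>
   (nat \<Rightarrow> ('a, 'e) module) \<Rightarrow> ('b \<Rightarrow> 'e) \<Rightarrow> (nat \<Rightarrow> 'e \<Rightarrow> 'e) \<Rightarrow> bool" where
  "baer_resolution R N E \<epsilon> d \<longleftrightarrow>
     module R N \<and> (\<forall>k. baer R (E k)) \<and>
     \<epsilon> \<in> mod_hom R N (E 0) \<and> (\<forall>x\<in>carrier N. \<epsilon> x = \<zero>\<^bsub>E 0\<^esub> \<longrightarrow> x = \<zero>\<^bsub>N\<^esub>) \<and>
     (\<forall>k. d k \<in> mod_hom R (E k) (E (Suc k))) \<and>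
     (\<forall>x\<in>carrier (E 0). d 0 x = \<zero>\<^bsub>E (Suc 0)\<^esub> \<longleftrightarrow> x \<in> \<epsilon> ` carrier N) \<and>
     (\<forall>k. \<forall>x\<in>carrier (E (Suc k)). d (Suc k) x = \<zero>\<^bsub>E (Suc (Suc k))\<^esub> \<longleftrightarrow> x \<in> d k ` carrier (E k))"

lemma baer_resolutionD:
  assumes "baer_resolution R N E \<epsilon> d"
  shows "module R N" "baer R (E k)" "module R (E k)" "\<epsilon> \<in> mod_hom R N (E 0)"
    "d k \<in> mod_hom R (E k) (E (Suc k))"
    "x \<in> carrier N \<Longrightarrow> \<epsilon> x = \<zero>\<^bsub>E 0\<^esub> \<Longrightarrow> x = \<zero>\<^bsub>N\<^esub>"
    "x \<in> carrier N \<Longrightarrow> d 0 (\<epsilon> x) = \<zero>\<^bsub>E (Suc 0)\<^esub>"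
    "y \<in> carrier (E 0) \<Longrightarrow> d 0 y = \<zero>\<^bsub>E (Suc 0)\<^esub> \<Longrightarrow> \<exists>x\<in>carrier N. \<epsilon> x = y"
    "y \<in> carrier (E k) \<Longrightarrow> d (Suc k) (d k y) = \<zero>\<^bsub>E (Suc (Suc k))\<^esub>"
    "y \<in> carrier (E (Suc k)) \<Longrightarrow> d (Suc k) y = \<zero>\<^bsub>E (Suc (Suc k))\<^esub> \<Longrightarrow> \<exists>x\<in>carrier (E k). d k x = y"
proof -
  note * = assms[unfolded baer_resolution_def]
  show "module R N" "baer R (E k)" "\<epsilon> \<in> mod_hom R N (E 0)" "d k \<in> mod_hom R (E k) (E (Suc k))"
    "x \<in> carrier N \<Longrightarrow> \<epsilon> x = \<zero>\<^bsub>E 0\<^esub> \<Longrightarrow> x = \<zero>\<^bsub>N\<^esub>"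
    using * by blast+
  show "module R (E k)"
    using * by (blast intro: baer_module)
  have \<epsilon>: "\<epsilon> x \<in> carrier (E 0)" if "x \<in> carrier N" for x
    using * that mod_homD(1)[of \<epsilon> R N "E 0"] by blast
  have "d k \<in> mod_hom R (E k) (E (Suc k))" for k
    using * by blast
  note d = mod_homD(1)[OF this]
  have ex0: "\<And>x. x \<in> carrier (E 0) \<Longrightarrow> d 0 x = \<zero>\<^bsub>E (Suc 0)\<^esub> \<longleftrightarrow> x \<in> \<epsilon> ` carrier N"
    and exS: "\<And>k x. x \<in> carrier (E (Suc k)) \<Longrightarrow>
      d (Suc k) x = \<zero>\<^bsub>E (Suc (Suc k))\<^esub> \<longleftrightarrow> x \<in> d k ` carrier (E k)"
    using * by blast+
  show "x \<in> carrier N \<Longrightarrow> d 0 (\<epsilon> x) = \<zero>\<^bsub>E (Suc 0)\<^esub>"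
    "y \<in> carrier (E k) \<Longrightarrow> d (Suc k) (d k y) = \<zero>\<^bsub>E (Suc (Suc k))\<^esub>"
    using ex0 exS \<epsilon> d by simp_all
  show "\<exists>x\<in>carrier N. \<epsilon> x = y" if "y \<in> carrier (E 0)" "d 0 y = \<zero>\<^bsub>E (Suc 0)\<^esub>"
  proof -
    have "y \<in> \<epsilon> ` carrier N" using ex0 exS that by blast
    then show ?thesis by auto
  qed
  show "\<exists>x\<in>carrier (E k). d k x = y" if "y \<in> carrier (E (Suc k))" "d (Suc k) y = \<zero>\<^bsub>E (Suc (Suc k))\<^esub>"
  proof -
    have "y \<in> d k ` carrier (E k)" using ex0 exS that by blast
    then show ?thesis by auto
  qed
qed

text \<open>Each \<open>\<theta> (Suc k)\<close> is obtained by factoring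
  \<open>d k \<circ> \<theta> k\<close> through \<open>\<delta> k\<close>. The target is merely a
  complex, which admits the shifted resolution with negated differentials that the horseshoe lemma
  uses.\<close>

lemma baer_resolution_lift:
  assumes G: "baer_resolution R N G \<epsilon> \<delta>"
    and F: "\<And>k. baer R (F k)" "\<And>k. d k \<in> mod_hom R (F k) (F (Suc k))"
      "\<And>k x. x \<in> carrier (F k) \<Longrightarrow> d (Suc k) (d k x) = \<zero>\<^bsub>F (Suc (Suc k))\<^esub>"
    and \<beta>: "\<beta> \<in> mod_hom R N (F 0)" "\<And>x. x \<in> carrier N \<Longrightarrow> d 0 (\<beta> x) = \<zero>\<^bsub>F (Suc 0)\<^esub>"
  shows "\<exists>\<theta>. (\<forall>k. \<theta> k \<in> mod_hom R (G k) (F k)) \<and> (\<forall>x\<in>carrier N. \<theta> 0 (\<epsilon> x) = \<beta> x) \<and>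
           (\<forall>k. \<forall>x\<in>carrier (G k). \<theta> (Suc k) (\<delta> k x) = d k (\<theta> k x))"
proof -
  note G = baer_resolutionD[OF G]
  note FM = baer_module[OF F(1)]
  \<comment> \<open>The middle clause, vanishing of \<open>d k \<circ> t\<close> on the kernel of
    \<open>\<delta> k\<close>, is the kernel condition that \<open>baer_factor\<close> demands for
    the next map; the last clause concerns the bottom degree only.\<close>
  define P where "P k t \<longleftrightarrow> t \<in> mod_hom R (G k) (F k) \<and>
    (\<forall>x\<in>carrier (G k). \<delta> k x = \<zero>\<^bsub>G (Suc k)\<^esub> \<longrightarrow> d k (t x) = \<zero>\<^bsub>F (Suc k)\<^esub>) \<and>
    (k = 0 \<longrightarrow> (\<forall>x\<in>carrier N. t (\<epsilon> x) = \<beta> x))" for k t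
  have "\<exists>\<theta>. \<forall>k. P k (\<theta> k) \<and> (\<forall>x\<in>carrier (G k). \<theta> (Suc k) (\<delta> k x) = d k (\<theta> k x))"
  proof (rule dependent_nat_choice)
    have "\<beta> x = \<zero>\<^bsub>F 0\<^esub>" if "x \<in> carrier N" "\<epsilon> x = \<zero>\<^bsub>G 0\<^esub>" for x
      using G(6)[OF that] mod_hom_zero[OF G(1) FM \<beta>(1)] by simp
    then obtain t where t: "t \<in> mod_hom R (G 0) (F 0)" "\<forall>x\<in>carrier N. t (\<epsilon> x) = \<beta> x"
      using baer_factor[OF G(1) G(3) F(1) G(4) \<beta>(1)] by blast
    have "d 0 (t x) = \<zero>\<^bsub>F (Suc 0)\<^esub>" if "x \<in> carrier (G 0)" "\<delta> 0 x = \<zero>\<^bsub>G (Suc 0)\<^esub>" for x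
      using G(8)[OF that] t \<beta>(2) by auto
    with t show "\<exists>t. P 0 t"
      unfolding P_def by blast
    fix t k assume t: "P k t"
    have f: "(\<lambda>x. d k (t x)) \<in> mod_hom R (G k) (F (Suc k))"
      using t mod_hom_comp[OF _ F(2)] unfolding P_def by blast
    obtain s where s: "s \<in> mod_hom R (G (Suc k)) (F (Suc k))" "\<forall>x\<in>carrier (G k). s (\<delta> k x) = d k (t x)"
      using baer_factor[OF G(3) G(3) F(1) G(5) f] t unfolding P_def by blast
    have "d (Suc k) (s x) = \<zero>\<^bsub>F (Suc (Suc k))\<^esub>"
      if x: "x \<in> carrier (G (Suc k))" "\<delta> (Suc k) x = \<zero>\<^bsub>G (Suc (Suc k))\<^esub>" for x
    proof -
      obtain y where y: "y \<in> carrier (G k)" "\<delta> k y = x"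
        using G(10)[OF x] by blast
      then have "s x = d k (t y)" "t y \<in> carrier (F k)"
        using s(2) t mod_homD(1)[of t R "G k" "F k"] unfolding P_def by blast+
      then show ?thesis
        using F(3) by simp
    qed
    with s show "\<exists>s. P (Suc k) s \<and> (\<forall>x\<in>carrier (G k). s (\<delta> k x) = d k (t x))"
      unfolding P_def by blast
  qed
  then obtain \<theta> where "\<And>k. P k (\<theta> k)" and
    "\<And>k x. x \<in> carrier (G k) \<Longrightarrow> \<theta> (Suc k) (\<delta> k x) = d k (\<theta> k x)"
    by blast
  then show ?thesis
    unfolding P_def by (intro exI[of _ \<theta>]) simp
qed

text \<open>On the kernel of \<open>\<delta> (Suc k)\<close>, \<open>\<chi> (Suc k)\<close> equals
  \<open>d k \<circ> h k\<close>, so their difference factors through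
  \<open>\<delta> (Suc k)\<close> and produces the next component of a null-homotopy; in degree 0
  the vanishing of \<open>\<chi> 0\<close> on the image of \<open>\<epsilon>\<close> starts the
  construction.\<close>

lemma baer_resolution_homotopy:
  assumes G: "baer_resolution R N G \<epsilon> \<delta>"
    and F: "\<And>k. baer R (F k)" "\<And>k. d k \<in> mod_hom R (F k) (F (Suc k))"
      "\<And>k x. x \<in> carrier (F k) \<Longrightarrow> d (Suc k) (d k x) = \<zero>\<^bsub>F (Suc (Suc k))\<^esub>"
    and \<chi>: "\<And>k. \<chi> k \<in> mod_hom R (G k) (F k)"
      "\<And>k x. x \<in> carrier (G k) \<Longrightarrow> \<chi> (Suc k) (\<delta> k x) = d k (\<chi> k x)"
      "\<And>x. x \<in> carrier N \<Longrightarrow> \<chi> 0 (\<epsilon> x) = \<zero>\<^bsub>F 0\<^esub>"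
  shows "\<exists>h. (\<forall>k. h k \<in> mod_hom R (G (Suc k)) (F k)) \<and> (\<forall>x\<in>carrier (G 0). h 0 (\<delta> 0 x) = \<chi> 0 x) \<and>
           (\<forall>k. \<forall>x\<in>carrier (G (Suc k)).
              h (Suc k) (\<delta> (Suc k) x) = \<chi> (Suc k) x \<ominus>\<^bsub>F (Suc k)\<^esub> d k (h k x))"
proof -
  note G = baer_resolutionD[OF G]
  note FM = baer_module[OF F(1)]
  define P where "P k t \<longleftrightarrow> t \<in> mod_hom R (G (Suc k)) (F k) \<and>
    (\<forall>x\<in>carrier (G (Suc k)). \<delta> (Suc k) x = \<zero>\<^bsub>G (Suc (Suc k))\<^esub> \<longrightarrow> \<chi> (Suc k) x = d k (t x)) \<and>
    (k = 0 \<longrightarrow> (\<forall>x\<in>carrier (G 0). t (\<delta> 0 x) = \<chi> 0 x))" for k t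
  have "\<exists>h. \<forall>k. P k (h k) \<and>
    (\<forall>x\<in>carrier (G (Suc k)). h (Suc k) (\<delta> (Suc k) x) = \<chi> (Suc k) x \<ominus>\<^bsub>F (Suc k)\<^esub> d k (h k x))"
  proof (rule dependent_nat_choice)
    have "\<chi> 0 x = \<zero>\<^bsub>F 0\<^esub>" if "x \<in> carrier (G 0)" "\<delta> 0 x = \<zero>\<^bsub>G (Suc 0)\<^esub>" for x
      using G(8)[OF that] \<chi>(3) by auto
    then obtain t where t: "t \<in> mod_hom R (G (Suc 0)) (F 0)" "\<forall>x\<in>carrier (G 0). t (\<delta> 0 x) = \<chi> 0 x"
      using baer_factor[OF G(3) G(3) F(1) G(5) \<chi>(1)] by blast
    have "\<chi> (Suc 0) x = d 0 (t x)" if "x \<in> carrier (G (Suc 0))" "\<delta> (Suc 0) x = \<zero>\<^bsub>G (Suc (Suc 0))\<^esub>" for x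
      using G(10)[OF that] t \<chi>(2) by auto
    with t show "\<exists>t. P 0 t"
      unfolding P_def by blast
    fix t k assume t: "P k t"
    interpret F1: module R "F (Suc k)" by (rule FM)
    have th: "t \<in> mod_hom R (G (Suc k)) (F k)"
      using t unfolding P_def by blast
    have f: "(\<lambda>x. \<chi> (Suc k) x \<ominus>\<^bsub>F (Suc k)\<^esub> d k (t x)) \<in> mod_hom R (G (Suc k)) (F (Suc k))"
      by (intro mod_hom_diff G(3) FM \<chi>(1) mod_hom_comp[OF th F(2)])
    have closed: "d k (t x) \<in> carrier (F (Suc k))" "\<chi> (Suc k) x \<in> carrier (F (Suc k))"
      if "x \<in> carrier (G (Suc k))" for x
      using that by (auto intro!: mod_homD(1)[OF F(2)] mod_homD(1)[OF th] mod_homD(1)[OF \<chi>(1)])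
    have "\<chi> (Suc k) x \<ominus>\<^bsub>F (Suc k)\<^esub> d k (t x) = \<zero>\<^bsub>F (Suc k)\<^esub>"
      if x: "x \<in> carrier (G (Suc k))" "\<delta> (Suc k) x = \<zero>\<^bsub>G (Suc (Suc k))\<^esub>" for x
      using t x closed[OF x(1)] unfolding P_def by (simp add: F1.minus_eq_zero_iff)
    then obtain s where s: "s \<in> mod_hom R (G (Suc (Suc k))) (F (Suc k))"
      "\<forall>x\<in>carrier (G (Suc k)). s (\<delta> (Suc k) x) = \<chi> (Suc k) x \<ominus>\<^bsub>F (Suc k)\<^esub> d k (t x)"
      using baer_factor[OF G(3) G(3) F(1) G(5) f] by blast
    have "\<chi> (Suc (Suc k)) x = d (Suc k) (s x)"
      if x: "x \<in> carrier (G (Suc (Suc k)))" "\<delta> (Suc (Suc k)) x = \<zero>\<^bsub>G (Suc (Suc (Suc k)))\<^esub>" for x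
    proof -
      obtain y where y: "y \<in> carrier (G (Suc k))" "\<delta> (Suc k) y = x"
        using G(10)[OF x] by blast
      interpret F2: module R "F (Suc (Suc k))" by (rule FM)
      have "d (Suc k) (s x) = d (Suc k) (\<chi> (Suc k) y) \<ominus>\<^bsub>F (Suc (Suc k))\<^esub> d (Suc k) (d k (t y))"
        using s(2) y closed[OF y(1)] mod_hom_minus[OF FM FM F(2)] by auto
      also have "d (Suc k) (d k (t y)) = \<zero>\<^bsub>F (Suc (Suc k))\<^esub>"
        by (intro F(3) mod_homD(1)[OF th] y)
      also have "d (Suc k) (\<chi> (Suc k) y) = \<chi> (Suc (Suc k)) x"
        using \<chi>(2)[OF y(1)] y(2) by simp
      finally show ?thesis
        using mod_homD(1)[OF \<chi>(1) x(1)] by (simp add: F2.minus_zero_right)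
    qed
    with s show "\<exists>s. P (Suc k) s \<and>
        (\<forall>x\<in>carrier (G (Suc k)). s (\<delta> (Suc k) x) = \<chi> (Suc k) x \<ominus>\<^bsub>F (Suc k)\<^esub> d k (t x))"
      unfolding P_def by blast
  qed
  then obtain h where "\<And>k. P k (h k)" and
    "\<And>k x. x \<in> carrier (G (Suc k)) \<Longrightarrow> h (Suc k) (\<delta> (Suc k) x) = \<chi> (Suc k) x \<ominus>\<^bsub>F (Suc k)\<^esub> d k (h k x)"
    by blast
  then show ?thesis
    unfolding P_def by (intro exI[of _ h]) simp
qed

text \<open>Vanishing of the cohomology of the torsion subcomplex in degree \<open>i\<close>, in
  terms of elements; nothing maps into degree 0, where cycles have to be zero.\<close>

definition torsion_exact ::
  "('a, 'r) ring_scheme \<Rightarrow> 'a set \<Rightarrow> (nat \<Rightarrow> ('a, 'e) module) \<Rightarrow> (nat \<Rightarrow> 'e \<Rightarrow> 'e) \<Rightarrow> nat \<Rightarrow> bool" where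
  "torsion_exact R \<aa> E d i \<longleftrightarrow>
     (\<forall>x\<in>torsion_part R \<aa> (E i). d i x = \<zero>\<^bsub>E (Suc i)\<^esub> \<longrightarrow>
        (case i of 0 \<Rightarrow> x = \<zero>\<^bsub>E 0\<^esub> | Suc k \<Rightarrow> \<exists>y\<in>torsion_part R \<aa> (E k). d k y = x))"

lemma torsion_exact_0:
  "torsion_exact R \<aa> E d 0 \<longleftrightarrow> (\<forall>x\<in>torsion_part R \<aa> (E 0). d 0 x = \<zero>\<^bsub>E (Suc 0)\<^esub> \<longrightarrow> x = \<zero>\<^bsub>E 0\<^esub>)"
  by (simp add: torsion_exact_def)

lemma torsion_exact_Suc:
  "torsion_exact R \<aa> E d (Suc k) \<longleftrightarrow>
     (\<forall>x\<in>torsion_part R \<aa> (E (Suc k)). d (Suc k) x = \<zero>\<^bsub>E (Suc (Suc k))\<^esub> \<longrightarrow>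
        (\<exists>y\<in>torsion_part R \<aa> (E k). d k y = x))"
  by (simp add: torsion_exact_def)

text \<open>\<open>\<phi>\<close> and its inverse lift to chain maps whose composite is homotopic to
  the identity of \<open>G\<close>; homomorphisms preserve torsion, so chain maps and homotopy act
  on the torsion parts. The element types of \<open>F\<close> and \<open>G\<close> may differ, which
  gives independence of the resolution and of its type.\<close>

lemma torsion_exact_iso:
  assumes R: "cring R" and \<aa>: "ideal \<aa> R"
    and G: "baer_resolution R N G \<epsilon> \<delta>" and F: "baer_resolution R N' F \<eta> d"
    and \<phi>: "\<phi> \<in> mod_hom R N N'" "bij_betw \<phi> (carrier N) (carrier N')"
    and exact: "torsion_exact R \<aa> F d i"
  shows "torsion_exact R \<aa> G \<delta> i"
proof -
  note G' = baer_resolutionD[OF G] and F' = baer_resolutionD[OF F]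
  let ?\<psi> = "inv_into (carrier N) \<phi>"
  have \<psi>: "?\<psi> \<in> mod_hom R N' N"
    by (rule mod_hom_inv_into[OF G'(1) \<phi>])
  have \<psi>\<phi>: "?\<psi> (\<phi> x) = x" if "x \<in> carrier N" for x
    using \<phi>(2) that by (simp add: bij_betw_def)
  have "d 0 (\<eta> (\<phi> x)) = \<zero>\<^bsub>F (Suc 0)\<^esub>" if "x \<in> carrier N" for x
    by (intro F'(7) mod_homD(1)[OF \<phi>(1)] that)
  from baer_resolution_lift[where F = F and d = d and \<beta> = "\<lambda>x. \<eta> (\<phi> x)",
      OF G F'(2,5,9) mod_hom_comp[OF \<phi>(1) F'(4)] this]
  obtain \<theta> where "\<forall>k. \<theta> k \<in> mod_hom R (G k) (F k)" "\<forall>x\<in>carrier N. \<theta> 0 (\<epsilon> x) = \<eta> (\<phi> x)"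
    "\<forall>k. \<forall>x\<in>carrier (G k). \<theta> (Suc k) (\<delta> k x) = d k (\<theta> k x)"
    by blast
  then have \<theta>: "\<And>k. \<theta> k \<in> mod_hom R (G k) (F k)" "\<And>x. x \<in> carrier N \<Longrightarrow> \<theta> 0 (\<epsilon> x) = \<eta> (\<phi> x)"
    "\<And>k x. x \<in> carrier (G k) \<Longrightarrow> \<theta> (Suc k) (\<delta> k x) = d k (\<theta> k x)"
    by simp_all
  have "\<delta> 0 (\<epsilon> (?\<psi> x)) = \<zero>\<^bsub>G (Suc 0)\<^esub>" if "x \<in> carrier N'" for x
    by (intro G'(7) mod_homD(1)[OF \<psi>] that)
  from baer_resolution_lift[where F = G and d = \<delta> and \<beta> = "\<lambda>x. \<epsilon> (?\<psi> x)",
      OF F G'(2,5,9) mod_hom_comp[OF \<psi> G'(4)] this]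
  obtain \<kappa> where "\<forall>k. \<kappa> k \<in> mod_hom R (F k) (G k)" "\<forall>x\<in>carrier N'. \<kappa> 0 (\<eta> x) = \<epsilon> (?\<psi> x)"
    "\<forall>k. \<forall>x\<in>carrier (F k). \<kappa> (Suc k) (d k x) = \<delta> k (\<kappa> k x)"
    by blast
  then have \<kappa>: "\<And>k. \<kappa> k \<in> mod_hom R (F k) (G k)" "\<And>x. x \<in> carrier N' \<Longrightarrow> \<kappa> 0 (\<eta> x) = \<epsilon> (?\<psi> x)"
    "\<And>k x. x \<in> carrier (F k) \<Longrightarrow> \<kappa> (Suc k) (d k x) = \<delta> k (\<kappa> k x)"
    by simp_all
  \<comment> \<open>Difference between the round trip and the identity; it vanishes on the image of
    \<open>N\<close>, so \<open>baer_resolution_homotopy\<close> applies.\<close>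
  define \<chi> where "\<chi> k x = \<kappa> k (\<theta> k x) \<ominus>\<^bsub>G k\<^esub> x" for k x
  have id: "(\<lambda>x. x) \<in> mod_hom R (G k) (G k)" for k
    by (rule mod_homI) auto
  note \<theta>c = mod_homD(1)[OF \<theta>(1)] and \<kappa>c = mod_homD(1)[OF \<kappa>(1)] and \<delta>c = mod_homD(1)[OF G'(5)]
  have \<chi>: "\<chi> k \<in> mod_hom R (G k) (G k)" for k
    unfolding \<chi>_def by (intro mod_hom_diff G'(3) id mod_hom_comp[OF \<theta>(1) \<kappa>(1)])
  have chain: "\<chi> (Suc k) (\<delta> k x) = \<delta> k (\<chi> k x)" if "x \<in> carrier (G k)" for k x
    unfolding \<chi>_def using that
    by (simp add: \<theta>(3) \<kappa>(3) \<theta>c \<kappa>c mod_hom_minus[OF G'(3) G'(3) G'(5)])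
  have zero: "\<chi> 0 (\<epsilon> x) = \<zero>\<^bsub>G 0\<^esub>" if x: "x \<in> carrier N" for x
  proof -
    interpret G0: module R "G 0" by (rule G')
    have "\<kappa> 0 (\<theta> 0 (\<epsilon> x)) = \<epsilon> x"
      using x by (simp add: \<theta>(2) \<kappa>(2) mod_homD(1)[OF \<phi>(1)] \<psi>\<phi>)
    then show ?thesis
      unfolding \<chi>_def using mod_homD(1)[OF G'(4) x] by (simp add: G0.minus_eq_zero_iff)
  qed
  from baer_resolution_homotopy[where F = G and d = \<delta> and \<chi> = \<chi>, OF G G'(2,5,9) \<chi> chain zero]
  obtain h where "\<forall>k. h k \<in> mod_hom R (G (Suc k)) (G k)" "\<forall>x\<in>carrier (G 0). h 0 (\<delta> 0 x) = \<chi> 0 x"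
    "\<forall>k. \<forall>x\<in>carrier (G (Suc k)). h (Suc k) (\<delta> (Suc k) x) = \<chi> (Suc k) x \<ominus>\<^bsub>G (Suc k)\<^esub> \<delta> k (h k x)"
    by blast
  then have h: "\<And>k. h k \<in> mod_hom R (G (Suc k)) (G k)"
    "\<And>x. x \<in> carrier (G 0) \<Longrightarrow> h 0 (\<delta> 0 x) = \<chi> 0 x"
    "\<And>k x. x \<in> carrier (G (Suc k)) \<Longrightarrow> h (Suc k) (\<delta> (Suc k) x) = \<chi> (Suc k) x \<ominus>\<^bsub>G (Suc k)\<^esub> \<delta> k (h k x)"
    by simp_all
  note tor = torsion_part_carrier[OF R \<aa>] and torh = torsion_part_hom[OF R \<aa>]
  have \<theta>x: "\<theta> i x \<in> torsion_part R \<aa> (F i)" "d i (\<theta> i x) = \<zero>\<^bsub>F (Suc i)\<^esub>" 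
    if "x \<in> torsion_part R \<aa> (G i)" "\<delta> i x = \<zero>\<^bsub>G (Suc i)\<^esub>" for x i
    using torh[OF G'(3) F'(3) \<theta>(1) that(1)] \<theta>(3)[OF tor[OF that(1)]] that(2)
      mod_hom_zero[OF G'(3) F'(3) \<theta>(1)] by auto
  show ?thesis
  proof (cases i)
    case 0
    have "x = \<zero>\<^bsub>G 0\<^esub>" if x: "x \<in> torsion_part R \<aa> (G 0)" "\<delta> 0 x = \<zero>\<^bsub>G (Suc 0)\<^esub>" for x
    proof -
      interpret G0: module R "G 0" by (rule G')
      have "\<theta> 0 x = \<zero>\<^bsub>F 0\<^esub>"
        using \<theta>x[OF x] exact unfolding 0 torsion_exact_0 by blast
      then have "\<kappa> 0 (\<theta> 0 x) = \<zero>\<^bsub>G 0\<^esub>"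
        using mod_hom_zero[OF F'(3) G'(3) \<kappa>(1)] by simp
      moreover have "\<chi> 0 x = \<zero>\<^bsub>G 0\<^esub>"
        using h(2)[OF tor[OF x(1)]] x(2) mod_hom_zero[OF G'(3) G'(3) h(1)] by simp
      ultimately show ?thesis
        unfolding \<chi>_def using tor[OF x(1)] by (metis G0.minus_eq_zero_iff G0.M.zero_closed)
    qed
    then show ?thesis
      unfolding 0 torsion_exact_0 by blast
  next
    case (Suc k)
    have "\<exists>y\<in>torsion_part R \<aa> (G k). \<delta> k y = x"
      if x: "x \<in> torsion_part R \<aa> (G (Suc k))" "\<delta> (Suc k) x = \<zero>\<^bsub>G (Suc (Suc k))\<^esub>" for x
    proof -
      interpret G1: module R "G (Suc k)" by (rule G')
      interpret G0: module R "G k" by (rule G')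
      have xc: "x \<in> carrier (G (Suc k))"
        by (rule tor[OF x(1)])
      obtain y where y: "y \<in> torsion_part R \<aa> (F k)" "d k y = \<theta> (Suc k) x"
        using \<theta>x[OF x] exact unfolding Suc torsion_exact_Suc by blast
      have hx: "h k x \<in> carrier (G k)"
        by (rule mod_homD(1)[OF h(1) xc])
      have \<kappa>y: "\<kappa> k y \<in> carrier (G k)"
        by (rule \<kappa>c[OF tor[OF y(1)]])
      have "\<chi> (Suc k) x \<ominus>\<^bsub>G (Suc k)\<^esub> \<delta> k (h k x) = \<zero>\<^bsub>G (Suc k)\<^esub>"
        using h(3)[OF xc] x(2) mod_hom_zero[OF G'(3) G'(3) h(1)] by simp
      then have 1: "\<chi> (Suc k) x = \<delta> k (h k x)"
        using mod_homD(1)[OF \<chi> xc] \<delta>c[OF hx] by (simp add: G1.minus_eq_zero_iff)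
      have 2: "\<kappa> (Suc k) (\<theta> (Suc k) x) = \<delta> k (\<kappa> k y)"
        using \<kappa>(3)[OF tor[OF y(1)]] y(2) by simp
      \<comment> \<open>From \<open>\<chi> x = \<delta> (h x)\<close> and
        \<open>\<kappa> (\<theta> x) = \<delta> (\<kappa> y)\<close>, the element
        \<open>\<kappa> y \<ominus> h x\<close> is a torsion preimage of \<open>x\<close>.\<close>
      have "\<delta> k (\<kappa> k y \<ominus>\<^bsub>G k\<^esub> h k x) = \<delta> k (\<kappa> k y) \<ominus>\<^bsub>G (Suc k)\<^esub> \<delta> k (h k x)"
        using hx \<kappa>y by (intro mod_hom_minus[OF G'(3) G'(3) G'(5)])
      also have "\<dots> = \<delta> k (\<kappa> k y) \<ominus>\<^bsub>G (Suc k)\<^esub> (\<delta> k (\<kappa> k y) \<ominus>\<^bsub>G (Suc k)\<^esub> x)"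
        using 1 2 unfolding \<chi>_def by simp
      also have "\<dots> = x"
        using xc \<delta>c[OF \<kappa>y] by (simp add: a_minus_def G1.minus_add G1.r_neg2)
      finally show ?thesis
        using G0.submodule_minus[OF torsion_part_submodule[OF R \<aa> G'(3)]
            torh[OF F'(3) G'(3) \<kappa>(1) y(1)] torh[OF G'(3) G'(3) h(1) x(1)]] by blast
    qed
    then show ?thesis
      unfolding Suc torsion_exact_Suc by blast
  qed
qed

subsection \<open>The horseshoe lemma\<close>

definition short_exact ::
  "('a, 'r) ring_scheme \<Rightarrow> ('a, 'b, 'm) module_scheme \<Rightarrow> ('b \<Rightarrow> 'c) \<Rightarrow> ('a, 'c, 'n) module_scheme \<Rightarrow>
   ('c \<Rightarrow> 'd) \<Rightarrow> ('a, 'd, 'o) module_scheme \<Rightarrow> bool" where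
  "short_exact R A \<alpha> B \<pi> C \<longleftrightarrow>
     module R A \<and> module R B \<and> module R C \<and> \<alpha> \<in> mod_hom R A B \<and> \<pi> \<in> mod_hom R B C \<and>
     inj_on \<alpha> (carrier A) \<and> \<pi> ` carrier B = carrier C \<and>
     (\<forall>b\<in>carrier B. \<pi> b = \<zero>\<^bsub>C\<^esub> \<longleftrightarrow> b \<in> \<alpha> ` carrier A)"

lemma baer_prod:
  assumes "baer R M" "baer R N"
  shows "baer R (prod_module M N)"
  unfolding baer_def
proof (intro conjI allI impI module_prod baer_module assms)
  fix J f assume *: "ideal J R \<and> f \<in> mod_hom R ((regular_module R)\<lparr>carrier := J\<rparr>) (prod_module M N)"
  have f: "f \<in> mod_hom R ((regular_module R)\<lparr>carrier := J\<rparr>) (prod_module M N)"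
    using * by blast
  have "(\<lambda>r. fst (f r)) \<in> mod_hom R ((regular_module R)\<lparr>carrier := J\<rparr>) M"
    using mod_homD[OF f] by (intro mod_homI) (auto simp: mem_Times_iff)
  moreover have "(\<lambda>r. snd (f r)) \<in> mod_hom R ((regular_module R)\<lparr>carrier := J\<rparr>) N"
    using mod_homD[OF f] by (intro mod_homI) (auto simp: mem_Times_iff)
  ultimately obtain e e' where "e \<in> carrier M" "\<forall>r\<in>J. fst (f r) = r \<odot>\<^bsub>M\<^esub> e"
    "e' \<in> carrier N" "\<forall>r\<in>J. snd (f r) = r \<odot>\<^bsub>N\<^esub> e'"
    using * assms unfolding baer_def by blast
  then show "\<exists>e\<in>carrier (prod_module M N). \<forall>r\<in>J. f r = r \<odot>\<^bsub>prod_module M N\<^esub> e"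
    by (intro bexI[of _ "(e, e')"]) (auto simp: prod_eq_iff)
qed

text \<open>Degreewise the middle resolution is a product, twisted by \<open>\<theta>\<close>; the
  anticommutation of \<open>\<theta>\<close> with the differentials is what makes the twisted
  differential square to zero. The map \<open>\<mu>\<close> extends \<open>\<eta>\<close> along
  \<open>\<alpha>\<close>.\<close>

lemma horseshoe:
  assumes ex: "short_exact R A \<alpha> B \<pi> C"
    and F: "baer_resolution R A F \<eta> d" and G: "baer_resolution R C G \<epsilon> \<delta>"
  shows "\<exists>\<theta> \<mu>. (\<forall>k. \<theta> k \<in> mod_hom R (G k) (F (Suc k))) \<and>
    (\<forall>k. \<forall>x\<in>carrier (G k). \<theta> (Suc k) (\<delta> k x) = \<ominus>\<^bsub>F (Suc (Suc k))\<^esub> d (Suc k) (\<theta> k x)) \<and>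
    baer_resolution R B (\<lambda>k. prod_module (F k) (G k)) (\<lambda>b. (\<mu> b, \<epsilon> (\<pi> b)))
      (\<lambda>k p. (d k (fst p) \<oplus>\<^bsub>F (Suc k)\<^esub> \<theta> k (snd p), \<delta> k (snd p)))"
proof -
  note F' = baer_resolutionD[OF F] and G' = baer_resolutionD[OF G]
  have B: "module R B" and \<alpha>: "\<alpha> \<in> mod_hom R A B" and \<pi>: "\<pi> \<in> mod_hom R B C"
    and inj: "inj_on \<alpha> (carrier A)" and surj: "\<pi> ` carrier B = carrier C"
    and ker: "\<And>b. b \<in> carrier B \<Longrightarrow> \<pi> b = \<zero>\<^bsub>C\<^esub> \<longleftrightarrow> b \<in> \<alpha> ` carrier A"
    using ex unfolding short_exact_def by blast+
  interpret A: module R A by (rule F')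
  interpret B: module R B by (rule B)
  interpret C: module R C by (rule G')
  note \<alpha>c = mod_homD(1)[OF \<alpha>] and \<pi>c = mod_homD(1)[OF \<pi>] and \<eta>c = mod_homD(1)[OF F'(4)]
    and \<epsilon>c = mod_homD(1)[OF G'(4)] and dc = mod_homD(1)[OF F'(5)] and \<delta>c = mod_homD(1)[OF G'(5)]
  have "\<eta> a = \<zero>\<^bsub>F 0\<^esub>" if "a \<in> carrier A" "\<alpha> a = \<zero>\<^bsub>B\<^esub>" for a
  proof -
    have "a = \<zero>\<^bsub>A\<^esub>"
      using inj that mod_hom_zero[OF F'(1) B \<alpha>] by (metis A.M.zero_closed inj_onD)
    then show ?thesis
      using mod_hom_zero[OF F'(1,3,4)] by simp
  qed
  then obtain \<mu> where \<mu>: "\<mu> \<in> mod_hom R B (F 0)" "\<And>a. a \<in> carrier A \<Longrightarrow> \<mu> (\<alpha> a) = \<eta> a"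
    using baer_factor[OF F'(1) B F'(2) \<alpha> F'(4)] by blast
  note \<mu>c = mod_homD(1)[OF \<mu>(1)]
  interpret F0: module R "F 0" by (rule F')
  interpret F1: module R "F (Suc 0)" by (rule F')
  interpret F2: module R "F (Suc (Suc 0))" by (rule F')
  have h: "(\<lambda>b. \<ominus>\<^bsub>F (Suc 0)\<^esub> d 0 (\<mu> b)) \<in> mod_hom R B (F (Suc 0))"
    by (intro mod_hom_uminus B F'(3) mod_hom_comp[OF \<mu>(1) F'(5)])
  have "\<ominus>\<^bsub>F (Suc 0)\<^esub> d 0 (\<mu> b) = \<zero>\<^bsub>F (Suc 0)\<^esub>" if b: "b \<in> carrier B" "\<pi> b = \<zero>\<^bsub>C\<^esub>" for b
  proof -
    obtain a where a: "a \<in> carrier A" "b = \<alpha> a"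
      using ker b by auto
    then show ?thesis
      using \<mu>(2) F'(7) F1.add.inv_one by simp
  qed
  \<comment> \<open>\<open>d 0 \<circ> \<mu>\<close> vanishes on the image of
    \<open>\<alpha>\<close>, so its negative descends to \<open>C\<close>; it measures how far
    \<open>\<mu>\<close> is from landing in the kernel of \<open>d 0\<close>.\<close>
  then obtain \<beta> where \<beta>: "\<beta> \<in> mod_hom R C (F (Suc 0))"
    "\<And>b. b \<in> carrier B \<Longrightarrow> \<beta> (\<pi> b) = \<ominus>\<^bsub>F (Suc 0)\<^esub> d 0 (\<mu> b)"
    using baer_factor[OF B G'(1) F'(2) \<pi> h] by blast
  have d\<beta>: "\<ominus>\<^bsub>F (Suc (Suc 0))\<^esub> d (Suc 0) (\<beta> c) = \<zero>\<^bsub>F (Suc (Suc 0))\<^esub>" if c: "c \<in> carrier C" for c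
  proof -
    obtain b where b: "b \<in> carrier B" "c = \<pi> b"
      using c surj by blast
    have "d (Suc 0) (\<ominus>\<^bsub>F (Suc 0)\<^esub> d 0 (\<mu> b)) = d (Suc 0) (\<zero>\<^bsub>F (Suc 0)\<^esub> \<ominus>\<^bsub>F (Suc 0)\<^esub> d 0 (\<mu> b))"
      using dc[OF \<mu>c[OF b(1)]] by (simp add: a_minus_def)
    also have "\<dots> = \<zero>\<^bsub>F (Suc (Suc 0))\<^esub>"
      using dc[OF \<mu>c[OF b(1)]] F'(9)[OF \<mu>c[OF b(1)]]
      by (simp add: mod_hom_minus[OF F'(3) F'(3) F'(5)] mod_hom_zero[OF F'(3) F'(3) F'(5)]
          F2.minus_zero_right)
    finally show ?thesis
      using \<beta>(2)[OF b(1)] b F2.add.inv_one by simp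
  qed
  have dm: "(\<lambda>x. \<ominus>\<^bsub>F (Suc (Suc k))\<^esub> d (Suc k) x) \<in> mod_hom R (F (Suc k)) (F (Suc (Suc k)))" for k
    by (intro mod_hom_uminus F'(3,5))
  have ddm: "\<ominus>\<^bsub>F (Suc (Suc (Suc k)))\<^esub> d (Suc (Suc k)) (\<ominus>\<^bsub>F (Suc (Suc k))\<^esub> d (Suc k) x) = \<zero>\<^bsub>F (Suc (Suc (Suc k)))\<^esub>"
    if x: "x \<in> carrier (F (Suc k))" for k x
  proof -
    interpret FS3: module R "F (Suc (Suc (Suc k)))" by (rule F')
    interpret FS2: module R "F (Suc (Suc k))" by (rule F')
    have "d (Suc (Suc k)) (\<ominus>\<^bsub>F (Suc (Suc k))\<^esub> d (Suc k) x) =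
        d (Suc (Suc k)) (\<zero>\<^bsub>F (Suc (Suc k))\<^esub> \<ominus>\<^bsub>F (Suc (Suc k))\<^esub> d (Suc k) x)"
      using dc[OF x] by (simp add: a_minus_def)
    also have "\<dots> = \<zero>\<^bsub>F (Suc (Suc (Suc k)))\<^esub>"
      using dc[OF x] F'(9)[OF x]
      by (simp add: mod_hom_minus[OF F'(3) F'(3) F'(5)] mod_hom_zero[OF F'(3) F'(3) F'(5)]
          FS3.minus_zero_right)
    finally show ?thesis
      using FS3.add.inv_one by simp
  qed
  \<comment> \<open>Lifting \<open>\<beta>\<close> to \<open>F\<close> shifted by one degree, with
    negated differentials, yields \<open>\<theta>\<close>; the sign is the source of its
    anticommutation.\<close>
  from baer_resolution_lift[where F = "\<lambda>k. F (Suc k)" and d = "\<lambda>k x. \<ominus>\<^bsub>F (Suc (Suc k))\<^esub> d (Suc k) x" and \<beta> = \<beta>,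
      OF G F'(2) dm ddm \<beta>(1) d\<beta>]
  obtain \<theta> where "\<forall>k. \<theta> k \<in> mod_hom R (G k) (F (Suc k))" "\<forall>x\<in>carrier C. \<theta> 0 (\<epsilon> x) = \<beta> x"
    "\<forall>k. \<forall>x\<in>carrier (G k). \<theta> (Suc k) (\<delta> k x) = \<ominus>\<^bsub>F (Suc (Suc k))\<^esub> d (Suc k) (\<theta> k x)"
    by blast
  then have \<theta>: "\<And>k. \<theta> k \<in> mod_hom R (G k) (F (Suc k))" "\<And>x. x \<in> carrier C \<Longrightarrow> \<theta> 0 (\<epsilon> x) = \<beta> x"
    "\<And>k x. x \<in> carrier (G k) \<Longrightarrow> \<theta> (Suc k) (\<delta> k x) = \<ominus>\<^bsub>F (Suc (Suc k))\<^esub> d (Suc k) (\<theta> k x)"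
    by simp_all
  note \<theta>c = mod_homD(1)[OF \<theta>(1)]
  let ?E = "\<lambda>k. prod_module (F k) (G k)" and ?\<eta> = "\<lambda>b. (\<mu> b, \<epsilon> (\<pi> b))"
    and ?D = "\<lambda>k p. (d k (fst p) \<oplus>\<^bsub>F (Suc k)\<^esub> \<theta> k (snd p), \<delta> k (snd p))"
  have "baer_resolution R B ?E ?\<eta> ?D"
    unfolding baer_resolution_def
  proof (intro conjI allI ballI impI B)
    show "baer R (?E k)" for k
      by (intro baer_prod F'(2) G'(2))
    have \<epsilon>\<pi>: "(\<lambda>b. \<epsilon> (\<pi> b)) \<in> mod_hom R B (G 0)"
      by (rule mod_hom_comp[OF \<pi> G'(4)])
    show "?\<eta> \<in> mod_hom R B (?E 0)"
      using mod_homD[OF \<mu>(1)] mod_homD[OF \<epsilon>\<pi>] by (intro mod_homI) auto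
    show "b = \<zero>\<^bsub>B\<^esub>" if b: "b \<in> carrier B" and eq: "?\<eta> b = \<zero>\<^bsub>?E 0\<^esub>" for b
    proof -
      have "\<pi> b = \<zero>\<^bsub>C\<^esub>"
        using eq G'(6)[OF \<pi>c[OF b]] by simp
      then obtain a where a: "a \<in> carrier A" "b = \<alpha> a"
        using ker b by auto
      then have "a = \<zero>\<^bsub>A\<^esub>"
        using eq \<mu>(2) F'(6) by simp
      then show ?thesis
        using a mod_hom_zero[OF F'(1) B \<alpha>] by simp
    qed
    show "?D k \<in> mod_hom R (?E k) (?E (Suc k))" for k
    proof -
      have 1: "fst \<in> mod_hom R (?E k) (F k)" and 2: "snd \<in> mod_hom R (?E k) (G k)"
        by (auto intro!: mod_homI)
      have "(\<lambda>p. d k (fst p) \<oplus>\<^bsub>F (Suc k)\<^esub> \<theta> k (snd p)) \<in> mod_hom R (?E k) (F (Suc k))"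
        by (intro mod_hom_add module_prod F'(3) G'(3) mod_hom_comp[OF 1 F'(5)] mod_hom_comp[OF 2 \<theta>(1)])
      from mod_homD[OF this] mod_homD[OF mod_hom_comp[OF 2 G'(5)]] show ?thesis
        by (intro mod_homI) auto
    qed
    show "?D 0 p = \<zero>\<^bsub>?E (Suc 0)\<^esub> \<longleftrightarrow> p \<in> ?\<eta> ` carrier B" if p: "p \<in> carrier (?E 0)" for p
    proof
      have pc: "fst p \<in> carrier (F 0)" "snd p \<in> carrier (G 0)"
        using p by auto
      assume Dp: "?D 0 p = \<zero>\<^bsub>?E (Suc 0)\<^esub>"
      then obtain c where c: "c \<in> carrier C" "\<epsilon> c = snd p"
        using G'(8)[OF pc(2)] by auto
      then obtain b where b: "b \<in> carrier B" "c = \<pi> b"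
        using surj by blast
      have "d 0 (fst p) \<oplus>\<^bsub>F (Suc 0)\<^esub> \<ominus>\<^bsub>F (Suc 0)\<^esub> d 0 (\<mu> b) = \<zero>\<^bsub>F (Suc 0)\<^esub>"
        using Dp \<theta>(2)[OF c(1)] \<beta>(2)[OF b(1)] b(2) c(2) by simp
      then have "d 0 (fst p \<ominus>\<^bsub>F 0\<^esub> \<mu> b) = \<zero>\<^bsub>F (Suc 0)\<^esub>"
        using pc \<mu>c[OF b(1)] by (subst mod_hom_minus[OF F'(3) F'(3) F'(5)]) (auto simp: a_minus_def)
      then obtain a where a: "a \<in> carrier A" "\<eta> a = fst p \<ominus>\<^bsub>F 0\<^esub> \<mu> b"
        using F'(8)[OF F0.minus_closed] pc \<mu>c[OF b(1)] by blast
      \<comment> \<open>Changing \<open>b\<close> by \<open>\<alpha> a\<close> repairs the first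
        component and leaves \<open>\<pi> b\<close> unchanged.\<close>
      have "\<mu> (b \<oplus>\<^bsub>B\<^esub> \<alpha> a) = fst p"
        using mod_homD(2)[OF \<mu>(1) b(1) \<alpha>c[OF a(1)]] a \<mu>(2) pc \<mu>c[OF b(1)] F0.minus_add_cancel by simp
      moreover have "\<epsilon> (\<pi> (b \<oplus>\<^bsub>B\<^esub> \<alpha> a)) = snd p"
      proof -
        have "\<pi> (\<alpha> a) = \<zero>\<^bsub>C\<^esub>"
          using ker[OF \<alpha>c[OF a(1)]] a(1) by blast
        then show ?thesis
          using mod_homD(2)[OF \<pi> b(1) \<alpha>c[OF a(1)]] b c by simp
      qed
      ultimately show "p \<in> ?\<eta> ` carrier B"
        using b(1) \<alpha>c[OF a(1)] by (intro image_eqI[of _ _ "b \<oplus>\<^bsub>B\<^esub> \<alpha> a"]) auto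
    next
      assume "p \<in> ?\<eta> ` carrier B"
      then obtain b where b: "b \<in> carrier B" "p = ?\<eta> b"
        by blast
      then show "?D 0 p = \<zero>\<^bsub>?E (Suc 0)\<^esub>"
        using \<theta>(2)[OF \<pi>c[OF b(1)]] \<beta>(2)[OF b(1)] G'(7)[OF \<pi>c[OF b(1)]] dc[OF \<mu>c[OF b(1)]]
        by (simp add: F1.r_neg)
    qed
    show "?D (Suc k) p = \<zero>\<^bsub>?E (Suc (Suc k))\<^esub> \<longleftrightarrow> p \<in> ?D k ` carrier (?E k)"
      if p: "p \<in> carrier (?E (Suc k))" for k p
    proof
      interpret FS1: module R "F (Suc k)" by (rule F')
      interpret FS2: module R "F (Suc (Suc k))" by (rule F')
      have pc: "fst p \<in> carrier (F (Suc k))" "snd p \<in> carrier (G (Suc k))"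
        using p by auto
      {
        assume Dp: "?D (Suc k) p = \<zero>\<^bsub>?E (Suc (Suc k))\<^esub>"
        then obtain g where g: "g \<in> carrier (G k)" "\<delta> k g = snd p"
          using G'(10)[OF pc(2)] by auto
        have "d (Suc k) (fst p) \<oplus>\<^bsub>F (Suc (Suc k))\<^esub> \<ominus>\<^bsub>F (Suc (Suc k))\<^esub> d (Suc k) (\<theta> k g) = \<zero>\<^bsub>F (Suc (Suc k))\<^esub>"
          using Dp \<theta>(3)[OF g(1)] g(2) by simp
        then have "d (Suc k) (fst p \<ominus>\<^bsub>F (Suc k)\<^esub> \<theta> k g) = \<zero>\<^bsub>F (Suc (Suc k))\<^esub>"
          using pc \<theta>c[OF g(1)] by (subst mod_hom_minus[OF F'(3) F'(3) F'(5)]) (auto simp: a_minus_def)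
        then obtain f where f: "f \<in> carrier (F k)" "d k f = fst p \<ominus>\<^bsub>F (Suc k)\<^esub> \<theta> k g"
          using F'(10)[OF FS1.minus_closed] pc \<theta>c[OF g(1)] by blast
        then have "?D k (f, g) = p"
          using g \<theta>c[OF g(1)] pc by (simp add: FS1.minus_add_cancel prod_eq_iff)
        then show "p \<in> ?D k ` carrier (?E k)"
          using f(1) g(1) by (intro image_eqI[of _ _ "(f, g)"]) auto
      }
      assume "p \<in> ?D k ` carrier (?E k)"
      then obtain f g where fg: "f \<in> carrier (F k)" "g \<in> carrier (G k)" "p = ?D k (f, g)"
        by auto
      have "d (Suc k) (d k f \<oplus>\<^bsub>F (Suc k)\<^esub> \<theta> k g) = d (Suc k) (\<theta> k g)"
        using mod_homD(2)[OF F'(5) dc[OF fg(1)] \<theta>c[OF fg(2)]] F'(9)[OF fg(1)] dc[OF \<theta>c[OF fg(2)]] by simp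
      then show "?D (Suc k) p = \<zero>\<^bsub>?E (Suc (Suc k))\<^esub>"
        using fg \<theta>(3)[OF fg(2)] G'(9)[OF fg(2)] dc[OF \<theta>c[OF fg(2)]] by (simp add: FS2.r_neg)
    qed
  qed
  with \<theta>(1,3) show ?thesis
    by blast
qed

subsection \<open>Vanishing of local cohomology\<close>

definition lc_vanishes ::
  "('a, 'r) ring_scheme \<Rightarrow> 'a set \<Rightarrow> nat \<Rightarrow> ('a, 'b, 'm) module_scheme \<Rightarrow> bool" where
  "lc_vanishes R \<aa> i N \<longleftrightarrow> carrier (local_cohomology R \<aa> i N) = {\<zero>\<^bsub>local_cohomology R \<aa> i N\<^esub>}"

text \<open>The type of the chosen resolution contains a copy of the ring, each \<open>a\<close>
  being coded by its characteristic family, so injectivity tested in that type alone implies Baer's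
  condition.\<close>

lemma chosen_resolution_baer:
  fixes N :: "('a, 'b, 'm) module_scheme"
  assumes N: "module R N" and eq: "chosen_resolution R N = (E, \<epsilon>, d)"
  shows "baer_resolution R N E \<epsilon> d"
proof -
  interpret N: module R N by fact
  have "case chosen_resolution R N of (E, \<epsilon>, d) \<Rightarrow> injective_resolution R N E \<epsilon> d"
    unfolding chosen_resolution_def by (rule someI_ex) (use injective_resolution_exists[OF N] in auto)
  then have inj: "injective_resolution R N E \<epsilon> d"
    using eq by simp
  define u :: "'a \<Rightarrow> ('a, 'b) resol_elem" where
    "u a = Fam (\<lambda>x. if x = a then Elem undefined else Seq undefined)" for a
  have "inj u"
  proof (rule injI)
    fix a b assume "u a = u b"
    then have "(if b = a then Elem undefined else Seq undefined :: ('a, 'b) resol_elem) = Elem undefined"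
      by (simp add: u_def fun_eq_iff)
    then show "a = b"
      by (auto split: if_splits)
  qed
  then have baer: "baer R (E k)" for k
    using inj baer_injective_module[OF N.is_cring] unfolding injective_resolution_def by blast
  have "x = \<zero>\<^bsub>N\<^esub>" if "x \<in> carrier N" "\<epsilon> x = \<zero>\<^bsub>E 0\<^esub>" for x
  proof -
    have "\<epsilon> \<in> mod_hom R N (E 0)" "inj_on \<epsilon> (carrier N)"
      using inj unfolding injective_resolution_def by blast+
    then show ?thesis
      using that mod_hom_zero[OF N baer_module[OF baer]] by (metis N.M.zero_closed inj_onD)
  qed
  with inj baer N show ?thesis
    unfolding injective_resolution_def baer_resolution_def by (simp add: set_eq_iff)
qed

text \<open>Triviality of the quotient means that torsion cycles are boundaries of torsion elements,
  and \<open>torsion_exact_iso\<close> for the identity of \<open>N\<close> passes from the chosen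
  resolution to \<open>F\<close>. From here on vanishing is computed in whichever resolution is
  convenient.\<close>

lemma lc_vanishes_iff:
  assumes R: "cring R" and \<aa>: "ideal \<aa> R" and F: "baer_resolution R N F \<eta> d"
  shows "lc_vanishes R \<aa> i N \<longleftrightarrow> torsion_exact R \<aa> F d i"
proof -
  obtain E \<epsilon> \<delta> where eq: "chosen_resolution R N = (E, \<epsilon>, \<delta>)"
    by (metis prod_cases3)
  note N = baer_resolutionD(1)[OF F]
  note E = chosen_resolution_baer[OF N eq]
  note E' = baer_resolutionD[OF E]
  note tor = torsion_part_carrier[OF R \<aa>] and torh = torsion_part_hom[OF R \<aa>]
    and tors = torsion_part_submodule[OF R \<aa>]
  define Z where "Z = {x \<in> torsion_part R \<aa> (E i). \<delta> i x = \<zero>\<^bsub>E (Suc i)\<^esub>}"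
  define B where "B = (case i of 0 \<Rightarrow> {\<zero>\<^bsub>E 0\<^esub>} | Suc k \<Rightarrow> \<delta> k ` torsion_part R \<aa> (E k))"
  interpret Ei: module R "E i" by (rule E')
  interpret Es: module R "E (Suc i)" by (rule E')
  have Z: "submodule Z R (E i)"
  proof -
    have "submodule (torsion_part R \<aa> (E i)) R (E i)"
      by (rule tors[OF E'(3)])
    then show ?thesis
      using mod_homD[OF E'(5)] mod_hom_zero[OF E'(3) E'(3) E'(5)]
      unfolding Ei.submodule_iff Z_def by (auto simp: subset_iff)
  qed
  have ZM: "module R ((E i)\<lparr>carrier := Z\<rparr>)"
    using Z Ei.module_axioms by (rule submodule.submodule_is_module)
  interpret Z: module R "(E i)\<lparr>carrier := Z\<rparr>" by (rule ZM)
  have B: "submodule B R ((E i)\<lparr>carrier := Z\<rparr>)"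
  proof (cases i)
    case 0
    then show ?thesis
      using Z.zero_submodule by (simp add: B_def)
  next
    case (Suc k)
    interpret Ek: module R "E k" by (rule E')
    have T: "submodule (torsion_part R \<aa> (E k)) R (E k)"
      by (rule tors[OF E'(3)])
    then have TM: "module R ((E k)\<lparr>carrier := torsion_part R \<aa> (E k)\<rparr>)"
      using Ek.module_axioms by (rule submodule.submodule_is_module)
    have "\<delta> k \<in> mod_hom R ((E k)\<lparr>carrier := torsion_part R \<aa> (E k)\<rparr>) ((E i)\<lparr>carrier := Z\<rparr>)"
      using torh[OF E'(3) E'(3) E'(5)] E'(9)[OF tor] unfolding Z_def Suc
      by (intro mod_homI) (auto simp: mod_homD(2)[OF E'(5) tor tor] mod_homD(3)[OF E'(5) _ tor])
    from mod_hom_image_submodule[OF TM ZM this] show ?thesis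
      by (simp add: B_def Suc)
  qed
  have lc: "local_cohomology R \<aa> i N = quot_module ((E i)\<lparr>carrier := Z\<rparr>) B"
    by (simp add: local_cohomology_def eq Z_def B_def)
  note quot = quot_module_carrier[OF ZM B] quot_module_coset_eq_zero_iff[OF ZM B]
  have "lc_vanishes R \<aa> i N \<longleftrightarrow> Z \<subseteq> B"
  proof
    assume van: "lc_vanishes R \<aa> i N"
    show "Z \<subseteq> B"
    proof
      fix x assume x: "x \<in> Z"
      then have "B +>\<^bsub>(E i)\<lparr>carrier := Z\<rparr>\<^esub> x \<in> carrier (quot_module ((E i)\<lparr>carrier := Z\<rparr>) B)"
        unfolding quot(1) by simp
      then have "B +>\<^bsub>(E i)\<lparr>carrier := Z\<rparr>\<^esub> x = \<zero>\<^bsub>quot_module ((E i)\<lparr>carrier := Z\<rparr>) B\<^esub>"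
        using van unfolding lc_vanishes_def lc by simp
      then show "x \<in> B"
        using quot(2)[of x] x by simp
    qed
  next
    assume "Z \<subseteq> B"
    then have "\<And>x. x \<in> Z \<Longrightarrow> B +>\<^bsub>(E i)\<lparr>carrier := Z\<rparr>\<^esub> x = \<zero>\<^bsub>quot_module ((E i)\<lparr>carrier := Z\<rparr>) B\<^esub>"
      using quot(2) by auto
    moreover have "Z \<noteq> {}"
      using Z.M.zero_closed by auto
    ultimately show "lc_vanishes R \<aa> i N"
      unfolding lc_vanishes_def lc quot(1) by auto
  qed
  also have "\<dots> \<longleftrightarrow> torsion_exact R \<aa> E \<delta> i"
    unfolding torsion_exact_def Z_def B_def by (cases i) auto
  also have "\<dots> \<longleftrightarrow> torsion_exact R \<aa> F d i"
  proof -
    have "(\<lambda>x. x) \<in> mod_hom R N N" "bij_betw (\<lambda>x. x) (carrier N) (carrier N)"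
      by (auto intro: mod_homI simp: bij_betw_def)
    then show ?thesis
      using torsion_exact_iso[OF R \<aa> E F] torsion_exact_iso[OF R \<aa> F E] by blast
  qed
  finally show ?thesis .
qed

lemma baer_resolution_exists:
  fixes N :: "('a, 'b, 'm) module_scheme"
  assumes "module R N"
  obtains E :: "nat \<Rightarrow> ('a, ('a, 'b) resol_elem) module" and \<epsilon> d where "baer_resolution R N E \<epsilon> d"
  using chosen_resolution_baer[OF assms] by (metis prod_cases3)

context
  fixes R :: "('a, 'r) ring_scheme" and \<aa> :: "'a set"
  assumes R: "cring R" and \<aa>: "ideal \<aa> R"
begin

text \<open>These are the exactness of the long sequence at \<open>H^i(B)\<close> and at
  \<open>H^i(C)\<close>, stated for vanishing. The horseshoe resolution is a degreewise product, so
  its torsion part splits into the two torsion parts.\<close>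

lemma lc_vanishes_short_exact:
  fixes A :: "('a, 'b, 'm) module_scheme" and B :: "('a, 'c, 'n) module_scheme"
    and C :: "('a, 'd, 'o) module_scheme"
  assumes ex: "short_exact R A \<alpha> B \<pi> C"
  shows "lc_vanishes R \<aa> i A \<Longrightarrow> lc_vanishes R \<aa> i C \<Longrightarrow> lc_vanishes R \<aa> i B"
    and "lc_vanishes R \<aa> i B \<Longrightarrow> lc_vanishes R \<aa> (Suc i) A \<Longrightarrow> lc_vanishes R \<aa> i C"
proof -
  have M: "module R A" "module R B" "module R C"
    using ex unfolding short_exact_def by blast+
  obtain F :: "nat \<Rightarrow> ('a, ('a, 'b) resol_elem) module" and \<eta> d where F: "baer_resolution R A F \<eta> d"
    by (rule baer_resolution_exists[OF M(1)])
  obtain G :: "nat \<Rightarrow> ('a, ('a, 'd) resol_elem) module" and \<epsilon> \<delta> where G: "baer_resolution R C G \<epsilon> \<delta>"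
    by (rule baer_resolution_exists[OF M(3)])
  define E where "E k = prod_module (F k) (G k)" for k
  obtain \<theta> \<mu> where "\<forall>k. \<theta> k \<in> mod_hom R (G k) (F (Suc k))" and
    "\<forall>k. \<forall>x\<in>carrier (G k). \<theta> (Suc k) (\<delta> k x) = \<ominus>\<^bsub>F (Suc (Suc k))\<^esub> d (Suc k) (\<theta> k x)"
    and E: "baer_resolution R B E (\<lambda>b. (\<mu> b, \<epsilon> (\<pi> b)))
      (\<lambda>k p. (d k (fst p) \<oplus>\<^bsub>F (Suc k)\<^esub> \<theta> k (snd p), \<delta> k (snd p)))"
    using horseshoe[OF ex F G, folded E_def] by meson
  then have \<theta>: "\<And>k. \<theta> k \<in> mod_hom R (G k) (F (Suc k))"
    "\<And>k x. x \<in> carrier (G k) \<Longrightarrow> \<theta> (Suc k) (\<delta> k x) = \<ominus>\<^bsub>F (Suc (Suc k))\<^esub> d (Suc k) (\<theta> k x)"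
    by simp_all
  define D where "D k p = (d k (fst p) \<oplus>\<^bsub>F (Suc k)\<^esub> \<theta> k (snd p), \<delta> k (snd p))" for k p
  note E = E[folded D_def]
  note F' = baer_resolutionD[OF F] and G' = baer_resolutionD[OF G]
  note iff = lc_vanishes_iff[OF R \<aa> F] lc_vanishes_iff[OF R \<aa> E] lc_vanishes_iff[OF R \<aa> G]
  note tor = torsion_part_carrier[OF R \<aa>] and torh = torsion_part_hom[OF R \<aa>]
    and tors = torsion_part_submodule[OF R \<aa>]
  have torE: "torsion_part R \<aa> (E k) = torsion_part R \<aa> (F k) \<times> torsion_part R \<aa> (G k)" for k
    unfolding E_def by (rule torsion_part_prod[OF R \<aa> F'(3) G'(3)])
  have zE: "\<zero>\<^bsub>E k\<^esub> = (\<zero>\<^bsub>F k\<^esub>, \<zero>\<^bsub>G k\<^esub>)" for k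
    by (simp add: E_def)
  note dc = mod_homD(1)[OF F'(5)] and \<theta>c = mod_homD(1)[OF \<theta>(1)]
    and \<theta>0 = mod_hom_zero[OF G'(3) F'(3) \<theta>(1)]
  show "lc_vanishes R \<aa> i B" if A: "lc_vanishes R \<aa> i A" and C: "lc_vanishes R \<aa> i C"
  proof (cases i)
    case 0
    interpret F1: module R "F (Suc 0)" by (rule F')
    have "p = \<zero>\<^bsub>E 0\<^esub>" if p: "p \<in> torsion_part R \<aa> (E 0)" and Dp: "D 0 p = \<zero>\<^bsub>E (Suc 0)\<^esub>" for p
    proof -
      have pt: "fst p \<in> torsion_part R \<aa> (F 0)" "snd p \<in> torsion_part R \<aa> (G 0)"
        using p by (auto simp: torE)
      have "snd p = \<zero>\<^bsub>G 0\<^esub>"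
        using C pt Dp unfolding 0 iff torsion_exact_0 zE D_def by simp
      moreover from this have "fst p = \<zero>\<^bsub>F 0\<^esub>"
        using A pt Dp \<theta>0 dc[OF tor[OF pt(1)]] unfolding 0 iff torsion_exact_0 zE D_def by simp
      ultimately show ?thesis
        by (simp add: zE prod_eq_iff)
    qed
    then show ?thesis
      unfolding 0 iff torsion_exact_0 by blast
  next
    case (Suc k)
    interpret F1: module R "F (Suc k)" by (rule F')
    have "\<exists>q\<in>torsion_part R \<aa> (E k). D k q = p"
      if p: "p \<in> torsion_part R \<aa> (E (Suc k))" and Dp: "D (Suc k) p = \<zero>\<^bsub>E (Suc (Suc k))\<^esub>" for p
    proof -
      have pt: "fst p \<in> torsion_part R \<aa> (F (Suc k))" "snd p \<in> torsion_part R \<aa> (G (Suc k))"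
        using p by (auto simp: torE)
      have D1: "\<delta> (Suc k) (snd p) = \<zero>\<^bsub>G (Suc (Suc k))\<^esub>"
        and D2: "d (Suc k) (fst p) \<oplus>\<^bsub>F (Suc (Suc k))\<^esub> \<theta> (Suc k) (snd p) = \<zero>\<^bsub>F (Suc (Suc k))\<^esub>"
        using Dp by (simp_all add: D_def zE)
      obtain g where g: "g \<in> torsion_part R \<aa> (G k)" "\<delta> k g = snd p"
        using C pt D1 unfolding Suc iff torsion_exact_Suc by blast
      have \<theta>g: "\<theta> k g \<in> torsion_part R \<aa> (F (Suc k))"
        by (rule torh[OF G'(3) F'(3) \<theta>(1) g(1)])
      \<comment> \<open>Once \<open>g\<close> bounds the second component, the twist
        \<open>\<theta> k g\<close> must be removed from the first to obtain a cycle of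
        \<open>F\<close>; the anticommutation of \<open>\<theta>\<close> shows that the result is
        one.\<close>
      have "d (Suc k) (fst p \<ominus>\<^bsub>F (Suc k)\<^esub> \<theta> k g) = \<zero>\<^bsub>F (Suc (Suc k))\<^esub>"
        using D2 \<theta>(2)[OF tor[OF g(1)]] g(2) tor[OF pt(1)] tor[OF \<theta>g]
        by (subst mod_hom_minus[OF F'(3) F'(3) F'(5)]) (auto simp: a_minus_def)
      moreover have "fst p \<ominus>\<^bsub>F (Suc k)\<^esub> \<theta> k g \<in> torsion_part R \<aa> (F (Suc k))"
        by (rule F1.submodule_minus[OF tors[OF F'(3)] pt(1) \<theta>g])
      ultimately obtain f where f: "f \<in> torsion_part R \<aa> (F k)" "d k f = fst p \<ominus>\<^bsub>F (Suc k)\<^esub> \<theta> k g"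
        using A unfolding Suc iff torsion_exact_Suc by blast
      have "D k (f, g) = p"
        using f(2) g(2) tor[OF pt(1)] tor[OF \<theta>g] by (simp add: D_def F1.minus_add_cancel prod_eq_iff)
      then show ?thesis
        using f(1) g(1) by (intro bexI[of _ "(f, g)"]) (auto simp: torE)
    qed
    then show ?thesis
      unfolding Suc iff torsion_exact_Suc by blast
  qed
  show "lc_vanishes R \<aa> i C" if B: "lc_vanishes R \<aa> i B" and A: "lc_vanishes R \<aa> (Suc i) A"
  proof -
    interpret Fi: module R "F i" by (rule F')
    interpret F1: module R "F (Suc i)" by (rule F')
    interpret F2: module R "F (Suc (Suc i))" by (rule F')
    \<comment> \<open>The connecting map sends the class of \<open>g\<close> to that of
      \<open>\<theta> i g\<close>; vanishing for \<open>A\<close> one degree up makes this a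
      boundary, so \<open>g\<close> lifts to a cycle of the middle complex.\<close>
    have *: "\<exists>f. (f, g) \<in> torsion_part R \<aa> (E i) \<and> D i (f, g) = \<zero>\<^bsub>E (Suc i)\<^esub>"
      if g: "g \<in> torsion_part R \<aa> (G i)" "\<delta> i g = \<zero>\<^bsub>G (Suc i)\<^esub>" for g
    proof -
      have \<theta>g: "\<theta> i g \<in> torsion_part R \<aa> (F (Suc i))"
        by (rule torh[OF G'(3) F'(3) \<theta>(1) g(1)])
      have "\<ominus>\<^bsub>F (Suc (Suc i))\<^esub> d (Suc i) (\<theta> i g) = \<zero>\<^bsub>F (Suc (Suc i))\<^esub>"
        using \<theta>(2)[OF tor[OF g(1)]] g(2) \<theta>0 by simp
      then have "d (Suc i) (\<theta> i g) = \<zero>\<^bsub>F (Suc (Suc i))\<^esub>"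
        using F2.l_neg[OF dc[OF tor[OF \<theta>g]]] dc[OF tor[OF \<theta>g]] by simp
      then obtain y where y: "y \<in> torsion_part R \<aa> (F i)" "d i y = \<theta> i g"
        using A \<theta>g unfolding iff torsion_exact_Suc by blast
      have "d i (\<zero>\<^bsub>F i\<^esub> \<ominus>\<^bsub>F i\<^esub> y) \<oplus>\<^bsub>F (Suc i)\<^esub> \<theta> i g = \<zero>\<^bsub>F (Suc i)\<^esub>"
        using tor[OF y(1)] dc[OF tor[OF y(1)]] y(2)
        by (simp add: mod_hom_minus[OF F'(3) F'(3) F'(5)] mod_hom_zero[OF F'(3) F'(3) F'(5)]
            F1.minus_add_cancel)
      moreover have "\<zero>\<^bsub>F i\<^esub> \<ominus>\<^bsub>F i\<^esub> y \<in> torsion_part R \<aa> (F i)"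
      proof (rule Fi.submodule_minus[OF tors[OF F'(3)] _ y(1)])
        show "\<zero>\<^bsub>F i\<^esub> \<in> torsion_part R \<aa> (F i)"
          using tors[OF F'(3), of i] unfolding Fi.submodule_iff by blast
      qed
      ultimately show ?thesis
        using g by (intro exI[of _ "\<zero>\<^bsub>F i\<^esub> \<ominus>\<^bsub>F i\<^esub> y"]) (simp add: torE D_def zE)
    qed
    show ?thesis
    proof (cases i)
      case 0
      have "g = \<zero>\<^bsub>G 0\<^esub>" if "g \<in> torsion_part R \<aa> (G 0)" "\<delta> 0 g = \<zero>\<^bsub>G (Suc 0)\<^esub>" for g
        using *[of g] that B unfolding 0 iff torsion_exact_0 zE by auto
      then show ?thesis
        unfolding 0 iff torsion_exact_0 by blast
    next
      case (Suc k)
      have "\<exists>y\<in>torsion_part R \<aa> (G k). \<delta> k y = g"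
        if g: "g \<in> torsion_part R \<aa> (G (Suc k))" "\<delta> (Suc k) g = \<zero>\<^bsub>G (Suc (Suc k))\<^esub>" for g
      proof -
        obtain f where "(f, g) \<in> torsion_part R \<aa> (E (Suc k))" "D (Suc k) (f, g) = \<zero>\<^bsub>E (Suc (Suc k))\<^esub>"
          using *[of g] g unfolding Suc by blast
        then obtain q where "q \<in> torsion_part R \<aa> (E k)" "D k q = (f, g)"
          using B unfolding Suc iff torsion_exact_Suc by blast
        then show ?thesis
          by (intro bexI[of _ "snd q"]) (auto simp: torE D_def)
      qed
      then show ?thesis
        unfolding Suc iff torsion_exact_Suc by blast
    qed
  qed
qed

end

subsection \<open>Vanishing in large degrees\<close>

text \<open>Zorn's lemma applies because a nonempty chain of ideals in a noetherian ring contains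
  its union.\<close>

lemma (in noetherian_ring) ideals_maximal:
  assumes "\<C> \<noteq> {}" "\<And>I. I \<in> \<C> \<Longrightarrow> ideal I R"
  shows "\<exists>I\<in>\<C>. \<forall>J\<in>\<C>. I \<subseteq> J \<longrightarrow> J = I"
proof (rule subset_Zorn_nonempty)
  show "\<C> \<noteq> {}" by fact
  fix C assume C: "C \<noteq> {}" "subset.chain \<C> C"
  then have "subset.chain {I. ideal I R} C"
    using assms(2) unfolding subset_chain_def by blast
  then have "\<Union>C \<in> C"
    by (rule ideal_chain_is_trivial[OF C(1)])
  then show "\<Union>C \<in> \<C>"
    using C(2) unfolding subset_chain_def by blast
qed

text \<open>For finite \<open>T\<close> this describes torsion with respect to the generated ideal
  while avoiding powers of ideals; the exponent may depend on \<open>s\<close>. In this form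
  generators can be added one at a time.\<close>

definition elem_torsion ::
  "('a, 'r) ring_scheme \<Rightarrow> 'a set \<Rightarrow> ('a, 'b, 'm) module_scheme \<Rightarrow> 'b set" where
  "elem_torsion R T N = {x \<in> carrier N. \<forall>s\<in>T. \<exists>n::nat. (s [^]\<^bsub>R\<^esub> n) \<odot>\<^bsub>N\<^esub> x = \<zero>\<^bsub>N\<^esub>}"

lemma (in module) pow_smult_zero_mono:
  assumes "s \<in> carrier R" "x \<in> carrier M" "(s [^] (m::nat)) \<odot>\<^bsub>M\<^esub> x = \<zero>\<^bsub>M\<^esub>" "m \<le> n"
  shows "(s [^] n) \<odot>\<^bsub>M\<^esub> x = \<zero>\<^bsub>M\<^esub>"
proof -
  have "s [^] n = s [^] (n - m) \<otimes> s [^] m"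
    using assms by (simp add: R.nat_pow_mult)
  then show ?thesis
    using assms by (simp add: smult_assoc1)
qed

lemma elem_torsion_submodule:
  assumes "module R N" and T: "T \<subseteq> carrier R"
  shows "submodule (elem_torsion R T N) R N"
proof -
  interpret N: module R N by fact
  show ?thesis
    unfolding N.submodule_iff
  proof (intro conjI ballI)
    show "elem_torsion R T N \<subseteq> carrier N"
      by (auto simp: elem_torsion_def)
    show "\<zero>\<^bsub>N\<^esub> \<in> elem_torsion R T N"
      using T by (auto simp: elem_torsion_def)
    show "x \<oplus>\<^bsub>N\<^esub> y \<in> elem_torsion R T N" if xy: "x \<in> elem_torsion R T N" "y \<in> elem_torsion R T N" for x y
    proof -
      have c: "x \<in> carrier N" "y \<in> carrier N"
        using xy by (auto simp: elem_torsion_def)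
      have "\<exists>n::nat. (s [^]\<^bsub>R\<^esub> n) \<odot>\<^bsub>N\<^esub> (x \<oplus>\<^bsub>N\<^esub> y) = \<zero>\<^bsub>N\<^esub>" if s: "s \<in> T" for s
      proof -
        obtain m n :: nat where mn: "(s [^]\<^bsub>R\<^esub> m) \<odot>\<^bsub>N\<^esub> x = \<zero>\<^bsub>N\<^esub>" "(s [^]\<^bsub>R\<^esub> n) \<odot>\<^bsub>N\<^esub> y = \<zero>\<^bsub>N\<^esub>"
          using xy s unfolding elem_torsion_def by blast
        have sR: "s \<in> carrier R"
          using s T by blast
        have "(s [^]\<^bsub>R\<^esub> max m n) \<odot>\<^bsub>N\<^esub> x = \<zero>\<^bsub>N\<^esub>" "(s [^]\<^bsub>R\<^esub> max m n) \<odot>\<^bsub>N\<^esub> y = \<zero>\<^bsub>N\<^esub>"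
          using N.pow_smult_zero_mono[OF sR c(1) mn(1)] N.pow_smult_zero_mono[OF sR c(2) mn(2)] by auto
        then show ?thesis
          using c sR by (intro exI[of _ "max m n"]) (simp add: N.smult_r_distr)
      qed
      then show ?thesis
        using c by (simp add: elem_torsion_def)
    qed
    show "r \<odot>\<^bsub>N\<^esub> x \<in> elem_torsion R T N" if r: "r \<in> carrier R" and x: "x \<in> elem_torsion R T N" for r x
    proof -
      have c: "x \<in> carrier N"
        using x by (auto simp: elem_torsion_def)
      have "\<exists>n::nat. (s [^]\<^bsub>R\<^esub> n) \<odot>\<^bsub>N\<^esub> (r \<odot>\<^bsub>N\<^esub> x) = \<zero>\<^bsub>N\<^esub>" if s: "s \<in> T" for s
      proof -
        obtain n :: nat where n: "(s [^]\<^bsub>R\<^esub> n) \<odot>\<^bsub>N\<^esub> x = \<zero>\<^bsub>N\<^esub>"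
          using x s unfolding elem_torsion_def by blast
        have sR: "s \<in> carrier R"
          using s T by blast
        show ?thesis
          using n N.smult_commute[of "s [^]\<^bsub>R\<^esub> n" r x] r c sR by (intro exI[of _ n]) simp
      qed
      then show ?thesis
        using c r by (simp add: elem_torsion_def)
    qed
  qed
qed

lemma elem_torsion_hom:
  assumes "module R M" "module R N" "f \<in> mod_hom R M N" "T \<subseteq> carrier R" "x \<in> elem_torsion R T M"
  shows "f x \<in> elem_torsion R T N"
proof -
  interpret M: module R M by fact
  have x: "x \<in> carrier M"
    using assms(5) by (simp add: elem_torsion_def)
  have "\<exists>n::nat. (s [^]\<^bsub>R\<^esub> n) \<odot>\<^bsub>N\<^esub> f x = \<zero>\<^bsub>N\<^esub>" if s: "s \<in> T" for s
  proof -
    obtain n :: nat where n: "(s [^]\<^bsub>R\<^esub> n) \<odot>\<^bsub>M\<^esub> x = \<zero>\<^bsub>M\<^esub>"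
      using assms(5) s unfolding elem_torsion_def by blast
    have sR: "s \<in> carrier R"
      using s assms(4) by blast
    show ?thesis
      using mod_homD(3)[OF assms(3) _ x, of "s [^]\<^bsub>R\<^esub> n"] sR n mod_hom_zero[OF assms(1-3)]
      by (intro exI[of _ n]) simp
  qed
  then show ?thesis
    using mod_homD(1)[OF assms(3) x] by (simp add: elem_torsion_def)
qed

text \<open>If \<open>s^(e s)\<close> kills \<open>x\<close> for every generator \<open>s\<close>,
  then the power of \<aa> with exponent \<open>Suc (sum e S)\<close> kills \<open>x\<close>: passing
  to \<open>s x\<close> lowers the exponent of \<open>s\<close> by one, and an exponent 0 means
  \<open>x = 0\<close>.\<close>

lemma torsion_part_eq_elem_torsion:
  assumes R: "cring R" and N: "module R N" and S: "finite S" "S \<subseteq> carrier R" and \<aa>: "\<aa> = Idl\<^bsub>R\<^esub> S"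
  shows "torsion_part R \<aa> N = elem_torsion R S N"
proof -
  interpret N: module R N by fact
  have ideal: "ideal \<aa> R"
    unfolding \<aa> by (rule N.genideal_ideal[OF S(2)])
  note pow_carr = ideal.Icarr[OF ideal_pow_ideal[OF R ideal]]
  have SI: "S \<subseteq> \<aa>"
    unfolding \<aa> by (rule N.genideal_self[OF S(2)])
  have pow: "s [^]\<^bsub>R\<^esub> n \<in> \<aa> [^]\<^bsub>ideals_set R\<^esub> n" if s: "s \<in> S" for s and n :: nat
  proof (induction n)
    case 0
    then show ?case
      by (simp add: ideals_set_def)
  next
    case (Suc n)
    then show ?case
      unfolding ideal_pow_Suc[OF R ideal] using s SI by (auto intro: ideal_prod.prod)
  qed
  define kills where "kills n x \<longleftrightarrow> (\<forall>r\<in>\<aa> [^]\<^bsub>ideals_set R\<^esub> (n::nat). r \<odot>\<^bsub>N\<^esub> x = \<zero>\<^bsub>N\<^esub>)" for n x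
  \<comment> \<open>The ring elements \<open>j\<close> such that \<open>\<aa>^n\<close> kills
    \<open>j x\<close> form an ideal \<open>K\<close>; if it contains the generators it contains
    \<aa>, and then \<open>\<aa>^(n+1)\<close> kills \<open>x\<close>.\<close>
  have kills_Suc: "kills (Suc n) x" if x: "x \<in> carrier N" and k: "\<And>s. s \<in> S \<Longrightarrow> kills n (s \<odot>\<^bsub>N\<^esub> x)" for n x
  proof -
    interpret reg: module R "regular_module R"
      by (rule module_regular[OF R])
    define K where "K = {j \<in> carrier R. kills n (j \<odot>\<^bsub>N\<^esub> x)}"
    have "submodule K R (regular_module R)"
      unfolding reg.submodule_iff
    proof (intro conjI ballI)
      show "\<zero>\<^bsub>regular_module R\<^esub> \<in> K"
        using x pow_carr by (auto simp: K_def kills_def)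
      show "i \<oplus>\<^bsub>regular_module R\<^esub> j \<in> K" if "i \<in> K" "j \<in> K" for i j
        using that x pow_carr by (auto simp: K_def kills_def N.smult_l_distr N.smult_r_distr)
      show "r \<odot>\<^bsub>regular_module R\<^esub> j \<in> K" if "r \<in> carrier R" "j \<in> K" for r j
      proof -
        have "i \<odot>\<^bsub>N\<^esub> ((r \<otimes>\<^bsub>R\<^esub> j) \<odot>\<^bsub>N\<^esub> x) = \<zero>\<^bsub>N\<^esub>" if i: "i \<in> \<aa> [^]\<^bsub>ideals_set R\<^esub> n" for i
        proof -
          have "i \<odot>\<^bsub>N\<^esub> ((r \<otimes>\<^bsub>R\<^esub> j) \<odot>\<^bsub>N\<^esub> x) = r \<odot>\<^bsub>N\<^esub> (i \<odot>\<^bsub>N\<^esub> (j \<odot>\<^bsub>N\<^esub> x))"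
            using \<open>r \<in> carrier R\<close> \<open>j \<in> K\<close> x pow_carr[OF i] N.smult_commute[of i r "j \<odot>\<^bsub>N\<^esub> x"]
            by (simp add: N.smult_assoc1 K_def)
          then show ?thesis
            using \<open>r \<in> carrier R\<close> \<open>j \<in> K\<close> i by (simp add: K_def kills_def)
        qed
        then show ?thesis
          using that by (simp add: K_def kills_def)
      qed
    qed (auto simp: K_def)
    then have "ideal K R"
      by (simp add: submodule_regular_iff R)
    moreover have "S \<subseteq> K"
      using k S(2) by (auto simp: K_def)
    ultimately have "\<aa> \<subseteq> K"
      unfolding \<aa> by (rule N.genideal_minimal)
    have "r \<odot>\<^bsub>N\<^esub> x = \<zero>\<^bsub>N\<^esub>" if r: "r \<in> (\<aa> [^]\<^bsub>ideals_set R\<^esub> n) \<cdot>\<^bsub>R\<^esub> \<aa>" for r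
      using r
    proof (induction r)
      case (prod i j)
      then have "j \<in> K"
        using \<open>\<aa> \<subseteq> K\<close> by blast
      then show ?case
        using prod pow_carr x by (simp add: N.smult_assoc1 K_def kills_def)
    next
      case (sum r s)
      have "r \<in> carrier R" "s \<in> carrier R"
        using sum N.ideal_prod_in_carrier[OF ideal_pow_ideal[OF R ideal] ideal] by blast+
      then show ?case
        using sum x by (simp add: N.smult_l_distr)
    qed
    then show ?thesis
      unfolding kills_def ideal_pow_Suc[OF R ideal] by blast
  qed
  \<comment> \<open>The additional power covers an empty \<open>S\<close>: there
    \<open>m = 0\<close>, and the zeroth power of \<aa> is the whole ring, which need not kill
    \<open>x\<close>.\<close>
  have kills: "kills (Suc m) x"
    if "x \<in> carrier N" "\<And>s. s \<in> S \<Longrightarrow> (s [^]\<^bsub>R\<^esub> (e s :: nat)) \<odot>\<^bsub>N\<^esub> x = \<zero>\<^bsub>N\<^esub>" "sum e S = m" for m x e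
    using that
  proof (induction m arbitrary: x e)
    case (0 x e)
    show ?case
    proof (rule kills_Suc)
      fix s assume s: "s \<in> S"
      then have "e s = 0"
        using 0 S(1) by simp
      then have "x = \<zero>\<^bsub>N\<^esub>"
        using 0(1) 0(2)[OF s] by simp
      moreover have "s \<in> carrier R"
        using s S(2) by blast
      ultimately show "kills 0 (s \<odot>\<^bsub>N\<^esub> x)"
        unfolding kills_def using pow_carr[of _ 0] by simp
    qed (rule 0)
  next
    case (Suc m x e)
    show ?case
    proof (rule kills_Suc)
      fix s assume s: "s \<in> S"
      have sR: "s \<in> carrier R"
        using s S by blast
      show "kills (Suc m) (s \<odot>\<^bsub>N\<^esub> x)"
      proof (cases "e s")
        case 0
        then have "x = \<zero>\<^bsub>N\<^esub>"
          using Suc.prems(1,2) s by force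
        then show ?thesis
          unfolding kills_def using pow_carr[of _ "Suc m"] sR by simp
      next
        case (Suc l)
        show ?thesis
        proof (rule Suc.IH[where e = "e(s := l)"])
          show "s \<odot>\<^bsub>N\<^esub> x \<in> carrier N"
            using sR Suc.prems by blast
          have "sum e S = e s + sum e (S - {s})"
            using s S(1) by (simp add: sum.remove)
          moreover have "sum (e(s := l)) S = l + sum e (S - {s})"
            using s S(1) by (simp add: sum.remove)
          ultimately show "sum (e(s := l)) S = m"
            using Suc Suc.prems(3) by simp
          show "(u [^]\<^bsub>R\<^esub> (e(s := l)) u) \<odot>\<^bsub>N\<^esub> (s \<odot>\<^bsub>N\<^esub> x) = \<zero>\<^bsub>N\<^esub>" if u: "u \<in> S" for u
          proof (cases "u = s")
            case True
            then show ?thesis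
              using Suc.prems(2)[OF s] Suc sR Suc.prems(1) by (simp add: N.smult_assoc1)
          next
            case False
            then show ?thesis
              using Suc.prems(1,2) u S(2) sR N.smult_commute[of "u [^]\<^bsub>R\<^esub> e u" s x] by auto
          qed
        qed
      qed
    qed (use Suc.prems in simp)
  qed
  show ?thesis
  proof (intro equalityI subsetI)
    fix x assume "x \<in> torsion_part R \<aa> N"
    then show "x \<in> elem_torsion R S N"
      using pow unfolding torsion_part_def elem_torsion_def by blast
  next
    fix x assume x: "x \<in> elem_torsion R S N"
    then have xc: "x \<in> carrier N"
      by (simp add: elem_torsion_def)
    obtain e where e: "\<And>s. s \<in> S \<Longrightarrow> (s [^]\<^bsub>R\<^esub> (e s :: nat)) \<odot>\<^bsub>N\<^esub> x = \<zero>\<^bsub>N\<^esub>"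
      using x unfolding elem_torsion_def by (auto dest!: bchoice)
    have "kills (Suc (sum e S)) x"
      by (rule kills[OF xc e refl])
    then show "x \<in> torsion_part R \<aa> N"
      using xc unfolding torsion_part_def kills_def by blast
  qed
qed

text \<open>
  This replaces the surjectivity of \<open>E \<rightarrow> E\<^sub>x\<close> for an injective module \<open>E\<close>: modulo \<open>x\<close>-torsion, every
  element is divisible by the powers of \<open>x\<close>, without enlarging its annihilator.
\<close>

lemma baer_divide_modulo_torsion:
  assumes R: "noetherian_ring R" and E: "baer R E" and x: "x \<in> carrier R" and c: "c \<in> carrier E"
  shows "\<exists>e\<in>carrier E. \<exists>k::nat. (x [^]\<^bsub>R\<^esub> (m + k)) \<odot>\<^bsub>E\<^esub> e = (x [^]\<^bsub>R\<^esub> k) \<odot>\<^bsub>E\<^esub> c \<and>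
           (\<forall>r\<in>carrier R. r \<odot>\<^bsub>E\<^esub> c = \<zero>\<^bsub>E\<^esub> \<longrightarrow> r \<odot>\<^bsub>E\<^esub> e = \<zero>\<^bsub>E\<^esub>)"
proof -
  interpret E: module R E using E by (rule baer_module)
  interpret noetherian_ring R by fact
  interpret reg: module R "regular_module R"
    by (rule module_regular[OF E.is_cring])
  \<comment> \<open>The annihilators of \<open>x^k c\<close> increase with \<open>k\<close>; at a
    maximal one, a multiple of \<open>c\<close> is killed by \<open>x^(m+k)\<close> exactly when it
    is killed by \<open>x^k\<close>.\<close>
  define A where "A k = {r \<in> carrier R. r \<odot>\<^bsub>E\<^esub> ((x [^]\<^bsub>R\<^esub> (k::nat)) \<odot>\<^bsub>E\<^esub> c) = \<zero>\<^bsub>E\<^esub>}" for k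
  have "ideal (A k) R" for k
  proof -
    have "submodule (A k) R (regular_module R)"
      unfolding reg.submodule_iff A_def using x c by (auto simp: E.smult_l_distr E.smult_assoc1)
    then show ?thesis
      by (simp add: submodule_regular_iff E.is_cring)
  qed
  then obtain k where k: "\<And>l. A k \<subseteq> A l \<Longrightarrow> A l = A k"
    using ideals_maximal[of "range A"] by auto
  have Akm: "A (m + k) = A k"
  proof (rule k, rule subsetI)
    fix r assume r: "r \<in> A k"
    have "r \<odot>\<^bsub>E\<^esub> ((x [^]\<^bsub>R\<^esub> (m + k)) \<odot>\<^bsub>E\<^esub> c) = (x [^]\<^bsub>R\<^esub> m) \<odot>\<^bsub>E\<^esub> (r \<odot>\<^bsub>E\<^esub> ((x [^]\<^bsub>R\<^esub> k) \<odot>\<^bsub>E\<^esub> c))"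
      using r x c E.smult_commute[of r "x [^]\<^bsub>R\<^esub> m" "(x [^]\<^bsub>R\<^esub> k) \<odot>\<^bsub>E\<^esub> c"]
      by (simp add: A_def E.smult_assoc1 flip: E.nat_pow_mult)
    then show "r \<in> A (m + k)"
      using r x by (simp add: A_def)
  qed
  let ?Y = "E\<lparr>carrier := {r \<odot>\<^bsub>E\<^esub> c |r. r \<in> carrier R}\<rparr>"
  have sub: "submodule {r \<odot>\<^bsub>E\<^esub> c |r. r \<in> carrier R} R E"
    by (rule E.cyclic_submodule[OF c])
  have Y: "module R ?Y"
    using sub E.module_axioms by (rule submodule.submodule_is_module)
  have mult_hom: "(\<lambda>y. s \<odot>\<^bsub>E\<^esub> y) \<in> mod_hom R ?Y ?Y" if s: "s \<in> carrier R" for s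
  proof (rule mod_homI)
    show "s \<odot>\<^bsub>E\<^esub> y \<in> carrier ?Y" if "y \<in> carrier ?Y" for y
      using that submodule.smult_closed[OF sub s] by simp
  qed (use s c in \<open>auto simp: E.smult_r_distr E.smult_commute\<close>)
  \<comment> \<open>On the cyclic module \<open>R c\<close>, multiplication by \<open>x^k\<close>
    factors through multiplication by \<open>x^(m+k)\<close>; the value at \<open>c\<close> of the
    resulting map \<open>g\<close> is the desired \<open>e\<close>, and linearity of
    \<open>g\<close> keeps the annihilator.\<close>
  have p: "(\<lambda>y. (x [^]\<^bsub>R\<^esub> (m + k)) \<odot>\<^bsub>E\<^esub> y) \<in> mod_hom R ?Y ?Y"
    using x by (intro mult_hom) simp
  have f: "(\<lambda>y. (x [^]\<^bsub>R\<^esub> k) \<odot>\<^bsub>E\<^esub> y) \<in> mod_hom R ?Y E"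
    using mod_hom_comp[OF mult_hom mod_hom_inclusion[OF sub E.module_axioms]] x by simp
  have "(x [^]\<^bsub>R\<^esub> k) \<odot>\<^bsub>E\<^esub> y = \<zero>\<^bsub>E\<^esub>" if y: "y \<in> carrier ?Y" "(x [^]\<^bsub>R\<^esub> (m + k)) \<odot>\<^bsub>E\<^esub> y = \<zero>\<^bsub>?Y\<^esub>" for y
  proof -
    obtain r where r: "r \<in> carrier R" "y = r \<odot>\<^bsub>E\<^esub> c"
      using y(1) by auto
    have "r \<in> A (m + k)"
      using r y(2) x c E.smult_commute[of r "x [^]\<^bsub>R\<^esub> (m + k)" c] by (simp add: A_def)
    then have "r \<in> A k"
      by (simp add: Akm)
    then show ?thesis
      using r x c E.smult_commute[of r "x [^]\<^bsub>R\<^esub> k" c] by (simp add: A_def)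
  qed
  then obtain g where g: "g \<in> mod_hom R ?Y E"
    "\<And>y. y \<in> carrier ?Y \<Longrightarrow> g ((x [^]\<^bsub>R\<^esub> (m + k)) \<odot>\<^bsub>E\<^esub> y) = (x [^]\<^bsub>R\<^esub> k) \<odot>\<^bsub>E\<^esub> y"
    using baer_factor[OF Y Y E p f] by auto
  have cY: "c \<in> carrier ?Y"
    using c by (auto intro!: exI[of _ "\<one>\<^bsub>R\<^esub>"])
  have g_smult: "g (r \<odot>\<^bsub>E\<^esub> c) = r \<odot>\<^bsub>E\<^esub> g c" if "r \<in> carrier R" for r
    using mod_homD(3)[OF g(1) that cY] by simp
  have "(x [^]\<^bsub>R\<^esub> (m + k)) \<odot>\<^bsub>E\<^esub> g c = (x [^]\<^bsub>R\<^esub> k) \<odot>\<^bsub>E\<^esub> c"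
    using g(2)[OF cY] g_smult[of "x [^]\<^bsub>R\<^esub> (m + k)"] x by simp
  moreover have "r \<odot>\<^bsub>E\<^esub> g c = \<zero>\<^bsub>E\<^esub>" if "r \<in> carrier R" "r \<odot>\<^bsub>E\<^esub> c = \<zero>\<^bsub>E\<^esub>" for r
    using g_smult[OF that(1)] that(2) mod_hom_zero[OF Y E.module_axioms g(1)] by simp
  moreover have "g c \<in> carrier E"
    by (rule mod_homD(1)[OF g(1) cY])
  ultimately show ?thesis
    by blast
qed

text \<open>Each new generator \<open>x\<close> uses the induction hypothesis in two adjacent
  degrees, which is why the bound grows by one. A \<open>T\<close>-torsion preimage is corrected by
  a boundary so that a power of \<open>x\<close> kills it too. For empty \<open>T\<close> this is
  exactness of the resolution.\<close>

lemma elem_torsion_exact: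
  fixes R :: "('a, 'r) ring_scheme" and E :: "nat \<Rightarrow> ('a, 'e) module"
  assumes R: "noetherian_ring R" and E: "baer_resolution R N E \<epsilon> d" and T: "finite T" "T \<subseteq> carrier R"
  shows "\<forall>k z. Suc k > card T \<and> z \<in> elem_torsion R T (E (Suc k)) \<and> d (Suc k) z = \<zero>\<^bsub>E (Suc (Suc k))\<^esub> \<longrightarrow>
           (\<exists>y\<in>elem_torsion R T (E k). d k y = z)"
  using T
proof (induction T rule: finite_induct)
  case empty
  then show ?case
    using baer_resolutionD(10)[OF E] by (auto simp: elem_torsion_def)
next
  case (insert x T)
  note E' = baer_resolutionD[OF E]
  have TR: "T \<subseteq> carrier R" and xR: "x \<in> carrier R"
    using insert.prems by auto
  have IH: "\<exists>y\<in>elem_torsion R T (E k). d k y = z"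
    if "Suc k > card T" "z \<in> elem_torsion R T (E (Suc k))" "d (Suc k) z = \<zero>\<^bsub>E (Suc (Suc k))\<^esub>" for k z
    using insert.IH[OF TR] that by blast
  have ins: "z \<in> elem_torsion R (insert x T) N \<longleftrightarrow>
      z \<in> elem_torsion R T N \<and> (\<exists>n::nat. (x [^]\<^bsub>R\<^esub> n) \<odot>\<^bsub>N\<^esub> z = \<zero>\<^bsub>N\<^esub>)" for z and N :: "('a, 'e) module"
    by (auto simp: elem_torsion_def)
  have tc: "z \<in> carrier N" if "z \<in> elem_torsion R T N" for z and N :: "('a, 'e) module"
    using that by (simp add: elem_torsion_def)
  have "\<exists>y\<in>elem_torsion R (insert x T) (E k). d k y = z"
    if k: "Suc k > card (insert x T)" and z: "z \<in> elem_torsion R (insert x T) (E (Suc k))"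
      and dz: "d (Suc k) z = \<zero>\<^bsub>E (Suc (Suc k))\<^esub>" for k z
  proof -
    have "k > card T"
      using k insert.hyps by simp
    then obtain j where j: "k = Suc j" "Suc j > card T"
      by (cases k) auto
    obtain m :: nat where zT: "z \<in> elem_torsion R T (E (Suc k))" and m: "(x [^]\<^bsub>R\<^esub> m) \<odot>\<^bsub>E (Suc k)\<^esub> z = \<zero>\<^bsub>E (Suc k)\<^esub>"
      using z unfolding ins by blast
    obtain w where w: "w \<in> elem_torsion R T (E k)" "d k w = z"
      using IH[OF _ zT dz] \<open>k > card T\<close> by auto
    interpret Ek: module R "E k" by (rule E')
    interpret Ej: module R "E j" by (rule E')
    note pc = Ek.nat_pow_closed[OF xR]
    have "(x [^]\<^bsub>R\<^esub> m) \<odot>\<^bsub>E k\<^esub> w \<in> elem_torsion R T (E k)"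
      using elem_torsion_submodule[OF E'(3) TR, of k] w(1) pc unfolding Ek.submodule_iff by blast
    moreover have "d k ((x [^]\<^bsub>R\<^esub> m) \<odot>\<^bsub>E k\<^esub> w) = \<zero>\<^bsub>E (Suc k)\<^esub>"
      using mod_homD(3)[OF E'(5) pc tc[OF w(1)]] w(2) m by simp
    ultimately obtain v where v: "v \<in> elem_torsion R T (E j)" "d j v = (x [^]\<^bsub>R\<^esub> m) \<odot>\<^bsub>E k\<^esub> w"
      using IH[OF j(2)] unfolding j(1) by blast
    \<comment> \<open>\<open>x^m w\<close> is the boundary of \<open>v\<close>. Dividing
      \<open>v\<close> by \<open>x^m\<close> up to \<open>x\<close>-torsion gives \<open>e\<close>,
      and \<open>w\<close> minus the boundary of \<open>e\<close> is killed by
      \<open>x^(m+n)\<close> and still maps to \<open>z\<close>.\<close>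
    obtain e n where e: "e \<in> carrier (E j)" "(x [^]\<^bsub>R\<^esub> (m + n)) \<odot>\<^bsub>E j\<^esub> e = (x [^]\<^bsub>R\<^esub> (n::nat)) \<odot>\<^bsub>E j\<^esub> v"
      and ann: "\<And>r. r \<in> carrier R \<Longrightarrow> r \<odot>\<^bsub>E j\<^esub> v = \<zero>\<^bsub>E j\<^esub> \<Longrightarrow> r \<odot>\<^bsub>E j\<^esub> e = \<zero>\<^bsub>E j\<^esub>"
      using baer_divide_modulo_torsion[OF R E'(2) xR tc[OF v(1)], of m] by blast
    have eT: "e \<in> elem_torsion R T (E j)"
      using v(1) e(1) ann TR unfolding elem_torsion_def by (auto simp: subset_iff) (metis Ek.nat_pow_closed)
    define w' where "w' = w \<ominus>\<^bsub>E k\<^esub> d j e"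
    have de: "d j e \<in> elem_torsion R T (E k)"
      unfolding j(1) by (rule elem_torsion_hom[OF E'(3) E'(3) E'(5) TR eT])
    have w'T: "w' \<in> elem_torsion R T (E k)"
      unfolding w'_def by (rule Ek.submodule_minus[OF elem_torsion_submodule[OF E'(3) TR] w(1) de])
    have "(x [^]\<^bsub>R\<^esub> (m + n)) \<odot>\<^bsub>E k\<^esub> w' = \<zero>\<^bsub>E k\<^esub>"
    proof -
      have "(x [^]\<^bsub>R\<^esub> (m + n)) \<odot>\<^bsub>E k\<^esub> d j e = d j ((x [^]\<^bsub>R\<^esub> n) \<odot>\<^bsub>E j\<^esub> v)"
        using mod_homD(3)[OF E'(5)[of j] pc e(1), of "m + n"] e(2) j(1) by simp
      also have "\<dots> = (x [^]\<^bsub>R\<^esub> n) \<odot>\<^bsub>E k\<^esub> ((x [^]\<^bsub>R\<^esub> m) \<odot>\<^bsub>E k\<^esub> w)"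
        using mod_homD(3)[OF E'(5)[of j] pc tc[OF v(1)], of n] v(2) j(1) by simp
      also have "\<dots> = (x [^]\<^bsub>R\<^esub> (m + n)) \<odot>\<^bsub>E k\<^esub> w"
        using tc[OF w(1)] pc xR by (simp add: add.commute[of m n] Ek.smult_assoc1 flip: Ek.nat_pow_mult)
      finally show ?thesis
        unfolding w'_def using tc[OF w(1)] tc[OF de] pc by (simp add: Ek.smult_minus_distr Ek.minus_eq_zero_iff)
    qed
    then have "w' \<in> elem_torsion R (insert x T) (E k)"
      using w'T unfolding ins by blast
    moreover have "d k w' = z"
    proof -
      interpret ES: module R "E (Suc k)" by (rule E')
      have "d k (d j e) = \<zero>\<^bsub>E (Suc k)\<^esub>"
        using E'(9)[OF e(1)] j(1) by simp
      then show ?thesis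
        unfolding w'_def using mod_hom_minus[OF E'(3) E'(3) E'(5) tc[OF w(1)] tc[OF de]] w(2) tc[OF zT]
        by (simp add: ES.minus_zero_right)
    qed
    ultimately show ?thesis
      by blast
  qed
  then show ?case
    by blast
qed

lemma lc_vanishes_large:
  fixes N :: "('a, 'b, 'm) module_scheme"
  assumes R: "cring R" "noetherian_ring R" and N: "module R N"
    and S: "finite S" "S \<subseteq> carrier R" "\<aa> = Idl\<^bsub>R\<^esub> S" and i: "i > card S"
  shows "lc_vanishes R \<aa> i N"
proof -
  interpret cring R by fact
  have \<aa>: "ideal \<aa> R"
    unfolding S(3) by (rule genideal_ideal[OF S(2)])
  obtain E :: "nat \<Rightarrow> ('a, ('a, 'b) resol_elem) module" and \<epsilon> d where E: "baer_resolution R N E \<epsilon> d"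
    by (rule baer_resolution_exists[OF N])
  obtain k where k: "i = Suc k"
    using i by (cases i) auto
  have tors: "torsion_part R \<aa> (E k) = elem_torsion R S (E k)" for k
    by (rule torsion_part_eq_elem_torsion[OF R(1) baer_resolutionD(3)[OF E] S])
  show ?thesis
    unfolding lc_vanishes_iff[OF R(1) \<aa> E] k torsion_exact_Suc tors
    using elem_torsion_exact[OF R(2) E S(1,2)] i k by blast
qed

subsection \<open>Noetherian modules\<close>

definition noeth_module :: "('a, 'r) ring_scheme \<Rightarrow> ('a, 'b, 'm) module_scheme \<Rightarrow> bool" where
  "noeth_module R M \<longleftrightarrow> module R M \<and>
     (\<forall>\<C>. \<C> \<noteq> {} \<and> (\<forall>H\<in>\<C>. submodule H R M) \<longrightarrow> (\<exists>H\<in>\<C>. \<forall>K\<in>\<C>. H \<subseteq> K \<longrightarrow> K = H))"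

lemma noeth_moduleD:
  assumes "noeth_module R M"
  shows "module R M"
    and "\<C> \<noteq> {} \<Longrightarrow> (\<And>H. H \<in> \<C> \<Longrightarrow> submodule H R M) \<Longrightarrow> \<exists>H\<in>\<C>. \<forall>K\<in>\<C>. H \<subseteq> K \<longrightarrow> K = H"
  using assms unfolding noeth_module_def by blast+

lemma noeth_module_regular:
  assumes "cring R" "noetherian_ring R"
  shows "noeth_module R (regular_module R)"
  unfolding noeth_module_def
  using module_regular[OF assms(1)] noetherian_ring.ideals_maximal[OF assms(2)]
  by (simp add: submodule_regular_iff[OF assms(1)])

lemma noeth_module_submodule:
  assumes M: "noeth_module R M" and N: "submodule N R M"
  shows "noeth_module R (M\<lparr>carrier := N\<rparr>)"
proof -
  interpret M: module R M using M by (rule noeth_moduleD)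
  interpret N: module R "M\<lparr>carrier := N\<rparr>"
    using N M.module_axioms by (rule submodule.submodule_is_module)
  have "submodule H R M" if "submodule H R (M\<lparr>carrier := N\<rparr>)" for H
    using N.submodule_iff[of H] M.submodule_iff[of H] M.submoduleE(1)[OF N] that by auto
  then show ?thesis
    unfolding noeth_module_def using N.module_axioms by (auto intro!: noeth_moduleD(2)[OF M])
qed

lemma noeth_module_image:
  assumes M: "noeth_module R M" and Q: "module R Q" and f: "f \<in> mod_hom R M Q" "f ` carrier M = carrier Q"
  shows "noeth_module R Q"
  unfolding noeth_module_def
proof (intro conjI allI impI Q)
  interpret M: module R M using M by (rule noeth_moduleD)
  interpret Q: module R Q by fact
  fix \<C> assume \<C>: "\<C> \<noteq> {} \<and> (\<forall>H\<in>\<C>. submodule H R Q)"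
  define pre where "pre H = {x \<in> carrier M. f x \<in> H}" for H
  have "submodule (pre H) R M" if "H \<in> \<C>" for H
  proof -
    have "submodule H R Q"
      using \<C> that by blast
    then show ?thesis
      unfolding M.submodule_iff Q.submodule_iff pre_def
      using mod_homD[OF f(1)] mod_hom_zero[OF M.module_axioms Q f(1)] by auto
  qed
  then have "\<exists>H\<in>pre ` \<C>. \<forall>K\<in>pre ` \<C>. H \<subseteq> K \<longrightarrow> K = H"
    using \<C> by (intro noeth_moduleD(2)[OF M]) auto
  then obtain H where H: "H \<in> \<C>" "\<And>K. K \<in> \<C> \<Longrightarrow> pre H \<subseteq> pre K \<Longrightarrow> pre K = pre H"
    by auto
  have img: "f ` pre K = K" if "K \<in> \<C>" for K
  proof -
    have "K \<subseteq> carrier Q"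
      using \<C> that Q.submoduleE(1) by blast
    then have "\<exists>x\<in>carrier M. y = f x" if "y \<in> K" for y
      using that f(2) by blast
    then show ?thesis
      by (auto simp: pre_def)
  qed
  have "K = H" if K: "K \<in> \<C>" "H \<subseteq> K" for K
  proof -
    have "pre H \<subseteq> pre K"
      using K(2) by (auto simp: pre_def)
    then have "pre K = pre H"
      using H(2) K(1) by blast
    then show ?thesis
      using img K(1) H(1) by metis
  qed
  then show "\<exists>H\<in>\<C>. \<forall>K\<in>\<C>. H \<subseteq> K \<longrightarrow> K = H"
    using H(1) by blast
qed

lemma (in module) colon_ideal:
  assumes H: "submodule H R M" and x: "x \<in> carrier M"
  shows "ideal {r \<in> carrier R. r \<odot>\<^bsub>M\<^esub> x \<in> H} R"
proof -
  interpret reg: module R "regular_module R"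
    by (rule module_regular[OF R.is_cring])
  have "submodule {r \<in> carrier R. r \<odot>\<^bsub>M\<^esub> x \<in> H} R (regular_module R)"
    using H x unfolding reg.submodule_iff submodule_iff by (auto simp: smult_l_distr smult_assoc1)
  then show ?thesis
    by (simp add: submodule_regular_iff R.is_cring)
qed

text \<open>Induction on the generators: equality of nested submodules of \<open>H + R x\<close> can
  be tested on the intersection with \<open>H\<close> and on the ideal of coefficients of
  \<open>x\<close>, so a maximal member is found by maximising these two in turn.\<close>

lemma fg_imp_noeth_module:
  assumes R: "noetherian_ring R" and M: "fg_module R M"
  shows "noeth_module R M"
proof -
  interpret M: module R M using M by (simp add: fg_module_def)
  interpret noetherian_ring R by fact
  interpret reg: module R "regular_module R"
    by (rule module_regular[OF M.is_cring])
  obtain S where S: "finite S" "S \<subseteq> carrier M" "\<And>N. submodule N R M \<Longrightarrow> S \<subseteq> N \<Longrightarrow> N = carrier M"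
    using M unfolding fg_module_def by blast
  have "\<exists>H. submodule H R M \<and> S \<subseteq> H \<and>
      (\<forall>\<C>. \<C> \<noteq> {} \<and> (\<forall>K\<in>\<C>. submodule K R M \<and> K \<subseteq> H) \<longrightarrow> (\<exists>K\<in>\<C>. \<forall>L\<in>\<C>. K \<subseteq> L \<longrightarrow> L = K))"
    using S(1,2)
  proof (induction S rule: finite_induct)
    case empty
    have "K = {\<zero>\<^bsub>M\<^esub>}" if "submodule K R M" "K \<subseteq> {\<zero>\<^bsub>M\<^esub>}" for K
      using that unfolding M.submodule_iff by blast
    then have "\<exists>K\<in>\<C>. \<forall>L\<in>\<C>. K \<subseteq> L \<longrightarrow> L = K"
      if "\<C> \<noteq> {} \<and> (\<forall>K\<in>\<C>. submodule K R M \<and> K \<subseteq> {\<zero>\<^bsub>M\<^esub>})" for \<C>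
      using that by (metis all_not_in_conv)
    then show ?case
      using M.zero_submodule by blast
  next
    case (insert x S)
    then obtain H where H: "submodule H R M" "S \<subseteq> H"
      and max: "\<And>\<C>. \<C> \<noteq> {} \<Longrightarrow> (\<And>K. K \<in> \<C> \<Longrightarrow> submodule K R M \<and> K \<subseteq> H) \<Longrightarrow> \<exists>K\<in>\<C>. \<forall>L\<in>\<C>. K \<subseteq> L \<longrightarrow> L = K"
      by (metis insert_subset)
    have x: "x \<in> carrier M"
      using insert by blast
    have HM: "H \<subseteq> carrier M" "\<zero>\<^bsub>M\<^esub> \<in> H"
      using H(1) by (auto simp: M.submodule_iff)
    let ?H = "{u \<oplus>\<^bsub>M\<^esub> v |u v. u \<in> H \<and> v \<in> {r \<odot>\<^bsub>M\<^esub> x |r. r \<in> carrier R}}"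
    have "submodule ?H R M"
      by (intro M.submodule_add H M.cyclic_submodule x)
    moreover have "insert x S \<subseteq> ?H"
    proof -
      have "x = \<zero>\<^bsub>M\<^esub> \<oplus>\<^bsub>M\<^esub> \<one>\<^bsub>R\<^esub> \<odot>\<^bsub>M\<^esub> x"
        using x by simp
      then have "x \<in> ?H"
        using HM(2) M.one_closed by blast
      moreover have "y \<in> ?H" if "y \<in> S" for y
      proof -
        have "y = y \<oplus>\<^bsub>M\<^esub> \<zero>\<^bsub>R\<^esub> \<odot>\<^bsub>M\<^esub> x"
          using that H(2) HM x by (auto simp: subset_iff)
        then show ?thesis
          using that H(2) M.R.zero_closed by blast
      qed
      ultimately show ?thesis
        by blast
    qed
    moreover have "\<exists>K\<in>\<C>. \<forall>L\<in>\<C>. K \<subseteq> L \<longrightarrow> L = K"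
      if \<C>: "\<C> \<noteq> {}" "\<And>K. K \<in> \<C> \<Longrightarrow> submodule K R M \<and> K \<subseteq> ?H" for \<C>
    proof -
      have "\<exists>U\<in>(\<lambda>K. K \<inter> H) ` \<C>. \<forall>L\<in>(\<lambda>K. K \<inter> H) ` \<C>. U \<subseteq> L \<longrightarrow> L = U"
      proof (rule max)
        show "submodule K R M \<and> K \<subseteq> H" if "K \<in> (\<lambda>K. K \<inter> H) ` \<C>" for K
          using that \<C>(2) H(1) unfolding M.submodule_iff by auto
      qed (use \<C> in auto)
      then obtain K0 where K0: "K0 \<in> \<C>" "\<And>L. L \<in> \<C> \<Longrightarrow> K0 \<inter> H \<subseteq> L \<inter> H \<Longrightarrow> L \<inter> H = K0 \<inter> H"
        by auto
      \<comment> \<open>The coefficients with which \<open>x\<close> occurs in \<open>K\<close>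
        modulo \<open>H\<close>; an ideal, being the colon of \<open>x\<close> into
        \<open>H + K\<close>.\<close>
      define J where "J K = {r \<in> carrier R. \<exists>h\<in>H. h \<oplus>\<^bsub>M\<^esub> r \<odot>\<^bsub>M\<^esub> x \<in> K}" for K
      define \<D> where "\<D> = {K \<in> \<C>. K \<inter> H = K0 \<inter> H}"
      have J: "ideal (J K) R" if "K \<in> \<C>" for K
      proof -
        have "J K = {r \<in> carrier R. r \<odot>\<^bsub>M\<^esub> x \<in> {h \<oplus>\<^bsub>M\<^esub> k |h k. h \<in> H \<and> k \<in> K}}"
        proof (intro equalityI subsetI)
          fix r assume "r \<in> J K"
          then obtain h where h: "r \<in> carrier R" "h \<in> H" "h \<oplus>\<^bsub>M\<^esub> r \<odot>\<^bsub>M\<^esub> x \<in> K"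
            unfolding J_def by blast
          have "r \<odot>\<^bsub>M\<^esub> x = \<ominus>\<^bsub>M\<^esub> h \<oplus>\<^bsub>M\<^esub> (h \<oplus>\<^bsub>M\<^esub> r \<odot>\<^bsub>M\<^esub> x)"
            using h HM x by (simp add: M.r_neg1 subset_iff)
          moreover have "\<ominus>\<^bsub>M\<^esub> h \<in> H"
            using M.submoduleE(3)[OF H(1) h(2)] .
          ultimately show "r \<in> {r \<in> carrier R. r \<odot>\<^bsub>M\<^esub> x \<in> {h \<oplus>\<^bsub>M\<^esub> k |h k. h \<in> H \<and> k \<in> K}}"
            using h by blast
        next
          fix r assume "r \<in> {r \<in> carrier R. r \<odot>\<^bsub>M\<^esub> x \<in> {h \<oplus>\<^bsub>M\<^esub> k |h k. h \<in> H \<and> k \<in> K}}"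
          then obtain h k where h: "r \<in> carrier R" "r \<odot>\<^bsub>M\<^esub> x = h \<oplus>\<^bsub>M\<^esub> k" "h \<in> H" "k \<in> K"
            by blast
          have "K \<subseteq> carrier M"
            using \<C>(2)[OF that] M.submoduleE(1) by blast
          then have "\<ominus>\<^bsub>M\<^esub> h \<oplus>\<^bsub>M\<^esub> r \<odot>\<^bsub>M\<^esub> x = k"
            using h HM by (simp add: M.r_neg1 subset_iff)
          moreover have "\<ominus>\<^bsub>M\<^esub> h \<in> H"
            using M.submoduleE(3)[OF H(1) h(3)] .
          ultimately show "r \<in> J K"
            unfolding J_def using h by blast
        qed
        then show ?thesis
          using M.colon_ideal[OF M.submodule_add[OF H(1)] x] \<C>(2)[OF that] by simp
      qed
      have "\<exists>I\<in>J ` \<D>. \<forall>I'\<in>J ` \<D>. I \<subseteq> I' \<longrightarrow> I' = I"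
      proof (rule ideals_maximal)
        show "J ` \<D> \<noteq> {}"
          using K0(1) by (auto simp: \<D>_def)
        show "ideal I R" if "I \<in> J ` \<D>" for I
          using that J by (auto simp: \<D>_def)
      qed
      then obtain K1 where K1: "K1 \<in> \<D>" "\<And>L. L \<in> \<D> \<Longrightarrow> J K1 \<subseteq> J L \<Longrightarrow> J L = J K1"
        by auto
      have "L = K1" if L: "L \<in> \<C>" "K1 \<subseteq> L" for L
      proof (rule equalityI[OF subsetI L(2)])
        have sub: "submodule L R M" "submodule K1 R M" "L \<subseteq> ?H"
          using \<C>(2) L(1) K1(1) unfolding \<D>_def by blast+
        have K1H: "K1 \<inter> H = K0 \<inter> H"
          using K1(1) by (simp add: \<D>_def)
        then have LH: "L \<inter> H = K0 \<inter> H"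
          using L by (intro K0(2)) auto
        then have "L \<in> \<D>"
          using L(1) by (simp add: \<D>_def)
        moreover have "J K1 \<subseteq> J L"
          using L(2) by (auto simp: J_def)
        ultimately have JL: "J L = J K1"
          by (rule K1(2))
        fix y assume y: "y \<in> L"
        then obtain h r where h: "h \<in> H" "r \<in> carrier R" "y = h \<oplus>\<^bsub>M\<^esub> r \<odot>\<^bsub>M\<^esub> x"
          using sub(3) by blast
        then have "r \<in> J L"
          unfolding J_def using y by blast
        then have "r \<in> J K1"
          by (simp add: JL)
        then obtain h' where h': "h' \<in> H" "h' \<oplus>\<^bsub>M\<^esub> r \<odot>\<^bsub>M\<^esub> x \<in> K1"
          by (auto simp: J_def)
        have hc: "h \<in> carrier M" "h' \<in> carrier M" "r \<odot>\<^bsub>M\<^esub> x \<in> carrier M"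
          using h h' HM x by auto
        \<comment> \<open>Two elements with the same coefficient of \<open>x\<close> differ by an
          element of \<open>H\<close>, and \<open>L\<close> and \<open>K1\<close> have the same
          intersection with \<open>H\<close>.\<close>
        have diff: "y \<ominus>\<^bsub>M\<^esub> (h' \<oplus>\<^bsub>M\<^esub> r \<odot>\<^bsub>M\<^esub> x) = h \<ominus>\<^bsub>M\<^esub> h'"
          using hc unfolding h(3) a_minus_def by (simp add: M.minus_add M.a_ac M.r_neg1 M.r_neg2 M.r_neg)
        have "y \<ominus>\<^bsub>M\<^esub> (h' \<oplus>\<^bsub>M\<^esub> r \<odot>\<^bsub>M\<^esub> x) \<in> L"
          using y h'(2) L(2) by (intro M.submodule_minus[OF sub(1)]) auto
        moreover have "h \<ominus>\<^bsub>M\<^esub> h' \<in> H"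
          by (rule M.submodule_minus[OF H(1) h(1) h'(1)])
        ultimately have "h \<ominus>\<^bsub>M\<^esub> h' \<in> K1"
          using diff LH K1H by auto
        then have "(h \<ominus>\<^bsub>M\<^esub> h') \<oplus>\<^bsub>M\<^esub> (h' \<oplus>\<^bsub>M\<^esub> r \<odot>\<^bsub>M\<^esub> x) \<in> K1"
          using h'(2) sub(2) by (simp add: M.submodule_iff)
        moreover have "(h \<ominus>\<^bsub>M\<^esub> h') \<oplus>\<^bsub>M\<^esub> (h' \<oplus>\<^bsub>M\<^esub> r \<odot>\<^bsub>M\<^esub> x) = y"
          unfolding diff[symmetric] using hc h(3) by (intro M.minus_add_cancel(1)) auto
        ultimately show "y \<in> K1"
          by simp
      qed
      then show ?thesis
        using K1(1) unfolding \<D>_def by blast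
    qed
    ultimately show ?case
      by (intro exI[of _ ?H]) simp
  qed
  then obtain H where H: "submodule H R M" "S \<subseteq> H"
    "\<And>\<C>. \<C> \<noteq> {} \<Longrightarrow> (\<And>K. K \<in> \<C> \<Longrightarrow> submodule K R M \<and> K \<subseteq> H) \<Longrightarrow> \<exists>K\<in>\<C>. \<forall>L\<in>\<C>. K \<subseteq> L \<longrightarrow> L = K"
    by metis
  have "H = carrier M"
    by (rule S(3)[OF H(1,2)])
  then show ?thesis
    unfolding noeth_module_def using H(3) M.module_axioms M.submoduleE(1) by simp
qed

subsection \<open>Cohomological dimension and supports\<close>

definition annihilator :: "('a, 'r) ring_scheme \<Rightarrow> ('a, 'b, 'm) module_scheme \<Rightarrow> 'a set" where
  "annihilator R N = {r \<in> carrier R. \<forall>x\<in>carrier N. r \<odot>\<^bsub>N\<^esub> x = \<zero>\<^bsub>N\<^esub>}"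

text \<open>Modulo \<open>H\<close>, the cyclic module generated by \<open>x\<close> is
  \<open>R/q\<close>, and multiplication by \<open>t\<close> maps \<open>D\<close> into it. The case
  \<open>t = \<one>\<close> serves to adjoin a cyclic piece; a \<open>t\<close> outside a prime
  takes the place of localisation.\<close>

lemma cyclic_quotient_map:
  assumes N: "module R N" and H: "submodule H R N" and D: "submodule D R N"
    and x: "x \<in> carrier N" and t: "t \<in> carrier R" and q: "q = {r \<in> carrier R. r \<odot>\<^bsub>N\<^esub> x \<in> H}"
    and cov: "\<And>y. y \<in> D \<Longrightarrow> \<exists>r\<in>carrier R. t \<odot>\<^bsub>N\<^esub> y \<ominus>\<^bsub>N\<^esub> r \<odot>\<^bsub>N\<^esub> x \<in> H"
  shows "\<exists>g. g \<in> mod_hom R (N\<lparr>carrier := D\<rparr>) (quot_module (regular_module R) q) \<and>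
    (\<forall>y\<in>D. \<forall>r\<in>carrier R. t \<odot>\<^bsub>N\<^esub> y \<ominus>\<^bsub>N\<^esub> r \<odot>\<^bsub>N\<^esub> x \<in> H \<longrightarrow> g y = q +>\<^bsub>regular_module R\<^esub> r) \<and>
    (\<forall>y\<in>D. g y = \<zero>\<^bsub>quot_module (regular_module R) q\<^esub> \<longleftrightarrow> t \<odot>\<^bsub>N\<^esub> y \<in> H)"
proof -
  interpret N: module R N by fact
  interpret reg: module R "regular_module R"
    by (rule module_regular[OF N.is_cring])
  have qs: "submodule q R (regular_module R)"
    using N.colon_ideal[OF H x] by (simp add: q submodule_regular_iff N.is_cring)
  let ?c = "\<lambda>y. H +>\<^bsub>N\<^esub> y" and ?k = "\<lambda>r. q +>\<^bsub>regular_module R\<^esub> r" and ?Q = "quot_module N H"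
  let ?Rq = "quot_module (regular_module R) q"
  note Neq = quot_module_coset_eq_iff[OF N H] and Req = quot_module_coset_eq_iff[OF reg.module_axioms qs]
  have DN: "y \<in> carrier N" if "y \<in> D" for y
    using that N.submoduleE(1)[OF D] by blast
  have key: "?c (r \<odot>\<^bsub>N\<^esub> x) = ?c (s \<odot>\<^bsub>N\<^esub> x) \<longleftrightarrow> ?k r = ?k s" if rs: "r \<in> carrier R" "s \<in> carrier R" for r s
  proof -
    have "?c (r \<odot>\<^bsub>N\<^esub> x) = ?c (s \<odot>\<^bsub>N\<^esub> x) \<longleftrightarrow> (r \<ominus>\<^bsub>R\<^esub> s) \<odot>\<^bsub>N\<^esub> x \<in> H"
      using rs x by (simp add: Neq N.smult_l_minus_distr)
    also have "\<dots> \<longleftrightarrow> r \<ominus>\<^bsub>R\<^esub> s \<in> q"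
      using rs by (simp add: q)
    also have "\<dots> \<longleftrightarrow> ?k r = ?k s"
      using rs by (simp add: Req a_minus_def)
    finally show ?thesis .
  qed
  define P where "P y r \<longleftrightarrow> r \<in> carrier R \<and> ?c (t \<odot>\<^bsub>N\<^esub> y) = ?c (r \<odot>\<^bsub>N\<^esub> x)" for y r
  have P_iff: "P y r \<longleftrightarrow> r \<in> carrier R \<and> t \<odot>\<^bsub>N\<^esub> y \<ominus>\<^bsub>N\<^esub> r \<odot>\<^bsub>N\<^esub> x \<in> H" if "y \<in> D" for y r
    using DN[OF that] t x Neq[of "t \<odot>\<^bsub>N\<^esub> y" "r \<odot>\<^bsub>N\<^esub> x"] unfolding P_def
    by (cases "r \<in> carrier R") simp_all
  define g where "g y = ?k (SOME r. P y r)" for y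
  have ex: "\<exists>r. P y r" if "y \<in> D" for y
    using cov[OF that] P_iff[OF that] by blast
  have g: "g y = ?k r" if "y \<in> D" "P y r" for y r
  proof -
    define s where "s = (SOME r. P y r)"
    have "P y s"
      unfolding s_def using that(2) by (rule someI)
    then have "?k s = ?k r"
      using that(2) key[of s r] by (simp add: P_def)
    then show ?thesis
      by (simp add: g_def s_def)
  qed
  have "g \<in> mod_hom R (N\<lparr>carrier := D\<rparr>) ?Rq"
  proof (rule mod_homI)
    show "g y \<in> carrier ?Rq" if "y \<in> carrier (N\<lparr>carrier := D\<rparr>)" for y
      using that ex[of y] g[of y] by (auto simp: quot_module_carrier[OF reg.module_axioms qs] P_def)
    show "g (y \<oplus>\<^bsub>N\<lparr>carrier := D\<rparr>\<^esub> z) = g y \<oplus>\<^bsub>?Rq\<^esub> g z"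
      if yz: "y \<in> carrier (N\<lparr>carrier := D\<rparr>)" "z \<in> carrier (N\<lparr>carrier := D\<rparr>)" for y z
    proof -
      obtain r s where rs: "P y r" "P z s"
        using ex[of y] ex[of z] yz by auto
      have yzD: "y \<in> D" "z \<in> D" "y \<oplus>\<^bsub>N\<^esub> z \<in> D"
        using yz D by (auto simp: N.submodule_iff)
      have "?c (t \<odot>\<^bsub>N\<^esub> (y \<oplus>\<^bsub>N\<^esub> z)) = ?c (t \<odot>\<^bsub>N\<^esub> y) \<oplus>\<^bsub>?Q\<^esub> ?c (t \<odot>\<^bsub>N\<^esub> z)"
        using DN yzD t by (simp add: N.smult_r_distr quot_module_add[OF N H])
      also have "\<dots> = ?c ((r \<oplus>\<^bsub>R\<^esub> s) \<odot>\<^bsub>N\<^esub> x)"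
        using rs x by (simp add: P_def N.smult_l_distr quot_module_add[OF N H])
      finally have "P (y \<oplus>\<^bsub>N\<^esub> z) (r \<oplus>\<^bsub>R\<^esub> s)"
        using rs by (simp add: P_def)
      then show ?thesis
        using g[OF yzD(3)] g[OF yzD(1) rs(1)] g[OF yzD(2) rs(2)] rs
          quot_module_add[OF reg.module_axioms qs, of r s] by (simp add: P_def)
    qed
    show "g (a \<odot>\<^bsub>N\<lparr>carrier := D\<rparr>\<^esub> y) = a \<odot>\<^bsub>?Rq\<^esub> g y"
      if a: "a \<in> carrier R" and y: "y \<in> carrier (N\<lparr>carrier := D\<rparr>)" for a y
    proof -
      obtain r where r: "P y r"
        using ex y by auto
      have yD: "y \<in> D" "a \<odot>\<^bsub>N\<^esub> y \<in> D"
        using y a D by (auto simp: N.submodule_iff)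
      have "?c (t \<odot>\<^bsub>N\<^esub> (a \<odot>\<^bsub>N\<^esub> y)) = a \<odot>\<^bsub>?Q\<^esub> ?c (t \<odot>\<^bsub>N\<^esub> y)"
        using DN[OF yD(1)] t a N.smult_commute[of t a y] by (simp add: quot_module_smult[OF N H])
      also have "\<dots> = ?c ((a \<otimes>\<^bsub>R\<^esub> r) \<odot>\<^bsub>N\<^esub> x)"
        using r x a by (simp add: P_def N.smult_assoc1 quot_module_smult[OF N H])
      finally have "P (a \<odot>\<^bsub>N\<^esub> y) (a \<otimes>\<^bsub>R\<^esub> r)"
        using r a by (simp add: P_def)
      then show ?thesis
        using g[OF yD(2)] g[OF yD(1) r] r a quot_module_smult[OF reg.module_axioms qs, of a r]
        by (simp add: P_def)
    qed
  qed
  moreover have "g y = ?k r" if "y \<in> D" "r \<in> carrier R" "t \<odot>\<^bsub>N\<^esub> y \<ominus>\<^bsub>N\<^esub> r \<odot>\<^bsub>N\<^esub> x \<in> H" for y r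
    using g[OF that(1)] P_iff[OF that(1)] that by blast
  moreover have "g y = \<zero>\<^bsub>?Rq\<^esub> \<longleftrightarrow> t \<odot>\<^bsub>N\<^esub> y \<in> H" if y: "y \<in> D" for y
  proof -
    obtain r where r: "P y r"
      using ex[OF y] by blast
    have zero: "\<zero>\<^bsub>?Rq\<^esub> = ?k \<zero>\<^bsub>R\<^esub>"
      using quot_module_zero[OF reg.module_axioms qs] by simp
    have "g y = \<zero>\<^bsub>?Rq\<^esub> \<longleftrightarrow> ?c (r \<odot>\<^bsub>N\<^esub> x) = ?c (\<zero>\<^bsub>R\<^esub> \<odot>\<^bsub>N\<^esub> x)"
      using r unfolding zero g[OF y r] by (subst key) (auto simp: P_def)
    also have "\<dots> \<longleftrightarrow> ?c (t \<odot>\<^bsub>N\<^esub> y) = ?c \<zero>\<^bsub>N\<^esub>"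
      using r x by (simp add: P_def)
    also have "\<dots> \<longleftrightarrow> t \<odot>\<^bsub>N\<^esub> y \<in> H"
      using DN[OF y] t by (subst Neq) (auto simp: N.minus_zero_right)
    finally show ?thesis .
  qed
  ultimately show ?thesis
    by blast
qed

lemma short_exact_quot:
  assumes B: "module R B" and A: "submodule A R B"
  shows "short_exact R (B\<lparr>carrier := A\<rparr>) (\<lambda>x. x) B (\<lambda>x. A +>\<^bsub>B\<^esub> x) (quot_module B A)"
  unfolding short_exact_def
  using submodule.submodule_is_module[OF A B] B module_quot[OF B A] mod_hom_inclusion[OF A B]
    mod_hom_quot[OF B A] quot_module_carrier[OF B A] quot_module_coset_eq_zero_iff[OF B A]
  by (auto simp: inj_on_def)

lemma short_exact_image:
  assumes B: "module R B" and Q: "module R Q" and f: "f \<in> mod_hom R B Q"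
    and A: "submodule A R B" "\<And>b. b \<in> carrier B \<Longrightarrow> f b = \<zero>\<^bsub>Q\<^esub> \<longleftrightarrow> b \<in> A"
  shows "short_exact R (B\<lparr>carrier := A\<rparr>) (\<lambda>x. x) B f (Q\<lparr>carrier := f ` carrier B\<rparr>)"
proof -
  have "f \<in> mod_hom R B (Q\<lparr>carrier := f ` carrier B\<rparr>)"
    using mod_homD[OF f] by (intro mod_homI) auto
  then show ?thesis
    unfolding short_exact_def
    using submodule.submodule_is_module[OF A(1) B] B mod_hom_inclusion[OF A(1) B] A(2)
      submodule.submodule_is_module[OF mod_hom_image_submodule[OF B Q f] Q]
    by (auto simp: inj_on_def)
qed

context
  fixes R :: "('a, 'r) ring_scheme" and \<aa> :: "'a set"
  assumes R: "cring R" and noeth: "noetherian_ring R" and \<aa>: "ideal \<aa> R"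
begin

interpretation R: cring R by (rule R)
interpretation Rn: noetherian_ring R by (rule noeth)
interpretation reg: module R "regular_module R" by (rule module_regular[OF R])

text \<open>The constant complex of one-element modules over \<open>unit\<close> is a resolution,
  and all its elements are zero.\<close>

lemma lc_vanishes_zero:
  assumes N: "module R N" "carrier N = {\<zero>\<^bsub>N\<^esub>}"
  shows "lc_vanishes R \<aa> i N"
proof -
  define U :: "('a, unit) module" where
    "U = \<lparr>carrier = UNIV, monoid.mult = undefined, one = undefined, zero = (), add = (\<lambda>_ _. ()),
      smult = (\<lambda>_ _. ())\<rparr>"
  have "module R U"
    by (rule moduleI'[OF R]) (auto simp: U_def)
  then have "baer R U"
    unfolding baer_def by (auto simp: U_def)
  then have res: "baer_resolution R N (\<lambda>_. U) (\<lambda>_. ()) (\<lambda>_ _. ())"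
    unfolding baer_resolution_def using N by (auto intro!: mod_homI simp: U_def)
  have "\<zero>\<^bsub>U\<^esub> \<in> torsion_part R \<aa> U"
    using torsion_part_submodule[OF R \<aa> \<open>module R U\<close>] module.submodule_iff[OF \<open>module R U\<close>] by blast
  then show ?thesis
    unfolding lc_vanishes_iff[OF R \<aa> res] torsion_exact_def by (auto split: nat.split)
qed

text \<open>
  A maximal submodule with vanishing cohomology is everything: otherwise it could be enlarged by a
  copy of \<open>R/q\<close>, where \<open>q\<close> is an associated prime of the quotient.
\<close>

lemma lc_vanishes_of_primes:
  assumes N: "noeth_module R N"
    and van: "\<And>q. primeideal q R \<Longrightarrow> annihilator R N \<subseteq> q \<Longrightarrow>
           lc_vanishes R \<aa> k (quot_module (regular_module R) q)"
  shows "lc_vanishes R \<aa> k N"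
proof -
  interpret N: module R N using N by (rule noeth_moduleD)
  define \<C> where "\<C> = {H. submodule H R N \<and> lc_vanishes R \<aa> k (N\<lparr>carrier := H\<rparr>)}"
  have "{\<zero>\<^bsub>N\<^esub>} \<in> \<C>"
    using submodule.submodule_is_module[OF N.zero_submodule N.module_axioms]
    by (auto simp: \<C>_def N.zero_submodule intro!: lc_vanishes_zero)
  then have "\<exists>H\<in>\<C>. \<forall>K\<in>\<C>. H \<subseteq> K \<longrightarrow> K = H"
    by (intro noeth_moduleD(2)[OF N]) (auto simp: \<C>_def)
  then obtain H where "H \<in> \<C>" and max: "\<And>K. K \<in> \<C> \<Longrightarrow> H \<subseteq> K \<Longrightarrow> K = H"
    by blast
  then have H: "submodule H R N" and vanH: "lc_vanishes R \<aa> k (N\<lparr>carrier := H\<rparr>)"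
    by (auto simp: \<C>_def)
  have HN: "H \<subseteq> carrier N" "\<zero>\<^bsub>N\<^esub> \<in> H"
    using H by (auto simp: N.submodule_iff)
  define I where "I x = {r \<in> carrier R. r \<odot>\<^bsub>N\<^esub> x \<in> H}" for x
  have "H = carrier N"
  proof (rule ccontr)
    assume "H \<noteq> carrier N"
    then have "I ` (carrier N - H) \<noteq> {}"
      using HN by blast
    moreover have "ideal J R" if "J \<in> I ` (carrier N - H)" for J
      using that N.colon_ideal[OF H] unfolding I_def by blast
    ultimately have "\<exists>J\<in>I ` (carrier N - H). \<forall>J'\<in>I ` (carrier N - H). J \<subseteq> J' \<longrightarrow> J' = J"
      by (rule Rn.ideals_maximal)
    then obtain x where x: "x \<in> carrier N" "x \<notin> H"
      and maxI: "\<And>y. y \<in> carrier N \<Longrightarrow> y \<notin> H \<Longrightarrow> I x \<subseteq> I y \<Longrightarrow> I y = I x"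
      by auto
    let ?q = "I x"
    \<comment> \<open>A colon ideal \<open>I x\<close> that is maximal for \<open>x\<close> outside
      \<open>H\<close> is prime: if \<open>b\<close> is not in it, \<open>b x\<close> is again
      outside \<open>H\<close>, so \<open>I (b x)\<close>, which contains \<open>I x\<close>, equals
      it.\<close>
    have q_prime: "primeideal ?q R"
    proof (rule primeidealI)
      show "ideal ?q R"
        unfolding I_def by (rule N.colon_ideal[OF H x(1)])
      show "cring R" by (rule R)
      have "\<one>\<^bsub>R\<^esub> \<notin> ?q"
        using x by (simp add: I_def)
      then show "carrier R \<noteq> ?q"
        by auto
      fix a b assume ab: "a \<in> carrier R" "b \<in> carrier R" "a \<otimes>\<^bsub>R\<^esub> b \<in> ?q"
      show "a \<in> ?q \<or> b \<in> ?q"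
      proof (rule disjCI)
        assume "b \<notin> ?q"
        then have bx: "b \<odot>\<^bsub>N\<^esub> x \<notin> H"
          using ab by (simp add: I_def)
        have "I x \<subseteq> I (b \<odot>\<^bsub>N\<^esub> x)"
        proof
          fix r assume r: "r \<in> I x"
          then have "b \<odot>\<^bsub>N\<^esub> (r \<odot>\<^bsub>N\<^esub> x) \<in> H"
            using ab(2) H by (auto simp: I_def N.submodule_iff)
          then show "r \<in> I (b \<odot>\<^bsub>N\<^esub> x)"
            using r ab(2) x(1) N.smult_commute[of b r x] by (simp add: I_def)
        qed
        then have "I (b \<odot>\<^bsub>N\<^esub> x) = I x"
          using ab(2) x(1) bx by (intro maxI) auto
        moreover have "a \<in> I (b \<odot>\<^bsub>N\<^esub> x)"
          using ab x(1) by (simp add: I_def N.smult_assoc1)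
        ultimately show "a \<in> ?q"
          by simp
      qed
    qed
    have "annihilator R N \<subseteq> ?q"
      using x(1) HN by (auto simp: annihilator_def I_def)
    then have vanq: "lc_vanishes R \<aa> k (quot_module (regular_module R) ?q)"
      by (rule van[OF q_prime])
    have qs: "submodule ?q R (regular_module R)"
      using q_prime by (simp add: submodule_regular_iff R primeideal_def)
    define H' where "H' = {u \<oplus>\<^bsub>N\<^esub> v |u v. u \<in> H \<and> v \<in> {r \<odot>\<^bsub>N\<^esub> x |r. r \<in> carrier R}}"
    have H': "submodule H' R N"
      unfolding H'_def by (intro N.submodule_add H N.cyclic_submodule x)
    have H'N: "H' \<subseteq> carrier N"
      by (rule N.submoduleE(1)[OF H'])
    have rx: "r \<odot>\<^bsub>N\<^esub> x \<in> H'" if "r \<in> carrier R" for r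
    proof -
      have "r \<odot>\<^bsub>N\<^esub> x = \<zero>\<^bsub>N\<^esub> \<oplus>\<^bsub>N\<^esub> r \<odot>\<^bsub>N\<^esub> x"
        using that x(1) by simp
      then show ?thesis
        unfolding H'_def using HN(2) that by blast
    qed
    have HH': "H \<subseteq> H'"
    proof
      fix u assume u: "u \<in> H"
      then have "u = u \<oplus>\<^bsub>N\<^esub> \<zero>\<^bsub>R\<^esub> \<odot>\<^bsub>N\<^esub> x"
        using HN x(1) by auto
      then show "u \<in> H'"
        unfolding H'_def using u R.zero_closed by blast
    qed
    have cov: "\<exists>r\<in>carrier R. \<one>\<^bsub>R\<^esub> \<odot>\<^bsub>N\<^esub> y \<ominus>\<^bsub>N\<^esub> r \<odot>\<^bsub>N\<^esub> x \<in> H" if y: "y \<in> H'" for y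
    proof -
      obtain u r where ur: "u \<in> H" "r \<in> carrier R" "y = u \<oplus>\<^bsub>N\<^esub> r \<odot>\<^bsub>N\<^esub> x"
        using y unfolding H'_def by blast
      then have "y \<ominus>\<^bsub>N\<^esub> r \<odot>\<^bsub>N\<^esub> x = u"
        using HN x(1) by (simp add: N.minus_add_cancel subset_iff)
      then show ?thesis
        using ur y H'N by (intro bexI[of _ r]) auto
    qed
    let ?Rq = "quot_module (regular_module R) ?q"
    \<comment> \<open>Here \<open>t = \<one>\<close>, and the map identifies \<open>H'/H\<close>
      with \<open>R/q\<close>.\<close>
    obtain g where g: "g \<in> mod_hom R (N\<lparr>carrier := H'\<rparr>) ?Rq"
      "\<And>y r. y \<in> H' \<Longrightarrow> r \<in> carrier R \<Longrightarrow> \<one>\<^bsub>R\<^esub> \<odot>\<^bsub>N\<^esub> y \<ominus>\<^bsub>N\<^esub> r \<odot>\<^bsub>N\<^esub> x \<in> H \<Longrightarrow>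
         g y = ?q +>\<^bsub>regular_module R\<^esub> r"
      "\<And>y. y \<in> H' \<Longrightarrow> g y = \<zero>\<^bsub>?Rq\<^esub> \<longleftrightarrow> \<one>\<^bsub>R\<^esub> \<odot>\<^bsub>N\<^esub> y \<in> H"
      using cyclic_quotient_map[OF N.module_axioms H H' x(1) R.one_closed I_def cov] by metis
    have "short_exact R (N\<lparr>carrier := H\<rparr>) (\<lambda>x. x) (N\<lparr>carrier := H'\<rparr>) g ?Rq"
      unfolding short_exact_def
    proof (intro conjI)
      show "module R (N\<lparr>carrier := H\<rparr>)" "module R (N\<lparr>carrier := H'\<rparr>)" "module R ?Rq"
        using submodule.submodule_is_module[OF H N.module_axioms]
          submodule.submodule_is_module[OF H' N.module_axioms] module_quot[OF reg.module_axioms qs] by auto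
      show "(\<lambda>x. x) \<in> mod_hom R (N\<lparr>carrier := H\<rparr>) (N\<lparr>carrier := H'\<rparr>)"
        using HH' by (intro mod_homI) auto
      show "g ` carrier (N\<lparr>carrier := H'\<rparr>) = carrier ?Rq"
      proof (intro equalityI subsetI)
        fix y assume "y \<in> g ` carrier (N\<lparr>carrier := H'\<rparr>)"
        then show "y \<in> carrier ?Rq"
          using mod_homD(1)[OF g(1)] by blast
      next
        fix y assume "y \<in> carrier ?Rq"
        then obtain r where r: "r \<in> carrier R" "y = ?q +>\<^bsub>regular_module R\<^esub> r"
          unfolding quot_module_carrier[OF reg.module_axioms qs] by auto
        have "g (r \<odot>\<^bsub>N\<^esub> x) = y"
          unfolding r(2) using r(1) x(1) HN(2) by (intro g(2) rx) (auto simp: a_minus_def N.r_neg)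
        then show "y \<in> g ` carrier (N\<lparr>carrier := H'\<rparr>)"
          using rx[OF r(1)] by auto
      qed
      show "\<forall>b\<in>carrier (N\<lparr>carrier := H'\<rparr>). g b = \<zero>\<^bsub>?Rq\<^esub> \<longleftrightarrow> b \<in> (\<lambda>x. x) ` carrier (N\<lparr>carrier := H\<rparr>)"
        using g(3) H'N by (auto simp: subset_iff)
    qed (use g(1) in \<open>auto simp: inj_on_def\<close>)
    then have "lc_vanishes R \<aa> k (N\<lparr>carrier := H'\<rparr>)"
      by (rule lc_vanishes_short_exact(1)[OF R \<aa> _ vanH vanq])
    then have "H' = H"
      using H' HH' by (intro max) (auto simp: \<C>_def)
    then show False
      using rx[OF R.one_closed] x by simp
  qed
  then show ?thesis
    using vanH by simp
qed

lemma annihilator_quot_regular: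
  assumes "ideal q R"
  shows "annihilator R (quot_module (regular_module R) q) = q"
proof -
  have qs: "submodule q R (regular_module R)"
    using assms by (simp add: submodule_regular_iff R)
  note quot = quot_module_carrier[OF reg.module_axioms qs] quot_module_smult[OF reg.module_axioms qs]
    quot_module_coset_eq_zero_iff[OF reg.module_axioms qs]
  interpret q: ideal q R by fact
  have "r \<odot>\<^bsub>quot_module (regular_module R) q\<^esub> (q +>\<^bsub>regular_module R\<^esub> s) =
      \<zero>\<^bsub>quot_module (regular_module R) q\<^esub> \<longleftrightarrow> r \<otimes>\<^bsub>R\<^esub> s \<in> q" if "r \<in> carrier R" "s \<in> carrier R" for r s
    using that quot(2)[of r s] quot(3)[of "r \<otimes>\<^bsub>R\<^esub> s"] by simp
  then have "r \<in> annihilator R (quot_module (regular_module R) q) \<longleftrightarrow>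
      r \<in> carrier R \<and> (\<forall>s\<in>carrier R. r \<otimes>\<^bsub>R\<^esub> s \<in> q)" for r
    unfolding annihilator_def quot(1) by (cases "r \<in> carrier R") simp_all
  moreover have "r \<in> carrier R \<and> (\<forall>s\<in>carrier R. r \<otimes>\<^bsub>R\<^esub> s \<in> q) \<longleftrightarrow> r \<in> q" for r
    using q.I_r_closed q.a_Hcarr by (metis R.one_closed R.r_one)
  ultimately show ?thesis
    by blast
qed

lemma noeth_quot_regular:
  assumes "ideal q R"
  shows "noeth_module R (quot_module (regular_module R) q)"
proof -
  have qs: "submodule q R (regular_module R)"
    using assms by (simp add: submodule_regular_iff R)
  show ?thesis
    by (rule noeth_module_image[OF noeth_module_regular[OF R noeth] module_quot[OF reg.module_axioms qs]
          mod_hom_quot[OF reg.module_axioms qs] quot_module_carrier[OF reg.module_axioms qs, symmetric]])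
qed

text \<open>
  Descending induction on \<open>k\<close>, starting from the vanishing in large degrees, and Noetherian induction
  on \<open>q\<close>. If \<open>L'\<close> is maximal among the submodules such that \<open>q\<close> contains the annihilator of \<open>L/L'\<close>,
  then \<open>L/L'\<close> embeds in \<open>R/q\<close> with a cokernel that is supported on primes strictly larger than \<open>q\<close>.
\<close>

lemma lc_vanishes_quot_prime:
  fixes L :: "('a, 'b, 'm) module_scheme"
  assumes L: "noeth_module R L" and van: "\<And>k. k > i \<Longrightarrow> lc_vanishes R \<aa> k L"
    and q: "primeideal q R" "annihilator R L \<subseteq> q" and k: "k > i"
  shows "lc_vanishes R \<aa> k (quot_module (regular_module R) q)"
proof -
  interpret L: module R L using L by (rule noeth_moduleD)
  let ?RQ = "\<lambda>q. quot_module (regular_module R) q"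
  have sub_regular: "submodule p R (regular_module R)" if "primeideal p R" for p
    using that by (simp add: submodule_regular_iff R primeideal_def)
  obtain S where S: "S \<subseteq> carrier R" "finite S" "\<aa> = Idl\<^bsub>R\<^esub> S"
    using Rn.finetely_gen[OF \<aa>] by blast
  show ?thesis
    using q k
  \<comment> \<open>The measure is 0 exactly when \<open>k\<close> exceeds the number of generators;
    otherwise the induction hypothesis concerns degree \<open>k + 1\<close>, for all primes at
    once.\<close>
  proof (induction "Suc (card S) - k" arbitrary: k q)
    case 0
    then show ?case
      using S by (intro lc_vanishes_large[OF R noeth module_quot[OF reg.module_axioms sub_regular]]) auto
  next
    case (Suc m)
    have IH: "lc_vanishes R \<aa> (Suc k) (?RQ p)" if "primeideal p R" "annihilator R L \<subseteq> p" for p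
      using Suc.hyps(1)[of "Suc k" p] Suc.hyps(2) Suc.prems(3) that by simp
    have vanL: "lc_vanishes R \<aa> k L"
      using Suc.prems(3) by (rule van)
    \<comment> \<open>For a maximal member \<open>p\<close>, all strictly larger primes satisfy the
      claim in the same degree \<open>k\<close>.\<close>
    define Bad where "Bad = {p. primeideal p R \<and> annihilator R L \<subseteq> p \<and> \<not> lc_vanishes R \<aa> k (?RQ p)}"
    have "Bad = {}"
    proof (rule ccontr)
      assume "Bad \<noteq> {}"
      then have "\<exists>p\<in>Bad. \<forall>J\<in>Bad. p \<subseteq> J \<longrightarrow> J = p"
        by (intro Rn.ideals_maximal) (auto simp: Bad_def primeideal_def)
      then obtain p where pBad: "p \<in> Bad" and pmax: "\<And>J. J \<in> Bad \<Longrightarrow> p \<subseteq> J \<Longrightarrow> J = p"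
        by blast
      have p: "primeideal p R" "annihilator R L \<subseteq> p" "\<not> lc_vanishes R \<aa> k (?RQ p)"
        using pBad by (auto simp: Bad_def)
      interpret p: primeideal p R by (rule p(1))
      have one: "\<one>\<^bsub>R\<^esub> \<notin> p"
        using p.I_notcarr p.one_imp_carrier by blast
      \<comment> \<open>Submodules \<open>K\<close> such that \<open>p\<close> contains the
        annihilator of \<open>L/K\<close>; this expresses, without localising, that \<open>p\<close>
        lies in the support of \<open>L/K\<close>.\<close>
      define \<C> where "\<C> = {K. submodule K R L \<and> (\<forall>r\<in>carrier R. (\<forall>y\<in>carrier L. r \<odot>\<^bsub>L\<^esub> y \<in> K) \<longrightarrow> r \<in> p)}"
      have "{\<zero>\<^bsub>L\<^esub>} \<in> \<C>"
        using p(2) L.zero_submodule by (auto simp: \<C>_def annihilator_def)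
      then have "\<exists>K\<in>\<C>. \<forall>K'\<in>\<C>. K \<subseteq> K' \<longrightarrow> K' = K"
        by (intro noeth_moduleD(2)[OF L]) (auto simp: \<C>_def)
      then obtain L' where L'C: "L' \<in> \<C>" and max: "\<And>K. K \<in> \<C> \<Longrightarrow> L' \<subseteq> K \<Longrightarrow> K = L'"
        by blast
      have L': "submodule L' R L" and L'p: "\<And>r. r \<in> carrier R \<Longrightarrow> (\<And>y. y \<in> carrier L \<Longrightarrow> r \<odot>\<^bsub>L\<^esub> y \<in> L') \<Longrightarrow> r \<in> p"
        using L'C by (auto simp: \<C>_def)
      have L'L: "L' \<subseteq> carrier L" "\<zero>\<^bsub>L\<^esub> \<in> L'"
        using L' by (auto simp: L.submodule_iff)
      have F1: "\<exists>t\<in>carrier R. t \<notin> p \<and> (\<forall>y\<in>carrier L. t \<odot>\<^bsub>L\<^esub> y \<in> K)"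
        if "submodule K R L" "L' \<subseteq> K" "K \<noteq> L'" for K
        using max[of K] that unfolding \<C>_def by blast
      \<comment> \<open>Elements outside \<open>p\<close> act injectively on \<open>L/L'\<close>:
        otherwise the preimage \<open>K\<close> of \<open>L'\<close> under \<open>s\<close> is
        larger, so some \<open>t\<close> outside \<open>p\<close> maps \<open>L\<close> into
        \<open>K\<close>, and \<open>s t\<close> maps \<open>L\<close> into \<open>L'\<close>
        although it is outside \<open>p\<close>.\<close>
      have F2: "y \<in> L'" if s: "s \<in> carrier R" "s \<notin> p" and y: "y \<in> carrier L" "s \<odot>\<^bsub>L\<^esub> y \<in> L'" for s y
      proof (rule ccontr)
        assume "y \<notin> L'"
        define K where "K = {y \<in> carrier L. s \<odot>\<^bsub>L\<^esub> y \<in> L'}"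
        have "submodule K R L"
          using L' s(1) unfolding L.submodule_iff K_def
          by (auto simp: L.smult_r_distr L.smult_commute[of s])
        moreover have "L' \<subseteq> K"
          using L' s(1) unfolding L.submodule_iff K_def by auto
        moreover have "K \<noteq> L'"
          using \<open>y \<notin> L'\<close> y by (auto simp: K_def)
        ultimately obtain t where t: "t \<in> carrier R" "t \<notin> p" "\<forall>y\<in>carrier L. t \<odot>\<^bsub>L\<^esub> y \<in> K"
          using F1 by blast
        have "s \<otimes>\<^bsub>R\<^esub> t \<in> p"
          using t s by (intro L'p) (auto simp: K_def L.smult_assoc1)
        then show False
          using p.I_prime[of s t] s t by blast
      qed
      have "L' \<noteq> carrier L"
        using L'p[of "\<one>\<^bsub>R\<^esub>"] one by auto
      then obtain x where x: "x \<in> carrier L" "x \<notin> L'"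
        using L'L by blast
      define K where "K = {u \<oplus>\<^bsub>L\<^esub> v |u v. u \<in> L' \<and> v \<in> {r \<odot>\<^bsub>L\<^esub> x |r. r \<in> carrier R}}"
      have "submodule K R L"
        unfolding K_def by (intro L.submodule_add L' L.cyclic_submodule x)
      moreover have "L' \<subseteq> K"
      proof
        fix u assume u: "u \<in> L'"
        then have "u = u \<oplus>\<^bsub>L\<^esub> \<zero>\<^bsub>R\<^esub> \<odot>\<^bsub>L\<^esub> x"
          using L'L x(1) by auto
        then show "u \<in> K"
          unfolding K_def using u R.zero_closed by blast
      qed
      moreover have "x \<in> K"
      proof -
        have "x = \<zero>\<^bsub>L\<^esub> \<oplus>\<^bsub>L\<^esub> \<one>\<^bsub>R\<^esub> \<odot>\<^bsub>L\<^esub> x"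
          using x(1) by simp
        then show ?thesis
          unfolding K_def using L'L(2) R.one_closed by blast
      qed
      \<comment> \<open>Up to the factor \<open>t\<close>, which is outside \<open>p\<close>, the
        quotient \<open>L/L'\<close> is cyclic with generator \<open>x\<close>.\<close>
      ultimately obtain t where t: "t \<in> carrier R" "t \<notin> p" "\<And>y. y \<in> carrier L \<Longrightarrow> t \<odot>\<^bsub>L\<^esub> y \<in> K"
        using F1[of K] x(2) by blast
      have cov: "\<exists>r\<in>carrier R. t \<odot>\<^bsub>L\<^esub> y \<ominus>\<^bsub>L\<^esub> r \<odot>\<^bsub>L\<^esub> x \<in> L'" if y: "y \<in> carrier L" for y
      proof -
        obtain u r where ur: "u \<in> L'" "r \<in> carrier R" "t \<odot>\<^bsub>L\<^esub> y = u \<oplus>\<^bsub>L\<^esub> r \<odot>\<^bsub>L\<^esub> x"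
          using t(3)[OF y] unfolding K_def by blast
        then have "t \<odot>\<^bsub>L\<^esub> y \<ominus>\<^bsub>L\<^esub> r \<odot>\<^bsub>L\<^esub> x = u"
          using L'L x(1) by (simp add: L.minus_add_cancel subset_iff)
        then show ?thesis
          using ur by blast
      qed
      \<comment> \<open>A Nakayama-type argument: if \<open>a L\<close> is not inside
        \<open>L'\<close>, then \<open>s x \<in> L' + a L\<close> for some \<open>s\<close> outside
        \<open>p\<close>. Expressing \<open>t z\<close> through \<open>x\<close> shows that
        \<open>t s - a r\<close> sends \<open>x\<close> into \<open>L'\<close>; this element is
        outside \<open>p\<close>, contradicting \<open>F2\<close>.\<close>
      have F3: "a \<odot>\<^bsub>L\<^esub> y \<in> L'" if a: "a \<in> p" and y: "y \<in> carrier L" for a y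
      proof (rule ccontr)
        assume ay: "a \<odot>\<^bsub>L\<^esub> y \<notin> L'"
        have aR: "a \<in> carrier R"
          using a p.a_Hcarr by blast
        have "(\<lambda>z. a \<odot>\<^bsub>L\<^esub> z) \<in> mod_hom R L L"
          using aR by (intro mod_homI) (auto simp: L.smult_r_distr L.smult_commute)
        then have aL: "submodule ((\<lambda>z. a \<odot>\<^bsub>L\<^esub> z) ` carrier L) R L"
          by (rule mod_hom_image_submodule[OF L.module_axioms L.module_axioms])
        define K' where "K' = {u \<oplus>\<^bsub>L\<^esub> v |u v. u \<in> L' \<and> v \<in> (\<lambda>z. a \<odot>\<^bsub>L\<^esub> z) ` carrier L}"
        have "submodule K' R L"
          unfolding K'_def by (intro L.submodule_add L' aL)
        moreover have "L' \<subseteq> K'"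
        proof
          fix u assume u: "u \<in> L'"
          then have "u = u \<oplus>\<^bsub>L\<^esub> a \<odot>\<^bsub>L\<^esub> \<zero>\<^bsub>L\<^esub>"
            using L'L aR by auto
          then show "u \<in> K'"
            unfolding K'_def using u L.M.zero_closed by blast
        qed
        moreover have "a \<odot>\<^bsub>L\<^esub> y \<in> K'"
        proof -
          have "a \<odot>\<^bsub>L\<^esub> y = \<zero>\<^bsub>L\<^esub> \<oplus>\<^bsub>L\<^esub> a \<odot>\<^bsub>L\<^esub> y"
            using aR y by simp
          then show ?thesis
            unfolding K'_def using L'L(2) y by blast
        qed
        ultimately obtain s where s: "s \<in> carrier R" "s \<notin> p" "\<forall>y\<in>carrier L. s \<odot>\<^bsub>L\<^esub> y \<in> K'"
          using F1[of K'] ay by blast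
        then obtain u z where uz: "u \<in> L'" "z \<in> carrier L" "s \<odot>\<^bsub>L\<^esub> x = u \<oplus>\<^bsub>L\<^esub> a \<odot>\<^bsub>L\<^esub> z"
          using x(1) unfolding K'_def by blast
        obtain r where r: "r \<in> carrier R" "t \<odot>\<^bsub>L\<^esub> z \<ominus>\<^bsub>L\<^esub> r \<odot>\<^bsub>L\<^esub> x \<in> L'"
          using cov[OF uz(2)] by blast
        define w where "w = t \<odot>\<^bsub>L\<^esub> z \<ominus>\<^bsub>L\<^esub> r \<odot>\<^bsub>L\<^esub> x"
        have w: "w \<in> carrier L" "t \<odot>\<^bsub>L\<^esub> z = w \<oplus>\<^bsub>L\<^esub> r \<odot>\<^bsub>L\<^esub> x"
          unfolding w_def using t r x uz by (simp_all add: L.minus_add_cancel)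
        have uc: "u \<in> carrier L"
          using uz(1) L'L by blast
        have "t \<odot>\<^bsub>L\<^esub> (s \<odot>\<^bsub>L\<^esub> x) = t \<odot>\<^bsub>L\<^esub> u \<oplus>\<^bsub>L\<^esub> a \<odot>\<^bsub>L\<^esub> (t \<odot>\<^bsub>L\<^esub> z)"
          using uz t(1) aR uc by (simp add: L.smult_r_distr L.smult_commute[of t a])
        also have "\<dots> = (t \<odot>\<^bsub>L\<^esub> u \<oplus>\<^bsub>L\<^esub> a \<odot>\<^bsub>L\<^esub> w) \<oplus>\<^bsub>L\<^esub> a \<odot>\<^bsub>L\<^esub> (r \<odot>\<^bsub>L\<^esub> x)"
          using w aR t(1) uc r(1) x(1) by (simp add: L.smult_r_distr L.M.a_assoc)
        finally have "(t \<otimes>\<^bsub>R\<^esub> s \<ominus>\<^bsub>R\<^esub> a \<otimes>\<^bsub>R\<^esub> r) \<odot>\<^bsub>L\<^esub> x = t \<odot>\<^bsub>L\<^esub> u \<oplus>\<^bsub>L\<^esub> a \<odot>\<^bsub>L\<^esub> w"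
          using aR t(1) uc r(1) x(1) s(1) w(1)
          by (simp add: L.smult_l_minus_distr L.smult_assoc1 L.minus_add_cancel)
        also have "\<dots> \<in> L'"
          using L' t(1) aR uz(1) r(2) unfolding L.submodule_iff w_def by blast
        finally have "(t \<otimes>\<^bsub>R\<^esub> s \<ominus>\<^bsub>R\<^esub> a \<otimes>\<^bsub>R\<^esub> r) \<odot>\<^bsub>L\<^esub> x \<in> L'" .
        moreover have "t \<otimes>\<^bsub>R\<^esub> s \<ominus>\<^bsub>R\<^esub> a \<otimes>\<^bsub>R\<^esub> r \<notin> p"
        proof
          assume "t \<otimes>\<^bsub>R\<^esub> s \<ominus>\<^bsub>R\<^esub> a \<otimes>\<^bsub>R\<^esub> r \<in> p"
          moreover have "a \<otimes>\<^bsub>R\<^esub> r \<in> p"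
            using a r(1) by (rule p.I_r_closed)
          ultimately have "(t \<otimes>\<^bsub>R\<^esub> s \<ominus>\<^bsub>R\<^esub> a \<otimes>\<^bsub>R\<^esub> r) \<oplus>\<^bsub>R\<^esub> a \<otimes>\<^bsub>R\<^esub> r \<in> p"
            by (rule p.a_closed)
          then have "t \<otimes>\<^bsub>R\<^esub> s \<in> p"
            using t(1) s(1) aR r(1) by (simp add: R.minus_add_cancel)
          then show False
            using p.I_prime[of t s] t s by blast
        qed
        ultimately show False
          using F2[of "t \<otimes>\<^bsub>R\<^esub> s \<ominus>\<^bsub>R\<^esub> a \<otimes>\<^bsub>R\<^esub> r" x] x aR t(1) s(1) r(1) by simp
      qed
      \<comment> \<open>By \<open>F2\<close> and \<open>F3\<close> the colon ideal of
        \<open>x\<close> is exactly \<open>p\<close>, so \<open>cyclic_quotient_map\<close> lands in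
        \<open>R/p\<close>.\<close>
      have pq: "p = {r \<in> carrier R. r \<odot>\<^bsub>L\<^esub> x \<in> L'}"
        using F2 F3 x p.a_Hcarr by blast
      note ps = sub_regular[OF p(1)]
      note RP = module_quot[OF reg.module_axioms ps]
      interpret RP: module R "?RQ p" by (rule RP)
      have eqL: "L\<lparr>carrier := carrier L\<rparr> = L"
        by simp
      obtain g where g: "g \<in> mod_hom R L (?RQ p)"
        "\<And>y r. y \<in> carrier L \<Longrightarrow> r \<in> carrier R \<Longrightarrow> t \<odot>\<^bsub>L\<^esub> y \<ominus>\<^bsub>L\<^esub> r \<odot>\<^bsub>L\<^esub> x \<in> L' \<Longrightarrow>
           g y = p +>\<^bsub>regular_module R\<^esub> r"
        "\<And>y. y \<in> carrier L \<Longrightarrow> g y = \<zero>\<^bsub>?RQ p\<^esub> \<longleftrightarrow> t \<odot>\<^bsub>L\<^esub> y \<in> L'"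
        using cyclic_quotient_map[OF L.module_axioms L' L.carrier_is_submodule x(1) t(1) pq cov]
        unfolding eqL by metis
      define Im where "Im = g ` carrier L"
      have Im: "submodule Im R (?RQ p)"
        unfolding Im_def by (rule mod_hom_image_submodule[OF L.module_axioms RP g(1)])
      have "g y = \<zero>\<^bsub>?RQ p\<^esub> \<longleftrightarrow> y \<in> L'" if y: "y \<in> carrier L" for y
        using g(3)[OF y] F2[OF t(1,2) y] submodule.smult_closed[OF L' t(1)] by blast
      then have ex1: "short_exact R (L\<lparr>carrier := L'\<rparr>) (\<lambda>x. x) L g ((?RQ p)\<lparr>carrier := Im\<rparr>)"
        unfolding Im_def by (intro short_exact_image L.module_axioms RP g(1) L')
      \<comment> \<open>Here degree \<open>k + 1\<close> enters: a prime containing the annihilator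
        of \<open>L'\<close> contains that of \<open>L\<close>, so the induction hypothesis covers
        it.\<close>
      have "lc_vanishes R \<aa> (Suc k) (L\<lparr>carrier := L'\<rparr>)"
      proof (rule lc_vanishes_of_primes[OF noeth_module_submodule[OF L L']])
        show "lc_vanishes R \<aa> (Suc k) (?RQ q)"
          if "primeideal q R" "annihilator R (L\<lparr>carrier := L'\<rparr>) \<subseteq> q" for q
          using that L'L by (intro IH) (auto simp: annihilator_def)
      qed
      then have vanIm: "lc_vanishes R \<aa> k ((?RQ p)\<lparr>carrier := Im\<rparr>)"
        by (rule lc_vanishes_short_exact(2)[OF R \<aa> ex1 vanL])
      note ex2 = short_exact_quot[OF RP Im]
      have "lc_vanishes R \<aa> k (quot_module (?RQ p) Im)"
      proof (rule lc_vanishes_of_primes)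
        show "noeth_module R (quot_module (?RQ p) Im)"
          by (rule noeth_module_image[OF noeth_quot_regular[OF p.is_ideal] module_quot[OF RP Im]
                mod_hom_quot[OF RP Im] quot_module_carrier[OF RP Im, symmetric]])
        fix q assume q: "primeideal q R" "annihilator R (quot_module (?RQ p) Im) \<subseteq> q"
        have ann: "r \<in> q" if r: "r \<in> carrier R" "\<And>s. s \<in> carrier R \<Longrightarrow> r \<odot>\<^bsub>?RQ p\<^esub> (p +>\<^bsub>regular_module R\<^esub> s) \<in> Im" for r
        proof -
          have "r \<odot>\<^bsub>quot_module (?RQ p) Im\<^esub> X = \<zero>\<^bsub>quot_module (?RQ p) Im\<^esub>"
            if X: "X \<in> carrier (quot_module (?RQ p) Im)" for X
          proof -
            obtain s where s: "s \<in> carrier R" "X = Im +>\<^bsub>?RQ p\<^esub> (p +>\<^bsub>regular_module R\<^esub> s)"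
              using X unfolding quot_module_carrier[OF RP Im] quot_module_carrier[OF reg.module_axioms ps]
              by auto
            have sc: "p +>\<^bsub>regular_module R\<^esub> s \<in> carrier (?RQ p)"
              unfolding quot_module_carrier[OF reg.module_axioms ps] using s(1) by simp
            show ?thesis
              unfolding s(2) quot_module_smult[OF RP Im r(1) sc]
              using quot_module_coset_eq_zero_iff[OF RP Im RP.smult_closed[OF r(1) sc]] r(2)[OF s(1)] by blast
          qed
          then show ?thesis
            using q(2) r(1) unfolding annihilator_def by blast
        qed
        have "p \<subseteq> q"
        proof
          fix r assume r: "r \<in> p"
          then have rR: "r \<in> carrier R"
            using p.a_Hcarr by blast
          have "r \<in> annihilator R (?RQ p)"
            using r annihilator_quot_regular[OF p.is_ideal] by blast
          then have "r \<odot>\<^bsub>?RQ p\<^esub> (p +>\<^bsub>regular_module R\<^esub> s) = \<zero>\<^bsub>?RQ p\<^esub>" if "s \<in> carrier R" for s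
            using that unfolding annihilator_def quot_module_carrier[OF reg.module_axioms ps] by simp
          moreover have "\<zero>\<^bsub>?RQ p\<^esub> \<in> Im"
            using Im unfolding RP.submodule_iff by blast
          ultimately show "r \<in> q"
            using rR by (intro ann) auto
        qed
        \<comment> \<open>The cokernel is killed by \<open>t\<close>, since the class of
          \<open>t\<close> is the value of \<open>g\<close> at \<open>x\<close>; a prime containing
          its annihilator is therefore strictly larger than \<open>p\<close>.\<close>
        moreover have "t \<in> q"
        proof (rule ann[OF t(1)])
          fix s assume s: "s \<in> carrier R"
          have "g x = p +>\<^bsub>regular_module R\<^esub> t"
            using x(1) t(1) L'L(2) by (intro g(2)) (auto simp: a_minus_def L.r_neg)
          then have "s \<odot>\<^bsub>?RQ p\<^esub> (p +>\<^bsub>regular_module R\<^esub> t) \<in> Im"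
            using submodule.smult_closed[OF Im s, of "g x"] imageI[OF x(1), of g] unfolding Im_def by simp
          moreover have "s \<odot>\<^bsub>?RQ p\<^esub> (p +>\<^bsub>regular_module R\<^esub> t) = t \<odot>\<^bsub>?RQ p\<^esub> (p +>\<^bsub>regular_module R\<^esub> s)"
            using quot_module_smult[OF reg.module_axioms ps, of s t]
              quot_module_smult[OF reg.module_axioms ps, of t s] s t(1) by (simp add: R.m_comm)
          ultimately show "t \<odot>\<^bsub>?RQ p\<^esub> (p +>\<^bsub>regular_module R\<^esub> s) \<in> Im"
            by simp
        qed
        ultimately have "q \<notin> Bad"
          using pmax[of q] t(2) by blast
        then show "lc_vanishes R \<aa> k (?RQ q)"
          using q(1) \<open>p \<subseteq> q\<close> p(2) unfolding Bad_def by blast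
      qed
      then have "lc_vanishes R \<aa> k (?RQ p)"
        by (rule lc_vanishes_short_exact(1)[OF R \<aa> ex2 vanIm])
      then show False
        using p(3) by blast
    qed
    then show ?case
      using Suc.prems unfolding Bad_def by blast
  qed
qed

end

section \<open>Bounds on cohomological dimension, primes of primary submodules, and the
  filtration\<close>

lemma cd_le_iff: "cd R \<aa> N \<le> ereal (real i) \<longleftrightarrow> (\<forall>k>i. lc_vanishes R \<aa> k N)"
proof -
  have "cd R \<aa> N = Sup {ereal (real k) |k. \<not> lc_vanishes R \<aa> k N}"
    by (simp add: cd_def lc_vanishes_def)
  then have "cd R \<aa> N \<le> ereal (real i) \<longleftrightarrow>
      (\<forall>x\<in>{ereal (real k) |k. \<not> lc_vanishes R \<aa> k N}. x \<le> ereal (real i))"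
    by (simp only: Sup_le_iff)
  also have "\<dots> \<longleftrightarrow> (\<forall>k. \<not> lc_vanishes R \<aa> k N \<longrightarrow> k \<le> i)"
    by auto
  also have "\<dots> \<longleftrightarrow> (\<forall>k>i. lc_vanishes R \<aa> k N)"
    by (meson not_le)
  finally show ?thesis .
qed

text \<open>\<open>p\<close> is the radical of the annihilator of \<open>M/N\<close>. Primality
  comes from applying the primary condition to \<open>a^k\<close> and an element
  \<open>b^k y\<close> outside \<open>N\<close>.\<close>

lemma primary_submodule_prime:
  assumes M: "module R M" and prim: "primary_submodule R M p N"
  shows "primeideal p R"
proof -
  interpret M: module R M by fact
  have N: "submodule N R M" "N \<noteq> carrier M"
    and prim': "\<And>r x. r \<in> carrier R \<Longrightarrow> x \<in> carrier M \<Longrightarrow> r \<odot>\<^bsub>M\<^esub> x \<in> N \<Longrightarrow>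
      x \<in> N \<or> (\<exists>k::nat. \<forall>y\<in>carrier M. (r [^]\<^bsub>R\<^esub> k) \<odot>\<^bsub>M\<^esub> y \<in> N)"
    and p: "p = {r \<in> carrier R. \<exists>k::nat. \<forall>y\<in>carrier M. (r [^]\<^bsub>R\<^esub> k) \<odot>\<^bsub>M\<^esub> y \<in> N}"
    using prim unfolding primary_submodule_def by blast+
  have NM: "N \<subseteq> carrier M" "\<zero>\<^bsub>M\<^esub> \<in> N"
    and Na: "\<And>x y. x \<in> N \<Longrightarrow> y \<in> N \<Longrightarrow> x \<oplus>\<^bsub>M\<^esub> y \<in> N"
    and Ns: "\<And>r x. r \<in> carrier R \<Longrightarrow> x \<in> N \<Longrightarrow> r \<odot>\<^bsub>M\<^esub> x \<in> N"
    using N(1) by (auto simp: M.submodule_iff)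
  obtain x where x: "x \<in> carrier M" "x \<notin> N"
    using N NM by blast
  \<comment> \<open>In place of the binomial theorem: one factor of \<open>(r + s)^(k+l)\<close> is
    split off, lowering the exponent of \<open>r\<close> or of \<open>s\<close>; if either exponent
    is 0, then \<open>z\<close> itself is in \<open>N\<close>.\<close>
  have pow_add: "((r \<oplus>\<^bsub>R\<^esub> s) [^]\<^bsub>R\<^esub> (k + l)) \<odot>\<^bsub>M\<^esub> z \<in> N"
    if "r \<in> carrier R" "s \<in> carrier R" "z \<in> carrier M" "(r [^]\<^bsub>R\<^esub> k) \<odot>\<^bsub>M\<^esub> z \<in> N" "(s [^]\<^bsub>R\<^esub> l) \<odot>\<^bsub>M\<^esub> z \<in> N"
    for r s z and k l :: nat
    using that
  proof (induction "k + l" arbitrary: k l z)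
    case 0
    then show ?case
      by simp
  next
    case (Suc m)
    show ?case
    proof (cases "k = 0 \<or> l = 0")
      case True
      then have "z \<in> N"
        using Suc.prems by auto
      then show ?thesis
        using Suc.prems by (intro Ns) auto
    next
      case False
      then obtain k' l' where kl: "k = Suc k'" "l = Suc l'"
        by (meson not0_implies_Suc)
      have "((r \<oplus>\<^bsub>R\<^esub> s) [^]\<^bsub>R\<^esub> (k' + l)) \<odot>\<^bsub>M\<^esub> (r \<odot>\<^bsub>M\<^esub> z) \<in> N"
      proof (rule Suc.hyps(1))
        show "(r [^]\<^bsub>R\<^esub> k') \<odot>\<^bsub>M\<^esub> (r \<odot>\<^bsub>M\<^esub> z) \<in> N"
          using Suc.prems kl by (simp add: M.smult_assoc1)
        show "(s [^]\<^bsub>R\<^esub> l) \<odot>\<^bsub>M\<^esub> (r \<odot>\<^bsub>M\<^esub> z) \<in> N"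
          using Ns[OF Suc.prems(1) Suc.prems(5)] Suc.prems(1-3) M.smult_commute[of "s [^]\<^bsub>R\<^esub> l" r z] by simp
      qed (use Suc.prems Suc.hyps(2) kl in auto)
      moreover have "((r \<oplus>\<^bsub>R\<^esub> s) [^]\<^bsub>R\<^esub> (k + l')) \<odot>\<^bsub>M\<^esub> (s \<odot>\<^bsub>M\<^esub> z) \<in> N"
      proof (rule Suc.hyps(1))
        show "(s [^]\<^bsub>R\<^esub> l') \<odot>\<^bsub>M\<^esub> (s \<odot>\<^bsub>M\<^esub> z) \<in> N"
          using Suc.prems kl by (simp add: M.smult_assoc1)
        show "(r [^]\<^bsub>R\<^esub> k) \<odot>\<^bsub>M\<^esub> (s \<odot>\<^bsub>M\<^esub> z) \<in> N"
          using Ns[OF Suc.prems(2) Suc.prems(4)] Suc.prems(1-3) M.smult_commute[of "r [^]\<^bsub>R\<^esub> k" s z] by simp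
      qed (use Suc.prems Suc.hyps(2) kl in auto)
      moreover have "((r \<oplus>\<^bsub>R\<^esub> s) [^]\<^bsub>R\<^esub> (k + l)) \<odot>\<^bsub>M\<^esub> z =
          ((r \<oplus>\<^bsub>R\<^esub> s) [^]\<^bsub>R\<^esub> (k' + l)) \<odot>\<^bsub>M\<^esub> (r \<odot>\<^bsub>M\<^esub> z) \<oplus>\<^bsub>M\<^esub> ((r \<oplus>\<^bsub>R\<^esub> s) [^]\<^bsub>R\<^esub> (k + l')) \<odot>\<^bsub>M\<^esub> (s \<odot>\<^bsub>M\<^esub> z)"
      proof -
        have eq: "k + l = Suc (k' + l)" "k + l' = k' + l"
          using kl by simp_all
        show ?thesis
          unfolding eq using Suc.prems(1-3) by (simp add: M.smult_assoc1 M.smult_l_distr M.smult_r_distr)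
      qed
      ultimately show ?thesis
        using Na by simp
    qed
  qed
  interpret reg: module R "regular_module R" by (rule module_regular[OF M.is_cring])
  have "submodule p R (regular_module R)"
    unfolding reg.submodule_iff
  proof (intro conjI ballI)
    show "p \<subseteq> carrier (regular_module R)"
      by (auto simp: p)
    have "(\<zero>\<^bsub>R\<^esub> [^]\<^bsub>R\<^esub> Suc 0) \<odot>\<^bsub>M\<^esub> y \<in> N" if "y \<in> carrier M" for y
      using that NM by simp
    then show "\<zero>\<^bsub>regular_module R\<^esub> \<in> p"
      unfolding p by (auto intro!: exI[of _ "Suc 0"])
    show "r \<oplus>\<^bsub>regular_module R\<^esub> s \<in> p" if rs: "r \<in> p" "s \<in> p" for r s
    proof -
      obtain k l :: nat where "\<forall>y\<in>carrier M. (r [^]\<^bsub>R\<^esub> k) \<odot>\<^bsub>M\<^esub> y \<in> N" "\<forall>y\<in>carrier M. (s [^]\<^bsub>R\<^esub> l) \<odot>\<^bsub>M\<^esub> y \<in> N"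
        using rs unfolding p by blast
      then have "\<forall>y\<in>carrier M. ((r \<oplus>\<^bsub>R\<^esub> s) [^]\<^bsub>R\<^esub> (k + l)) \<odot>\<^bsub>M\<^esub> y \<in> N"
        using pow_add rs unfolding p by blast
      then show ?thesis
        using rs unfolding p by auto
    qed
    show "a \<odot>\<^bsub>regular_module R\<^esub> r \<in> p" if a: "a \<in> carrier R" and r: "r \<in> p" for a r
    proof -
      obtain k :: nat where k: "r \<in> carrier R" "\<And>y. y \<in> carrier M \<Longrightarrow> (r [^]\<^bsub>R\<^esub> k) \<odot>\<^bsub>M\<^esub> y \<in> N"
        using r unfolding p by blast
      have "((a \<otimes>\<^bsub>R\<^esub> r) [^]\<^bsub>R\<^esub> k) \<odot>\<^bsub>M\<^esub> y \<in> N" if "y \<in> carrier M" for y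
        using k a that Ns[of "a [^]\<^bsub>R\<^esub> k"] by (simp add: M.nat_pow_distrib M.smult_assoc1)
      then show ?thesis
        using a k(1) unfolding p by auto
    qed
  qed
  then have ideal: "ideal p R"
    by (simp add: submodule_regular_iff M.is_cring)
  show ?thesis
  proof (rule primeidealI[OF ideal M.is_cring])
    have "\<one>\<^bsub>R\<^esub> \<notin> p"
      using x unfolding p by auto
    then show "carrier R \<noteq> p"
      by auto
    fix a b assume ab: "a \<in> carrier R" "b \<in> carrier R" "a \<otimes>\<^bsub>R\<^esub> b \<in> p"
    then obtain k :: nat where k: "\<And>y. y \<in> carrier M \<Longrightarrow> ((a \<otimes>\<^bsub>R\<^esub> b) [^]\<^bsub>R\<^esub> k) \<odot>\<^bsub>M\<^esub> y \<in> N"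
      unfolding p by blast
    show "a \<in> p \<or> b \<in> p"
    proof (rule disjCI)
      assume "b \<notin> p"
      then obtain y where y: "y \<in> carrier M" "(b [^]\<^bsub>R\<^esub> k) \<odot>\<^bsub>M\<^esub> y \<notin> N"
        using ab(2) unfolding p by blast
      have "(a [^]\<^bsub>R\<^esub> k) \<odot>\<^bsub>M\<^esub> ((b [^]\<^bsub>R\<^esub> k) \<odot>\<^bsub>M\<^esub> y) \<in> N"
        using k[OF y(1)] ab y(1) by (simp add: M.nat_pow_distrib M.smult_assoc1)
      then obtain l :: nat where "\<And>y. y \<in> carrier M \<Longrightarrow> ((a [^]\<^bsub>R\<^esub> k) [^]\<^bsub>R\<^esub> l) \<odot>\<^bsub>M\<^esub> y \<in> N"
        using prim'[of "a [^]\<^bsub>R\<^esub> k" "(b [^]\<^bsub>R\<^esub> k) \<odot>\<^bsub>M\<^esub> y"] ab y by auto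
      then show "a \<in> p"
        using ab(1) unfolding p by (auto simp: M.nat_pow_pow)
    qed
  qed
qed

theorem corollary2p28:
  fixes R :: "('a, 'r) ring_scheme"
    and \<aa> :: "'a set"
    and M :: "('a, 'b, 'm) module_scheme"
    and n :: nat
    and \<pp> :: "nat \<Rightarrow> 'a set"
    and N :: "nat \<Rightarrow> 'b set"
  assumes "cring R" and "noetherian_ring R"
    and "ideal \<aa> R" and "\<aa> \<noteq> carrier R"
    and "fg_module R M"
    and "reduced_primary_decomposition_of_zero R M n \<pp> N"
    and "cd R \<aa> (M\<lparr>carrier :=
           carrier M \<inter> (\<Inter>j\<in>{j\<in>{1..n}. cd R \<aa> (quot_module (regular_module R) (\<pp> j)) > 0}. N j)\<rparr>) = 0"
  shows "is_cd_filtration R \<aa> M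
           (\<lambda>i. carrier M \<inter>
             (\<Inter>j\<in>{j\<in>{1..n}. cd R \<aa> (quot_module (regular_module R) (\<pp> j)) > ereal (real i)}. N j))"
proof -
  note R = assms(1-3)
  have Mn: "noeth_module R M"
    by (rule fg_imp_noeth_module[OF assms(2,5)])
  interpret M: module R M using Mn by (rule noeth_moduleD)
  let ?RQ = "\<lambda>q. quot_module (regular_module R) q"
  define J where "J i = {j \<in> {1..n}. cd R \<aa> (?RQ (\<pp> j)) > ereal (real i)}" for i :: nat
  define F where "F i = carrier M \<inter> (\<Inter>j\<in>J i. N j)" for i
  have prim: "primary_submodule R M (\<pp> j) (N j)" if "j \<in> {1..n}" for j
    using assms(6) that unfolding reduced_primary_decomposition_of_zero_def by blast
  have zero: "carrier M \<inter> (\<Inter>j\<in>{1..n}. N j) = {\<zero>\<^bsub>M\<^esub>}"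
    using assms(6) unfolding reduced_primary_decomposition_of_zero_def by blast
  have prime: "primeideal (\<pp> j) R" if "j \<in> {1..n}" for j
    by (rule primary_submodule_prime[OF M.module_axioms prim[OF that]])
  have N: "submodule (N j) R M" if "j \<in> {1..n}" for j
    using prim[OF that] unfolding primary_submodule_def by blast
  have p_eq: "\<pp> j = {r \<in> carrier R. \<exists>k::nat. \<forall>y\<in>carrier M. (r [^]\<^bsub>R\<^esub> k) \<odot>\<^bsub>M\<^esub> y \<in> N j}" if "j \<in> {1..n}" for j
    using prim[OF that] unfolding primary_submodule_def by blast
  have F: "submodule (F i) R M" for i
    unfolding F_def by (rule M.submodule_Inter) (auto simp: J_def N)
  have mono: "F i \<subseteq> F j" if "i \<le> j" for i j
  proof -
    have "J j \<subseteq> J i"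
      using that by (auto simp: J_def intro: le_less_trans[rotated])
    then show ?thesis
      by (auto simp: F_def)
  qed
  have cdF: "cd R \<aa> (M\<lparr>carrier := F i\<rparr>) \<le> ereal (real i)" for i
    unfolding cd_le_iff
  proof (intro allI impI)
    fix k assume k: "k > i"
    show "lc_vanishes R \<aa> k (M\<lparr>carrier := F i\<rparr>)"
    proof (rule lc_vanishes_of_primes[OF R noeth_module_submodule[OF Mn F]])
      fix q assume q: "primeideal q R" "annihilator R (M\<lparr>carrier := F i\<rparr>) \<subseteq> q"
      interpret q: primeideal q R by (rule q(1))
      \<comment> \<open>Otherwise suitable powers of elements outside \<open>q\<close>, one from
        each remaining prime, multiply to an \<open>r\<close> outside \<open>q\<close> that sends
        \<open>M\<close> into every \<open>N j\<close> with \<open>j \<notin> J i\<close>.\<close>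
      have "\<exists>j\<in>{1..n} - J i. \<pp> j \<subseteq> q"
      proof (rule ccontr)
        assume neg: "\<not> (\<exists>j\<in>{1..n} - J i. \<pp> j \<subseteq> q)"
        have "\<exists>r\<in>carrier R. r \<notin> q \<and> (\<forall>j\<in>G. \<forall>y\<in>carrier M. r \<odot>\<^bsub>M\<^esub> y \<in> N j)"
          if "finite G" "G \<subseteq> {1..n} - J i" for G
          using that
        proof (induction G rule: finite_induct)
          case empty
          have "\<one>\<^bsub>R\<^esub> \<notin> q"
            using q.I_notcarr q.one_imp_carrier by blast
          then show ?case
            by auto
        next
          case (insert j G)
          then obtain r where r: "r \<in> carrier R" "r \<notin> q" "\<forall>j\<in>G. \<forall>y\<in>carrier M. r \<odot>\<^bsub>M\<^esub> y \<in> N j"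
            by auto
          have jn: "j \<in> {1..n}"
            using insert.prems by auto
          obtain s where s: "s \<in> \<pp> j" "s \<notin> q"
            using neg insert.prems by blast
          then obtain l :: nat where l: "s \<in> carrier R" "\<And>y. y \<in> carrier M \<Longrightarrow> (s [^]\<^bsub>R\<^esub> l) \<odot>\<^bsub>M\<^esub> y \<in> N j"
            using p_eq[OF jn] by blast
          have "s [^]\<^bsub>R\<^esub> m \<notin> q" for m :: nat
          proof (induction m)
            case 0
            then show ?case
              using q.I_notcarr q.one_imp_carrier by auto
          next
            case (Suc m)
            then show ?case
              using q.I_prime[of "s [^]\<^bsub>R\<^esub> m" s] s(2) l(1) by auto
          qed
          then have "r \<otimes>\<^bsub>R\<^esub> s [^]\<^bsub>R\<^esub> l \<notin> q"
            using q.I_prime[of r "s [^]\<^bsub>R\<^esub> l"] r l(1) by auto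
          moreover have "(r \<otimes>\<^bsub>R\<^esub> s [^]\<^bsub>R\<^esub> l) \<odot>\<^bsub>M\<^esub> y \<in> N j'" if y: "y \<in> carrier M" and j': "j' \<in> insert j G" for y j'
          proof (cases "j' = j")
            case True
            then show ?thesis
              using submodule.smult_closed[OF N[OF jn] r(1) l(2)[OF y]] r(1) l(1) y by (simp add: M.smult_assoc1)
          next
            case False
            then show ?thesis
              using r(1,3) l(1) y j' by (simp add: M.smult_assoc1)
          qed
          ultimately show ?case
            using r(1) l(1) by (intro bexI[of _ "r \<otimes>\<^bsub>R\<^esub> s [^]\<^bsub>R\<^esub> l"]) auto
        qed
        then obtain r where r: "r \<in> carrier R" "r \<notin> q" "\<forall>j\<in>{1..n} - J i. \<forall>y\<in>carrier M. r \<odot>\<^bsub>M\<^esub> y \<in> N j"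
          by (meson finite_Diff finite_atLeastAtMost order_refl)
        \<comment> \<open>Membership in \<open>F i\<close> handles the indices in \<open>J i\<close>
          and the choice of \<open>r\<close> the others, so \<open>r y\<close> lies in the whole
          intersection, which is zero.\<close>
        have "r \<odot>\<^bsub>M\<^esub> y = \<zero>\<^bsub>M\<^esub>" if y: "y \<in> F i" for y
        proof -
          have yM: "y \<in> carrier M"
            using y by (simp add: F_def)
          have "r \<odot>\<^bsub>M\<^esub> y \<in> F i"
            by (rule submodule.smult_closed[OF F r(1) y])
          then have "r \<odot>\<^bsub>M\<^esub> y \<in> N j" if "j \<in> {1..n}" for j
            using r(3) yM that by (cases "j \<in> J i") (auto simp: F_def)
          then have "r \<odot>\<^bsub>M\<^esub> y \<in> carrier M \<inter> (\<Inter>j\<in>{1..n}. N j)"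
            using r(1) yM by blast
          then show ?thesis
            unfolding zero by simp
        qed
        then have "r \<in> annihilator R (M\<lparr>carrier := F i\<rparr>)"
          using r(1) by (simp add: annihilator_def)
        then show False
          using q(2) r(2) by blast
      qed
      then obtain j where j: "j \<in> {1..n}" "j \<notin> J i" "\<pp> j \<subseteq> q"
        by blast
      have ideal: "ideal (\<pp> j) R"
        using prime[OF j(1)] by (simp add: primeideal_def)
      have "cd R \<aa> (?RQ (\<pp> j)) \<le> ereal (real i)"
        using j(1,2) by (simp add: J_def not_less)
      then have "lc_vanishes R \<aa> l (?RQ (\<pp> j))" if "l > i" for l
        using that unfolding cd_le_iff by blast
      \<comment> \<open>The module from which vanishing descends to \<open>R/q\<close> is
        \<open>R/\<pp> j\<close> itself, whose annihilator is \<open>\<pp> j\<close>.\<close>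
      then show "lc_vanishes R \<aa> k (?RQ q)"
        using j(3) annihilator_quot_regular[OF R ideal]
        by (intro lc_vanishes_quot_prime[OF R noeth_quot_regular[OF R ideal] _ q(1) _ k]) auto
    qed
  qed
  have largest: "L \<subseteq> F i" if L: "submodule L R M" and cdL: "cd R \<aa> (M\<lparr>carrier := L\<rparr>) \<le> ereal (real i)" for L i
  proof -
    have LM: "L \<subseteq> carrier M"
      by (rule M.submoduleE(1)[OF L])
    have "L \<subseteq> N j" if j: "j \<in> J i" for j
    proof (rule ccontr)
      assume "\<not> L \<subseteq> N j"
      then obtain x where x: "x \<in> L" "x \<notin> N j"
        by blast
      have jn: "j \<in> {1..n}"
        using j by (simp add: J_def)
      \<comment> \<open>An annihilating element kills \<open>x\<close>, which lies outside
        \<open>N j\<close>, so by the primary condition some power of it maps \<open>M\<close> into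
        \<open>N j\<close>.\<close>
      have "annihilator R (M\<lparr>carrier := L\<rparr>) \<subseteq> \<pp> j"
      proof
        fix r assume "r \<in> annihilator R (M\<lparr>carrier := L\<rparr>)"
        then have r: "r \<in> carrier R" "r \<odot>\<^bsub>M\<^esub> x = \<zero>\<^bsub>M\<^esub>"
          using x(1) by (auto simp: annihilator_def)
        have "r \<odot>\<^bsub>M\<^esub> x \<in> N j"
          using N[OF jn] r(2) by (simp add: M.submodule_iff)
        then have "\<exists>k::nat. \<forall>y\<in>carrier M. (r [^]\<^bsub>R\<^esub> k) \<odot>\<^bsub>M\<^esub> y \<in> N j"
          using prim[OF jn] r(1) x LM unfolding primary_submodule_def by blast
        then show "r \<in> \<pp> j"
          unfolding p_eq[OF jn] using r(1) by simp
      qed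
      moreover have "lc_vanishes R \<aa> l (M\<lparr>carrier := L\<rparr>)" if "l > i" for l
        using cdL that unfolding cd_le_iff by blast
      ultimately have "lc_vanishes R \<aa> k (?RQ (\<pp> j))" if "k > i" for k
        using that by (intro lc_vanishes_quot_prime[OF R noeth_module_submodule[OF Mn L] _ prime[OF jn]])
      then have "cd R \<aa> (?RQ (\<pp> j)) \<le> ereal (real i)"
        unfolding cd_le_iff by blast
      then show False
        using j by (simp add: J_def not_le[symmetric])
    qed
    then show ?thesis
      using LM by (auto simp: F_def)
  qed
  show ?thesis
    unfolding is_cd_filtration_def J_def[symmetric] F_def[symmetric]
    using mono F cdF largest by blast
qed

end
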